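(* Let $d\ge3$ be a fixed integer. For even $n$, let $C_n$ be the adjacency matrix of the random $d$-regular graph $H_n$. Then, as $n\to\infty$ along even integers, $$\mathbb{P}(C_n\text{ is singular in }\mathbb{R})=o(1).$$
   Context: $H_n$ ($n$ even) is the union (with multiplicity) of $d$ independent uniform random perfect matchings of $\{1,\dots,n\}$; thus $C_n=M_1+\dots+M_d$, where $M_1,\dots,M_d$ are independent uniform random $n\times n$ permutation matrices of fixed point free involutions. "Singular in $\mathbb{R}$" means singular as a real matrix. *)

theory Defs
  imports "HOL-Probability.Probability" "Jordan_Normal_Form.Matrix"
begin

definition perfect_matchings :: "nat \<Rightarrow> nat set set set" where
  "perfect_matchings n = {M. partition_on {1..n} M \<and> (\<forall>e\<in>M. card e = 2)}"

text \<open>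
  A multigraph on the vertex set \<open>{1..n}\<close> is given by its multiset of edges. Matrix indices
  start at \<open>0\<close>, so vertex \<open>i + 1\<close> belongs to row and column \<open>i\<close>.
\<close>

definition adjacency_matrix :: "nat \<Rightarrow> nat set multiset \<Rightarrow> real mat" where
  "adjacency_matrix n H = mat n n (\<lambda>(i, j). real (count H {i + 1, j + 1}))"

text \<open>
  The law of the union, with multiplicities, of \<open>d\<close> independent uniform perfect matchings. For odd
  \<open>n\<close> there are no perfect matchings, and the value is then unspecified.
\<close>

definition random_regular_graph :: "nat \<Rightarrow> nat \<Rightarrow> nat set multiset pmf" where
  "random_regular_graph d n =
     map_pmf (\<lambda>M. \<Sum>k<d. mset_set (M k))
       (Pi_pmf {..<d} {} (\<lambda>_. pmf_of_set (perfect_matchings n)))"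

lemma finite_perfect_matchings: "finite (perfect_matchings n)"
proof (rule finite_subset)
  show "perfect_matchings n \<subseteq> Pow (Pow {1..n})"
    by (auto simp: perfect_matchings_def partition_on_def)
qed auto

lemma perfect_matchings_nonempty:
  assumes "even n"
  shows "perfect_matchings n \<noteq> {}"
proof -
  have "\<exists>M. M \<in> perfect_matchings (2 * m)" for m
  proof (induction m)
    case 0
    have "{} \<in> perfect_matchings (2 * 0)"
      by (auto simp: perfect_matchings_def partition_on_def)
    then show ?case by blast
  next
    case (Suc m)
    then obtain M where M: "partition_on {1..2*m} M" "\<forall>e\<in>M. card e = 2"
      by (auto simp: perfect_matchings_def)
    have "partition_on {1..2*Suc m} (insert {2*m+1, 2*m+2} M)"
    proof (rule partition_onI)
      show "\<Union> (insert {2*m+1, 2*m+2} M) = {1..2 * Suc m}"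
      proof -
        have "{1..2 * Suc m} = {2*m+1, 2*m+2} \<union> {1..2*m}" by auto
        then show ?thesis using partition_onD1[OF M(1)] by simp
      qed
    next
      fix p q assume pq: "p \<in> insert {2*m+1, 2*m+2} M" "q \<in> insert {2*m+1, 2*m+2} M" "p \<noteq> q"
      have new: "disjnt {2*m+1, 2*m+2} e" if "e \<in> M" for e
      proof -
        have "e \<subseteq> {1..2*m}" using partition_onD1[OF M(1)] that by blast
        then have "2*m+1 \<notin> e" "2*m+2 \<notin> e" by auto
        then show ?thesis by simp
      qed
      consider "p \<in> M" "q \<in> M" | "p = {2*m+1, 2*m+2}" "q \<in> M" | "p \<in> M" "q = {2*m+1, 2*m+2}"
        using pq by blast
      then show "disjnt p q"
      proof cases
        case 1
        then show ?thesis
          using disjointD[OF partition_onD2[OF M(1)] _ _ pq(3)] by (simp add: disjnt_def)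
      next
        case 2
        then show ?thesis using new by simp
      next
        case 3
        show ?thesis unfolding 3(2) by (rule disjnt_sym, rule new, rule 3(1))
      qed
    next
      show "{} \<notin> insert {2*m+1, 2*m+2} M"
        using M by (auto simp: partition_on_def)
    qed
    moreover have "card {2*m+1, 2*m+2::nat} = 2" by simp
    ultimately have "insert {2*m+1, 2*m+2} M \<in> perfect_matchings (2 * Suc m)"
      using M(2) unfolding perfect_matchings_def by blast
    then show ?case by blast
  qed
  moreover obtain m where "n = 2 * m" using assms by (rule evenE)
  ultimately show ?thesis by blast
qed

lemma adjacency_matrix_union_matchings:
  assumes "\<And>k. k < d \<Longrightarrow> M k \<in> perfect_matchings n" and "i < n" "j < n"
  shows "adjacency_matrix n (\<Sum>k<d. mset_set (M k)) $$ (i, j) =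
           (\<Sum>k<d. of_bool ({i + 1, j + 1} \<in> M k))"
proof -
  have "finite (M k)" if "k < d" for k
    using assms(1)[OF that] finite_elements[of "{1..n}" "M k"]
    by (auto simp: perfect_matchings_def)
  then have "(\<Sum>k<d. real (count (mset_set (M k)) {i + 1, j + 1})) = (\<Sum>k<d. of_bool ({i + 1, j + 1} \<in> M k))"
    by (intro sum.cong) (auto simp: count_mset_set')
  with assms(2,3) show ?thesis
    by (simp add: adjacency_matrix_def count_sum)
qed

lemma bij_betw_involutions_perfect_matchings:
  "bij_betw (\<lambda>\<sigma>. (\<lambda>i. {i, \<sigma> i}) ` {1..n})
     {\<sigma>. \<sigma> permutes {1..n} \<and> \<sigma> \<circ> \<sigma> = id \<and> (\<forall>i\<in>{1..n}. \<sigma> i \<noteq> i)} (perfect_matchings n)"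
  (is "bij_betw ?f ?I _")
proof (rule bij_betw_imageI)
  show "inj_on ?f ?I"
  proof (rule inj_onI, rule ext)
    fix s t i assume s: "s \<in> ?I" and t: "t \<in> ?I" and eq: "?f s = ?f t"
    show "s i = t i"
    proof (cases "i \<in> {1..n}")
      case True
      then have "{i, s i} \<in> ?f t" using eq by blast
      then obtain j where j: "j \<in> {1..n}" "{i, s i} = {j, t j}" by blast
      have "t (t j) = j" using t by (metis (mono_tags) comp_apply id_apply mem_Collect_eq)
      with j s t True show ?thesis by (auto simp: doubleton_eq_iff)
    next
      case False
      then show ?thesis using s t by (simp add: permutes_def)
    qed
  qed
  show "?f ` ?I = perfect_matchings n"
  proof (intro equalityI subsetI)
    fix M assume "M \<in> ?f ` ?I"
    then obtain s where s: "s permutes {1..n}" "s \<circ> s = id" "\<forall>i\<in>{1..n}. s i \<noteq> i" "M = ?f s"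
      by blast
    have ss: "s (s i) = i" for i using s(2) by (metis comp_apply id_apply)
    have "partition_on {1..n} M"
    proof (rule partition_onI)
      show "\<Union> M = {1..n}" using s(4) permutes_in_image[OF s(1)] by (auto simp del: atLeastAtMost_iff)
      show "{} \<notin> M" unfolding s(4) by blast
      fix p q assume pq: "p \<in> M" "q \<in> M" "p \<noteq> q"
      then obtain i j where ij: "p = {i, s i}" "q = {j, s j}" using s(4) by blast
      have "i \<noteq> j" using ij pq(3) by blast
      moreover have "i \<noteq> s j" using ij pq(3) ss[of j] by (metis insert_commute)
      moreover have "s i \<noteq> j" using ij pq(3) ss[of i] by (metis insert_commute)
      moreover have "s i \<noteq> s j" using ss[of i] ss[of j] \<open>i \<noteq> j\<close> by metis
      ultimately show "disjnt p q" by (simp add: ij disjnt_def)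
    qed
    moreover have "\<forall>e\<in>M. card e = 2" using s(3,4) by (auto simp: card_2_iff)
    ultimately show "M \<in> perfect_matchings n" by (simp add: perfect_matchings_def)
  next
    fix M assume "M \<in> perfect_matchings n"
    then have M: "partition_on {1..n} M" "\<And>e. e \<in> M \<Longrightarrow> card e = 2"
      by (auto simp: perfect_matchings_def)
    have uniq: "\<exists>!j. {i, j} \<in> M" if i: "i \<in> {1..n}" for i
    proof -
      obtain e where e: "e \<in> M" "i \<in> e" using partition_onD1[OF M(1)] i by blast
      with M(2)[of e] obtain j where j: "e = {i, j}" "i \<noteq> j"
        by (auto simp: card_2_iff)
      show ?thesis
      proof (rule ex1I)
        show "{i, j} \<in> M" using e j by simp
        fix k assume k: "{i, k} \<in> M"
        then have "{i, k} = {i, j}" 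
          using disjointD[OF partition_onD2[OF M(1)] k, of e] e j by blast
        then show "k = j" by (auto simp: doubleton_eq_iff)
      qed
    qed
    define s where "s = (\<lambda>i. if i \<in> {1..n} then THE j. {i, j} \<in> M else i)"
    have s_in: "{i, s i} \<in> M" if "i \<in> {1..n}" for i
      using theI'[OF uniq[OF that]] that by (simp add: s_def)
    have sV: "s i \<in> {1..n}" if "i \<in> {1..n}" for i
      using s_in[OF that] partition_onD1[OF M(1)] by blast
    have s_ne: "s i \<noteq> i" if "i \<in> {1..n}" for i
      using M(2)[OF s_in[OF that]] by auto
    have ss: "s (s i) = i" for i
    proof (cases "i \<in> {1..n}")
      case True
      then show ?thesis using s_in[OF sV[OF True]] s_in[OF True] uniq[OF sV[OF True]]
        by (metis insert_commute)
    next
      case False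
      then have "s i = i" unfolding s_def by (rule if_not_P)
      then show ?thesis by simp
    qed
    have "s permutes {1..n}"
      unfolding permutes_def
    proof (intro conjI allI impI)
      show "s x = x" if "x \<notin> {1..n}" for x using that by (auto simp: s_def)
      show "\<exists>!x. s x = y" for y by (metis ss)
    qed
    moreover have "s \<circ> s = id" using ss by auto
    moreover have "M = ?f s"
    proof (intro equalityI subsetI)
      fix e assume e: "e \<in> M"
      then obtain i j where ij: "e = {i, j}" using M(2)[OF e] by (auto simp: card_2_iff)
      then have "i \<in> {1..n}" using e partition_onD1[OF M(1)] by blast
      moreover from this have "j = s i" using uniq[of i] s_in[of i] e ij by blast
      ultimately show "e \<in> ?f s" using ij by blast
    qed (use s_in in auto)
    ultimately show "M \<in> ?f ` ?I" using s_ne by blast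
  qed
qed

end

theory Submission
  imports Defs "Jordan_Normal_Form.Determinant" "HOL-Library.Function_Algebras"
    "HOL-Computational_Algebra.Primes" "HOL-Real_Asymp.Real_Asymp"
begin

text \<open>
  An integer matrix that is singular over the reals is singular modulo every prime \<open>p\<close>, so it is
  enough to show that, for each large prime \<open>p\<close>, the matrix \<open>C\<^sub>n\<close> is singular modulo \<open>p\<close> with
  probability at most \<open>3 / (p - 1)\<close> once \<open>n\<close> is large (\<open>singular_mod_p_rare\<close>), and then to let \<open>p\<close> grow. A
  nonzero kernel modulo \<open>p\<close> has at least \<open>p - 1\<close> nonzero elements, so it suffices to bound the
  expected number of nonzero kernel vectors by \<open>3\<close>.

  Fix \<open>p\<close> and a vector \<open>x\<close> of residues. The tuple of matchings \<open>M\<close> turns \<open>x\<close> into an array with one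
  column \<open>(x\<^sub>j, (x (M\<^sub>i j))\<^sub>i)\<close> for each vertex \<open>j\<close>; here \<open>C\<^sub>n x = 0\<close> says that the last \<open>d\<close> entries of
  every column add up to \<open>0\<close>. The number of tuples \<open>M\<close> that yield a given array depends only on how
  often each column occurs, its type, and is an explicit product of factorials
  (\<open>card_compatible_matchings\<close>). Three ranges of types behave differently.

  For a type \<open>n Q\<close> with \<open>Q\<close> fixed the expected number of pairs is \<open>exp (n \<Phi>(Q))\<close> up to a polynomial
  factor, with \<open>\<Phi>(Q) = H(X, Y\<^sub>1, \<dots>, Y\<^sub>d) - 1/2 \<Sum>\<^sub>i H(X, Y\<^sub>i)\<close>. As \<open>Y\<^sub>1 + \<dots> + Y\<^sub>d = 0\<close>, any \<open>d - 1\<close> of the \<open>Y\<^sub>i\<close>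
  determine the last one, so subadditivity of entropy bounds \<open>H(X, Y\<^sub>1, \<dots>, Y\<^sub>d)\<close> in \<open>d\<close> ways. The average
  of these bounds gives \<open>\<Phi> \<le> 0\<close> as soon as \<open>d \<ge> 3\<close>, with equality only for the uniform law and for the
  point mass at the zero column (\<open>growth_rate_extremal\<close>). By compactness all types away from these
  two contribute an exponentially small amount (\<open>atypical_solutions_rare\<close>).

  Types near the zero column belong to sparse \<open>x\<close>. The support \<open>S\<close> of such a kernel vector is
  exceptional: no vertex has exactly one edge into \<open>S\<close>. This makes the neighbourhood of \<open>S\<close> too small,
  and a union bound gives \<open>O(n\<^sup>-\<^sup>1\<^sup>/\<^sup>2)\<close> (\<open>sparse_solutions_rare\<close>).

  Types near the uniform one carry an expected number of order \<open>1\<close>, which has to be bounded by a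
  constant that does not grow with \<open>p\<close>. Instead of evaluating it, it is compared with the
  expected number of solutions of \<open>C\<^sub>n x = \<gamma> e\<^sub>v\<close>, for every \<open>\<gamma>\<close> and every unit vector \<open>e\<^sub>v\<close>: a bounded number
  of columns can be exchanged so that one column acquires the sum \<open>\<gamma>\<close> while all counts stay
  admissible, and near the uniform type this changes the number of matchings by a factor close to
  the expected one (\<open>balance_column\<close>, \<open>typical_solutions_transfer\<close>). On the other hand, the
  solutions of \<open>C\<^sub>n x = \<gamma> e\<^sub>v\<close> form a coset of the kernel or the empty set, and they exist for \<open>\<gamma> \<noteq> 0\<close> only
  if every kernel vector vanishes at \<open>v\<close>, because \<open>C\<^sub>n\<close> is symmetric. A kernel vector of nearly uniform
  type vanishes only at about \<open>n / p\<close> vertices. Averaging over \<open>v\<close> and \<open>\<gamma>\<close> thus bounds the expected number of typical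
  kernel vectors by a constant.
\<close>

section \<open>Perfect matchings with prescribed labels\<close>

definition fpf_involutions :: "'a set \<Rightarrow> ('a \<Rightarrow> 'a) set" where
  "fpf_involutions V = {\<sigma>. \<sigma> permutes V \<and> \<sigma> \<circ> \<sigma> = id \<and> (\<forall>i\<in>V. \<sigma> i \<noteq> i)}"

text \<open>
  The number of perfect matchings of a set of \<open>k\<close> points: \<open>(k - 1)!!\<close> for even \<open>k\<close>, and \<open>0\<close> for odd \<open>k\<close>.
\<close>

fun odd_fact :: "nat \<Rightarrow> nat" where
  "odd_fact 0 = 1"
| "odd_fact (Suc 0) = 0"
| "odd_fact (Suc (Suc k)) = Suc k * odd_fact k"

definition pair_count :: "'v set \<Rightarrow> ('v \<Rightarrow> 'a) \<Rightarrow> ('v \<Rightarrow> 'a) \<Rightarrow> 'a \<Rightarrow> 'a \<Rightarrow> nat" where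
  "pair_count V x y s t = card {j\<in>V. x j = s \<and> y j = t}"

text \<open>
  A matching that sends label pairs \<open>(s, t)\<close> to \<open>(t, s)\<close> is a bijection between two classes if
  \<open>s \<noteq> t\<close>, and a matching inside one class if \<open>s = t\<close>. The bijection is accounted for at the pair with
  \<open>s < t\<close>, so the pair with \<open>s > t\<close> gets weight \<open>1\<close>.
\<close>

definition pair_weight :: "'a::linorder \<Rightarrow> 'a \<Rightarrow> nat \<Rightarrow> nat" where
  "pair_weight s t m = (if s < t then fact m else if s = t then odd_fact m else 1)"

lemma fpf_involutionsD:
  assumes "\<sigma> \<in> fpf_involutions V"
  shows "\<sigma> (\<sigma> j) = j" "j \<in> V \<Longrightarrow> \<sigma> j \<in> V" "j \<in> V \<Longrightarrow> \<sigma> j \<noteq> j" "j \<notin> V \<Longrightarrow> \<sigma> j = j"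
  using assms unfolding fpf_involutions_def
  by (auto simp: permutes_in_image permutes_not_in) (metis comp_apply id_apply)

lemma fpf_involutionsI:
  assumes "\<And>j. \<sigma> (\<sigma> j) = j" "\<And>j. j \<in> V \<Longrightarrow> \<sigma> j \<noteq> j" "\<And>j. j \<notin> V \<Longrightarrow> \<sigma> j = j"
  shows "\<sigma> \<in> fpf_involutions V"
  unfolding fpf_involutions_def permutes_def
  using assms by (auto simp: fun_eq_iff) metis+

lemma finite_fpf_involutions: "finite V \<Longrightarrow> finite (fpf_involutions V)"
  by (rule finite_subset[OF _ finite_permutations]) (auto simp: fpf_involutions_def)

lemma fpf_involutions_empty: "fpf_involutions {} = {id}"
  by (auto simp: fpf_involutions_def)

text \<open>
  The recursion behind all counting of matchings: deleting the edge at a chosen vertex.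
\<close>

lemma bij_betw_fpf_involutions_delete_edge:
  assumes "v \<in> V" "w \<in> V" "v \<noteq> w"
  shows "bij_betw (\<lambda>\<tau> j. if j = v then w else if j = w then v else \<tau> j)
           (fpf_involutions (V - {v, w})) {\<sigma> \<in> fpf_involutions V. \<sigma> v = w}" (is "bij_betw ?f ?A ?B")
proof (rule bij_betw_byWitness[where f' = "\<lambda>\<sigma> j. if j = v then v else if j = w then w else \<sigma> j"])
  show "\<forall>a\<in>?A. (\<lambda>j. if j = v then v else if j = w then w else ?f a j) = a"
    using fpf_involutionsD(4) by (fastforce simp: fun_eq_iff)
  show "\<forall>\<sigma>\<in>?B. ?f (\<lambda>j. if j = v then v else if j = w then w else \<sigma> j) = \<sigma>"
    using fpf_involutionsD(1) by (fastforce simp: fun_eq_iff)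
  show "?f ` ?A \<subseteq> ?B"
  proof
    fix \<sigma> assume "\<sigma> \<in> ?f ` ?A"
    then obtain \<tau> where \<tau>: "\<tau> \<in> ?A" and eq: "\<sigma> = ?f \<tau>" by blast
    have a: "\<tau> v = v" "\<tau> w = w" using fpf_involutionsD(4)[OF \<tau>] by auto
    have b: "\<tau> j \<noteq> v" "\<tau> j \<noteq> w" if "j \<noteq> v" "j \<noteq> w" for j
      using fpf_involutionsD(1)[OF \<tau>, of j] a that by metis+
    have "?f \<tau> \<in> fpf_involutions V"
      using assms a b fpf_involutionsD[OF \<tau>] by (intro fpf_involutionsI) (auto split: if_splits)
    then show "\<sigma> \<in> ?B" unfolding eq by simp
  qed
  show "(\<lambda>\<sigma> j. if j = v then v else if j = w then w else \<sigma> j) ` ?B \<subseteq> ?A"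
  proof
    fix \<tau> assume "\<tau> \<in> (\<lambda>\<sigma> j. if j = v then v else if j = w then w else \<sigma> j) ` ?B"
    then obtain \<sigma> where \<sigma>: "\<sigma> \<in> fpf_involutions V" "\<sigma> v = w"
      and eq: "\<tau> = (\<lambda>j. if j = v then v else if j = w then w else \<sigma> j)" by blast
    have a: "\<sigma> w = v" using fpf_involutionsD(1)[OF \<sigma>(1), of v] \<sigma>(2) by simp
    have b: "\<sigma> j \<noteq> v" "\<sigma> j \<noteq> w" if "j \<noteq> v" "j \<noteq> w" for j
      using fpf_involutionsD(1)[OF \<sigma>(1), of j] a \<sigma>(2) that by metis+
    show "\<tau> \<in> ?A" unfolding eq
    proof (rule fpf_involutionsI)
      fix j
      show "(if (if j = v then v else if j = w then w else \<sigma> j) = v then v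
          else if (if j = v then v else if j = w then w else \<sigma> j) = w then w
          else \<sigma> (if j = v then v else if j = w then w else \<sigma> j)) = j"
        using b[of j] fpf_involutionsD(1)[OF \<sigma>(1), of j] by simp
      show "(if j = v then v else if j = w then w else \<sigma> j) \<noteq> j" if "j \<in> V - {v, w}"
        using that fpf_involutionsD(3)[OF \<sigma>(1), of j] by simp
      show "(if j = v then v else if j = w then w else \<sigma> j) = j" if "j \<notin> V - {v, w}"
        using that fpf_involutionsD(4)[OF \<sigma>(1), of j] by auto
    qed
  qed
qed

definition compatible_matchings :: "'v set \<Rightarrow> ('v \<Rightarrow> 'a) \<Rightarrow> ('v \<Rightarrow> 'a) \<Rightarrow> ('v \<Rightarrow> 'v) set" where
  "compatible_matchings V x y = {\<sigma> \<in> fpf_involutions V. \<forall>j\<in>V. x (\<sigma> j) = y j}"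

lemma finite_compatible_matchings: "finite V \<Longrightarrow> finite (compatible_matchings V x y)"
  by (simp add: compatible_matchings_def finite_fpf_involutions)

lemma card_compatible_matchings_delete_edge:
  assumes "v \<in> V" "w \<in> V" "v \<noteq> w"
  shows "card {\<sigma> \<in> compatible_matchings V x y. \<sigma> v = w} =
    (if x w = y v \<and> x v = y w then card (compatible_matchings (V - {v, w}) x y) else 0)"
proof (cases "x w = y v \<and> x v = y w")
  case True
  let ?f = "\<lambda>\<tau> j. if j = v then w else if j = w then v else \<tau> j"
  have bij: "bij_betw ?f (fpf_involutions (V - {v, w})) {\<sigma> \<in> fpf_involutions V. \<sigma> v = w}"
    by (rule bij_betw_fpf_involutions_delete_edge[OF assms])
  have "bij_betw ?f (compatible_matchings (V - {v, w}) x y) {\<sigma> \<in> compatible_matchings V x y. \<sigma> v = w}"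
  proof (rule bij_betw_subset[OF bij])
    show "compatible_matchings (V - {v, w}) x y \<subseteq> fpf_involutions (V - {v, w})"
      by (auto simp: compatible_matchings_def)
    have "?f ` {\<tau>\<in>fpf_involutions (V - {v, w}). \<forall>j\<in>V - {v,w}. x (\<tau> j) = y j} =
       {\<sigma> \<in> ?f ` fpf_involutions (V - {v, w}). \<forall>j\<in>V. x (\<sigma> j) = y j}"
    proof -
      have "(\<forall>j\<in>V. x (?f \<tau> j) = y j) \<longleftrightarrow> (\<forall>j\<in>V - {v,w}. x (\<tau> j) = y j)" for \<tau>
      proof -
        have split: "(\<forall>j\<in>V. Q j) \<longleftrightarrow> Q v \<and> Q w \<and> (\<forall>j\<in>V - {v,w}. Q j)" for Q
          using assms(1,2) by auto
        show ?thesis unfolding split[of "\<lambda>j. x (?f \<tau> j) = y j"] using True assms(3) by simp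
      qed
      then show ?thesis by blast
    qed
    then show "?f ` compatible_matchings (V - {v, w}) x y = {\<sigma> \<in> compatible_matchings V x y. \<sigma> v = w}"
      unfolding bij_betw_imp_surj_on[OF bij] by (auto simp: compatible_matchings_def)
  qed
  then show ?thesis using True by (simp add: bij_betw_same_card)
next
  case False
  have "x w = y v \<and> x v = y w" if "\<sigma> \<in> compatible_matchings V x y" "\<sigma> v = w" for \<sigma>
  proof -
    have "\<sigma> w = v" using that fpf_involutionsD(1)[of \<sigma> V v] by (auto simp: compatible_matchings_def)
    then show ?thesis using that assms by (auto simp: compatible_matchings_def)
  qed
  then have "{\<sigma> \<in> compatible_matchings V x y. \<sigma> v = w} = {}" using False by blast
  then show ?thesis using False by (simp only: card.empty if_False)
qed

lemma card_compatible_matchings_step: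
  assumes "finite V" "v \<in> V"
  shows "card (compatible_matchings V x y) =
    (\<Sum>w\<in>{w\<in>V - {v}. x w = y v \<and> x v = y w}. card (compatible_matchings (V - {v, w}) x y))"
proof -
  have "compatible_matchings V x y = (\<Union>w\<in>V - {v}. {\<sigma> \<in> compatible_matchings V x y. \<sigma> v = w})"
    using assms fpf_involutionsD(2,3) by (fastforce simp: compatible_matchings_def)
  then have "card (compatible_matchings V x y) = (\<Sum>w\<in>V - {v}. card {\<sigma> \<in> compatible_matchings V x y. \<sigma> v = w})"
    using assms by (subst card_UN_disjoint[symmetric]) (auto simp: finite_compatible_matchings)
  also have "\<dots> = (\<Sum>w\<in>V - {v}. if x w = y v \<and> x v = y w then card (compatible_matchings (V - {v, w}) x y) else 0)"
    using assms by (intro sum.cong refl card_compatible_matchings_delete_edge) auto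
  also have "\<dots> = (\<Sum>w\<in>{w\<in>V - {v}. x w = y v \<and> x v = y w}. card (compatible_matchings (V - {v, w}) x y))"
    using assms by (intro sum.inter_filter[symmetric]) auto
  finally show ?thesis .
qed

lemma pair_count_delete_edge:
  assumes "finite V" "v \<in> V" "w \<in> V" "v \<noteq> w" "x w = y v" "x v = y w"
  shows "pair_count V x y s t = pair_count (V - {v, w}) x y s t +
    (of_bool (s = x v \<and> t = y v) + of_bool (s = y v \<and> t = x v))"
proof -
  have sums: "pair_count U x y s t = (\<Sum>j\<in>U. of_bool (x j = s \<and> y j = t))" if "finite U" for U
    using that by (simp add: pair_count_def of_bool_def sum.If_cases Int_def conj_commute)
  have "V = insert v (insert w (V - {v, w}))" using assms(2,3) by blast
  then have "(\<Sum>j\<in>V. of_bool (x j = s \<and> y j = t) :: nat) =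
      (\<Sum>j\<in>insert v (insert w (V - {v, w})). of_bool (x j = s \<and> y j = t))" by (rule arg_cong)
  also have "\<dots> = of_bool (x v = s \<and> y v = t) + (of_bool (x w = s \<and> y w = t) +
      (\<Sum>j\<in>V - {v, w}. of_bool (x j = s \<and> y j = t)))"
    using assms(1,4) by (subst sum.insert; simp)+
  finally show ?thesis
    unfolding sums[OF assms(1)] sums[OF finite_Diff[OF assms(1)]] assms(5) assms(6)[symmetric]
    by (simp add: eq_commute)
qed

text \<open>
  If \<open>j\<close> has the pair \<open>(s, t)\<close> of \<open>x\<close>- and \<open>y\<close>-values, its partner must have the pair \<open>(t, s)\<close>. Hence
  the classes of vertices with pairs \<open>(s, t)\<close> and \<open>(t, s)\<close> are matched with each other, independently
  for different unordered pairs, and the count depends on the sizes of the classes only. The induction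
  removes one vertex together with its partner.
\<close>

theorem card_compatible_matchings:
  fixes x y :: "'v \<Rightarrow> 'a::linorder"
  assumes "finite V" "finite R" "x ` V \<subseteq> R" "y ` V \<subseteq> R"
  shows "card (compatible_matchings V x y) =
    (if \<forall>s\<in>R. \<forall>t\<in>R. pair_count V x y s t = pair_count V x y t s
     then \<Prod>(s,t)\<in>R \<times> R. pair_weight s t (pair_count V x y s t) else 0)"
  using assms
proof (induction "card V" arbitrary: V rule: less_induct)
  case less
  let ?m = "pair_count V x y"
  show ?case
  proof (cases "V = {}")
    case True
    then have "compatible_matchings V x y = {id}"
      by (simp add: compatible_matchings_def fpf_involutions_empty)
    moreover have "(\<Prod>(s,t)\<in>R \<times> R. pair_weight s t (?m s t)) = 1"
      using True by (intro prod.neutral) (auto simp: pair_count_def pair_weight_def)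
    ultimately show ?thesis using True by (simp add: pair_count_def)
  next
    case False
    then obtain v where v: "v \<in> V" by blast
    define s0 t0 where "s0 = x v" and "t0 = y v"
    have R: "s0 \<in> R" "t0 \<in> R" using less.prems v by (auto simp: s0_def t0_def)
    define W where "W = {w\<in>V - {v}. x w = y v \<and> x v = y w}"
    have step: "card (compatible_matchings V x y) = (\<Sum>w\<in>W. card (compatible_matchings (V - {v, w}) x y))"
      unfolding W_def by (rule card_compatible_matchings_step[OF less.prems(1) v])
    have del: "?m s t = pair_count (V - {v, w}) x y s t +
        (of_bool (s = s0 \<and> t = t0) + of_bool (s = t0 \<and> t = s0))" if "w \<in> W" for w s t
      using that less.prems(1) v unfolding s0_def t0_def W_def by (intro pair_count_delete_edge) auto
    have IH: "card (compatible_matchings (V - {v, w}) x y) =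
      (if \<forall>s\<in>R. \<forall>t\<in>R. pair_count (V - {v, w}) x y s t = pair_count (V - {v, w}) x y t s
       then \<Prod>(s,t)\<in>R \<times> R. pair_weight s t (pair_count (V - {v, w}) x y s t) else 0)" if "w \<in> W" for w
    proof -
      have "card (V - {v, w}) < card V"
        using v less.prems(1) by (intro psubset_card_mono) auto
      moreover have "finite (V - {v, w})" "x ` (V - {v, w}) \<subseteq> R" "y ` (V - {v, w}) \<subseteq> R"
        using less.prems by blast+
      ultimately show ?thesis using less.hyps less.prems(2) by blast
    qed
    have symiff: "pair_count (V - {v, w}) x y s t = pair_count (V - {v, w}) x y t s \<longleftrightarrow> ?m s t = ?m t s"
      if "w \<in> W" for w s t
    proof -
      have "of_bool (t = s0 \<and> s = t0) + of_bool (t = t0 \<and> s = s0) =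
          (of_bool (s = s0 \<and> t = t0) + of_bool (s = t0 \<and> t = s0) :: nat)"
        by (simp only: conj_commute add.commute)
      then show ?thesis unfolding del[OF that, of s t] del[OF that, of t s] by (simp only: add_right_cancel)
    qed
    have cardW: "card W = ?m t0 s0 - of_bool (s0 = t0)"
    proof (cases "s0 = t0")
      case True
      have "W = {j\<in>V. x j = t0 \<and> y j = s0} - {v}" by (auto simp: W_def s0_def t0_def)
      then show ?thesis using True v less.prems
        by (simp add: pair_count_def card_Diff_singleton_if s0_def t0_def)
    next
      case False
      then have "W = {j\<in>V. x j = t0 \<and> y j = s0}" by (auto simp: W_def s0_def t0_def)
      then show ?thesis using False by (simp add: pair_count_def)
    qed
    show ?thesis
    proof (cases "\<forall>s\<in>R. \<forall>t\<in>R. ?m s t = ?m t s")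
      case False
      then have "card (compatible_matchings (V - {v, w}) x y) = 0" if "w \<in> W" for w
        using IH[OF that] symiff[OF that] by auto
      then have "card (compatible_matchings V x y) = 0" using step by simp
      then show ?thesis unfolding if_not_P[OF False] .
    next
      case sym: True
      define a b where "a = min s0 t0" and "b = max s0 t0"
      have abR: "(a, b) \<in> R \<times> R" and ab: "a \<le> b" using R by (auto simp: a_def b_def min_def max_def)
      have s0t0: "?m s0 t0 = ?m t0 s0" using sym R by blast
      have mab: "?m a b = ?m t0 s0" using s0t0 by (cases "s0 \<le> t0") (simp_all add: a_def b_def min_def max_def)
      have m0: "?m s0 t0 > 0" unfolding pair_count_def using v less.prems by (auto simp: card_gt_0_iff s0_def t0_def)
      have prod: "card W * (\<Prod>(s,t)\<in>R \<times> R. pair_weight s t (pair_count (V - {v, w}) x y s t))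
         = (\<Prod>(s,t)\<in>R \<times> R. pair_weight s t (?m s t))" if w: "w \<in> W" for w
      proof -
        let ?m' = "pair_count (V - {v, w}) x y"
        have "(\<Prod>(s,t)\<in>R \<times> R. pair_weight s t (?m s t)) = pair_weight a b (?m a b) *
            (\<Prod>(s,t)\<in>R \<times> R - {(a,b)}. pair_weight s t (?m s t))"
          using less.prems abR by (subst prod.remove[of _ "(a,b)"]) auto
        also have "(\<Prod>(s,t)\<in>R \<times> R - {(a,b)}. pair_weight s t (?m s t)) = (\<Prod>(s,t)\<in>R \<times> R - {(a,b)}. pair_weight s t (?m' s t))"
        proof (rule prod.cong[OF refl])
          fix z assume z: "z \<in> R \<times> R - {(a, b)}"
          obtain s t where st': "z = (s, t)" by (cases z)
          with z have st: "s \<in> R" "t \<in> R" "(s, t) \<noteq> (a, b)" by auto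
          have "pair_weight s t (?m s t) = pair_weight s t (?m' s t)"
          proof (cases "s \<le> t")
            case True
            then have "?m s t = ?m' s t" using st del[OF w, of s t]
              by (auto simp: a_def b_def min_def max_def split: if_splits)
            then show ?thesis by simp
          qed (auto simp: pair_weight_def)
          then show "(case z of (s, t) \<Rightarrow> pair_weight s t (?m s t)) = (case z of (s, t) \<Rightarrow> pair_weight s t (?m' s t))"
            by (simp add: st')
        qed
        also have "pair_weight a b (?m a b) = card W * pair_weight a b (?m' a b)"
        proof (cases "s0 = t0")
          case True
          then have "a = s0" "b = s0" by (auto simp: a_def b_def)
          moreover have "?m s0 s0 = Suc (Suc (?m' s0 s0))" using del[OF w, of s0 s0] True by simp
          ultimately show ?thesis using cardW True by (simp add: pair_weight_def)
        next
          case False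
          then have lt: "a < b" by (auto simp: a_def b_def min_def max_def)
          have "?m a b = Suc (?m' a b)" using del[OF w, of a b] False
            by (auto simp: a_def b_def min_def max_def)
          then show ?thesis using cardW False lt mab by (simp add: pair_weight_def)
        qed
        finally show ?thesis using less.prems abR by (subst prod.remove[of _ "(a,b)"]) (auto simp: mult_ac)
      qed
      show ?thesis
      proof (cases "W = {}")
        case True
        then have "?m t0 s0 - of_bool (s0 = t0) = 0" using cardW by simp
        moreover have "?m t0 s0 > 0" using m0 s0t0 by simp
        ultimately have "s0 = t0" "?m s0 s0 = 1" by (cases "s0 = t0"; simp)+
        then have "pair_weight s0 s0 (?m s0 s0) = 0" by (simp add: pair_weight_def)
        then have "(\<Prod>(s,t)\<in>R \<times> R. pair_weight s t (?m s t)) = 0"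
          using R less.prems by (intro prod_zero) auto
        moreover have "card (compatible_matchings V x y) = 0" using True step by simp
        ultimately show ?thesis unfolding if_P[OF sym] by (simp only:)
      next
        case False
        then obtain w0 where w0: "w0 \<in> W" by blast
        have "card (compatible_matchings (V - {v, w}) x y) = (\<Prod>(s,t)\<in>R \<times> R. pair_weight s t (pair_count (V - {v, w}) x y s t))"
          if "w \<in> W" for w
        proof -
          have "\<forall>s\<in>R. \<forall>t\<in>R. pair_count (V - {v, w}) x y s t = pair_count (V - {v, w}) x y t s"
            using symiff[OF that] sym by blast
          then show ?thesis using IH[OF that] by (simp only: if_P)
        qed
        moreover have "pair_count (V - {v, w}) x y s t = pair_count (V - {v, w0}) x y s t" if "w \<in> W" for w s t
          using del[OF that, of s t] del[OF w0, of s t] by simp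
        ultimately have "card (compatible_matchings V x y) = (\<Sum>w\<in>W. \<Prod>(s,t)\<in>R \<times> R. pair_weight s t (pair_count (V - {v, w0}) x y s t))"
          unfolding step by (intro sum.cong refl) simp
        then have "card (compatible_matchings V x y) = card W * (\<Prod>(s,t)\<in>R \<times> R. pair_weight s t (pair_count (V - {v, w0}) x y s t))"
          by (simp only: sum_constant of_nat_id)
        then show ?thesis unfolding if_P[OF sym] prod[OF w0] .
      qed
    qed
  qed
qed

lemma card_fpf_involutions:
  assumes "finite V" shows "card (fpf_involutions V) = odd_fact (card V)"
proof -
  have "card (compatible_matchings V (\<lambda>_. 0::nat) (\<lambda>_. 0)) = odd_fact (card V)"
    by (subst card_compatible_matchings[OF assms, of "{0}"]) (simp_all add: pair_count_def pair_weight_def image_subset_iff)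
  then show ?thesis by (simp add: compatible_matchings_def)
qed

section \<open>The lattice generated by the columns with sum zero\<close>

text \<open>
  A predicate \<open>L\<close> closed under differences is a subgroup; an element of the quotient that is killed by
  two coprime integers is zero, by Bezout's identity.
\<close>

lemma torsion_coprime:
  fixes L :: "'g::comm_ring_1 \<Rightarrow> bool"
  assumes L0: "L 0" and Ldiff: "\<And>a b. L a \<Longrightarrow> L b \<Longrightarrow> L (a - b)"
    and "coprime k l" "L (of_int k * a)" "L (of_int l * a)"
  shows "L a"
proof -
  have neg: "L (- a)" if "L a" for a using Ldiff[OF L0 that] by simp
  have add: "L (a + b)" if "L a" "L b" for a b using Ldiff[OF that(1) neg[OF that(2)]] by simp
  have natmult: "L (of_nat j * b)" if "L b" for j b
    by (induction j) (use that in \<open>simp_all add: L0 add algebra_simps\<close>)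
  have intmult: "L (of_int j * b)" if "L b" for j b
  proof (cases "j \<ge> 0")
    case True
    then show ?thesis using natmult[OF that, of "nat j"] by simp
  next
    case False
    then show ?thesis using neg[OF natmult[OF that, of "nat (- j)"]] by simp
  qed
  obtain u v where "u * k + v * l = 1"
    using bezout_int[of k l] assms(3) by (metis coprime_imp_gcd_eq_1)
  then have "of_int u * (of_int k * a) + of_int v * (of_int l * a) = a"
    by (metis (no_types, lifting) distrib_right mult.assoc mult_1 of_int_1 of_int_add of_int_mult)
  then show ?thesis using add[OF intmult[OF assms(4)] intmult[OF assms(5)]] by metis
qed

text \<open>
  Here \<open>e i s t\<close> stands for one occurrence of the pair \<open>(s, t)\<close> in row \<open>i\<close>, and \<open>L\<close> is the subgroup
  generated by the columns with sum zero and by the modifications that keep pair counts admissible.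
  The claim is that \<open>L\<close> contains every column, whatever its sum.
  
  Modulo \<open>L\<close>, the relations for columns with at most three nonzero neighbour values show that
  \<open>e i x u - e i x 0\<close> is the same for all \<open>i\<close>, say \<open>h x u\<close>, and additive in \<open>u\<close>; in particular it is killed
  by \<open>p\<close>. Summing the symmetry relation over the \<open>d\<close> rows gives \<open>d (h x u + h u x) = 0\<close>, so \<open>h\<close> is
  alternating because \<open>p\<close> divides neither \<open>d\<close> nor \<open>2\<close>. An alternating biadditive form on a cyclic group
  vanishes, and then a column is congruent to the column with the same first entry and zeros elsewhere,
  whose sum is zero.
\<close>

theorem columns_generate:
  fixes L :: "'g::comm_ring_1 \<Rightarrow> bool" and e :: "nat \<Rightarrow> int \<Rightarrow> int \<Rightarrow> 'g" and p :: int
  assumes L0: "L 0" and Ldiff: "\<And>a b. L a \<Longrightarrow> L b \<Longrightarrow> L (a - b)"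
    and periodic: "\<And>i s t. e i s (t mod p) = e i s t"
    and sym: "\<And>i s t. i < d \<Longrightarrow> L (e i s t + e i t s)"
    and col: "\<And>x y. (\<Sum>i<d. y i) mod p = 0 \<Longrightarrow> L (\<Sum>i<d. e i x (y i))"
    and d: "d \<ge> 3" and p: "prime p" "odd p" "\<not> p dvd int d"
    and x: "x \<ge> 0" and y: "\<And>i. i < d \<Longrightarrow> y i \<ge> 0"
  shows "L (\<Sum>i<d. e i x (y i))"
proof -
  have neg: "L (- a)" if "L a" for a using Ldiff[OF L0 that] by simp
  have add: "L (a + b)" if "L a" "L b" for a b using Ldiff[OF that(1) neg[OF that(2)]] by simp
  have sum: "L (\<Sum>i\<in>I. f i)" if "\<And>i. i \<in> I \<Longrightarrow> L (f i)" for I and f :: "nat \<Rightarrow> 'g"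
    using that by (induction I rule: infinite_finite_induct) (auto simp: L0 add)
  define g where "g = (\<lambda>i x u. e i x u - e i x 0)"
  define h where "h = g 0"
  have base: "L (\<Sum>i<d. e i x 0)" for x using col[of "\<lambda>_. 0" x] by simp
  have gsum: "L (\<Sum>i<d. g i x (y i))" if "(\<Sum>i<d. y i) mod p = 0" for x y
    using Ldiff[OF col[OF that] base, of x x] by (simp add: g_def sum_subtractf)
  have g0 [simp]: "g i x 0 = 0" for i x by (simp add: g_def)
  have three: "L (g i x u + g j x v + g k x w)"
    if "i < d" "j < d" "k < d" "i \<noteq> j" "j \<noteq> k" "i \<noteq> k" "u + v + w = 0" for i j k x u v w
  proof -
    \<comment> \<open>A row that is zero except at \<open>i\<close>, \<open>j\<close> and \<open>k\<close>.\<close>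
  define y where "y = (\<lambda>l. if l = i then u else if l = j then v else if l = k then w else 0)"
    have sum3: "(\<Sum>l<d. F l) = F i + F j + F k" if "\<And>l. l \<notin> {i,j,k} \<Longrightarrow> F l = 0" for F :: "nat \<Rightarrow> 'b::comm_monoid_add"
    proof -
      have "(\<Sum>l<d. F l) = (\<Sum>l\<in>{i,j,k}. F l)"
        using that \<open>i < d\<close> \<open>j < d\<close> \<open>k < d\<close> by (intro sum.mono_neutral_right) auto
      then show ?thesis using \<open>i \<noteq> j\<close> \<open>j \<noteq> k\<close> \<open>i \<noteq> k\<close> by (simp add: add.assoc)
    qed
    have "(\<Sum>l<d. y l) = y i + y j + y k" by (rule sum3) (simp add: y_def)
    moreover have yv: "y i = u" "y j = v" "y k = w" using that by (auto simp: y_def)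
    moreover have "(\<Sum>l<d. g l x (y l)) = g i x (y i) + g j x (y j) + g k x (y k)"
      by (rule sum3) (simp add: y_def)
    ultimately show ?thesis using gsum[of y x] that(7) by simp
  qed
  have two: "L (g i x u + g j x (- u))" if "i < d" "j < d" "i \<noteq> j" for i j x u
  proof -
    obtain k where "k < d" "k \<noteq> i" "k \<noteq> j"
    proof -
      have "\<exists>k\<in>{0,1,2}. k \<noteq> i \<and> k \<noteq> j" by auto
      then obtain k where k: "k \<in> {0,1,2}" "k \<noteq> i" "k \<noteq> j" by blast
      then have "k < d" using d by auto
      then show ?thesis using that k by blast
    qed
    then show ?thesis using three[of i j k u "- u" 0 x] that by simp
  qed
  have addij: "L (g i x u + g j x v - g i x (u + v))" if "i < d" "j < d" "i \<noteq> j" for i j x u v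
  proof -
    obtain k where k: "k < d" "k \<noteq> i" "k \<noteq> j"
    proof -
      have "\<exists>k\<in>{0,1,2}. k \<noteq> i \<and> k \<noteq> j" by auto
      then obtain k where k: "k \<in> {0,1,2}" "k \<noteq> i" "k \<noteq> j" by blast
      then have "k < d" using d by auto
      then show ?thesis using that k by blast
    qed
    have "L ((g i x u + g j x v + g k x (- (u + v))) - (g i x (u + v) + g k x (- (u + v))))"
      using k that by (intro Ldiff three two) auto
    then show ?thesis by simp
  qed
  have same: "L (g j x v - g i x v)" if "i < d" "j < d" for i j x v
    using addij[OF that, of x 0 v] that L0 by (cases "i = j") auto
  have hadd: "L (h x u + h x v - h x (u + v))" for x u v
    using Ldiff[OF addij[of 0 1 x u v] same[of 0 1 x v]] d by (simp add: h_def add_diff_eq)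
  have hmult: "L (of_nat k * h x u - h x (int k * u))" for k x u
  proof (induction k)
    case 0
    then show ?case by (simp add: h_def L0)
  next
    case (Suc k)
    have "L ((of_nat k * h x u - h x (int k * u)) + (h x (int k * u) + h x u - h x (int k * u + u)))"
      by (intro add Suc hadd)
    then show ?case by (simp add: algebra_simps)
  qed
  have nonneg_mult: "L (of_int k * h x u - h x (k * u))" if "k \<ge> 0" for k x u
    using hmult[of "nat k" x u] that by simp
  have p0: "p > 0" using p(1) by (simp add: prime_gt_0_int)
  have hp: "L (of_int p * h x u)" for x u
  proof -
    have "h x (p * u) = 0" using periodic[of 0 x "p * u"] periodic[of 0 x 0] by (simp add: h_def g_def)
    then show ?thesis using nonneg_mult[of p x u] p0 by simp
  qed
  have intmult: "L (of_int k * a)" if "L a" for k a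
  proof -
    have *: "L (of_nat j * a)" for j
      by (induction j) (use that in \<open>simp_all add: L0 add algebra_simps\<close>)
    show ?thesis using *[of "nat k"] neg[OF *[of "nat (- k)"]] by (cases "k \<ge> 0") simp_all
  qed
  have hanti: "L (h x u + h u x)" for x u
  proof (rule torsion_coprime[OF L0 Ldiff])
    show "coprime (int d) p" using p(1,3) by (metis coprime_commute prime_imp_coprime_int prime_int_iff)
    show "L (of_int p * (h x u + h u x))" using add[OF hp[of x u] hp[of u x]] by (simp add: algebra_simps)
    have "L ((\<Sum>i<d. (e i x u + e i u x) - (g i x u - h x u) - (g i u x - h u x)) - ((\<Sum>i<d. e i x 0) + (\<Sum>i<d. e i u 0)))"
      unfolding h_def using d by (intro Ldiff add base sum sym same) auto
    also have "(\<Sum>i<d. (e i x u + e i u x) - (g i x u - h x u) - (g i u x - h u x)) - ((\<Sum>i<d. e i x 0) + (\<Sum>i<d. e i u 0))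
        = of_int (int d) * (h x u + h u x)"
      by (simp add: g_def sum.distrib sum_subtractf algebra_simps)
    finally show "L (of_int (int d) * (h x u + h u x))" .
  qed
  have hdiag: "L (h x x)" for x
  proof (rule torsion_coprime[OF L0 Ldiff])
    show "coprime 2 p" using p(2) by simp
    show "L (of_int 2 * h x x)" using hanti[of x x] by (simp add: algebra_simps)
    show "L (of_int p * h x x)" by (rule hp)
  qed
  have hzero: "L (h x u)" if "x \<ge> 0" "u \<ge> 0" for x u
  proof -
    \<comment> \<open>Modulo \<open>L\<close>, \<open>h x u = u * h x 1 = - u * h 1 x = - u * x * h 1 1 = 0\<close>.\<close>
    have 1: "L (of_int u * h x 1 - h x u)" using nonneg_mult[OF that(2), of x 1] by simp
    have 2: "L (of_int x * h 1 1 - h 1 x)" using nonneg_mult[OF that(1), of 1 1] by simp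
    have 3: "L (h 1 x)" using Ldiff[OF intmult[OF hdiag[of 1]] 2, of x] by simp
    have 4: "L (h x 1)" using Ldiff[OF hanti[of x 1] 3] by simp
    show ?thesis using Ldiff[OF intmult[OF 4, of u] 1] by simp
  qed
  have "L (\<Sum>i<d. (g i x (y i) - h x (y i)) + h x (y i))"
    unfolding h_def using d y hzero[OF x] by (intro sum add same) (auto simp: h_def)
  then have "L ((\<Sum>i<d. g i x (y i)) + (\<Sum>i<d. e i x 0))" using add[OF _ base[of x]] by simp
  then show ?thesis by (simp add: g_def sum_subtractf)
qed

definition residues :: "int \<Rightarrow> int set" where "residues p = {0..<p}"

text \<open>
  The first component of a column is the value at a vertex, the second one lists the values at its \<open>d\<close> neighbours.
\<close>

type_synonym column = "int \<times> (nat \<Rightarrow> int)"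

definition all_columns :: "int \<Rightarrow> nat \<Rightarrow> column set" where
  "all_columns p d = residues p \<times> (PiE {..<d} (\<lambda>_. residues p))"

definition columns_of_sum :: "int \<Rightarrow> nat \<Rightarrow> int \<Rightarrow> column set" where
  "columns_of_sum p d g = {a \<in> all_columns p d. (\<Sum>i<d. snd a i) mod p = g}"

lemma finite_all_columns [simp]: "finite (all_columns p d)"
  by (simp add: all_columns_def residues_def finite_PiE)

lemma finite_columns [simp]: "finite (columns_of_sum p d g)"
  by (simp add: columns_of_sum_def)

text \<open>
  The changes of the pair counts that preserve the two conditions under which compatible matchings
  exist: symmetry, and an even number of vertices with each diagonal pair.
\<close>

definition balanced :: "int \<Rightarrow> nat \<Rightarrow> (nat \<Rightarrow> int \<Rightarrow> int \<Rightarrow> int) \<Rightarrow> bool" where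
  "balanced p d F \<longleftrightarrow>
     (\<forall>i<d. \<forall>s\<in>residues p. \<forall>t\<in>residues p. F i s t = F i t s \<and> even (F i s s))"

definition incidence :: "column \<Rightarrow> nat \<Rightarrow> int \<Rightarrow> int \<Rightarrow> int" where
  "incidence a i s t = of_bool (s = fst a \<and> t = snd a i)"

lemma all_columnsD:
  assumes "a \<in> all_columns p d"
  shows "fst a \<in> residues p" "i < d \<Longrightarrow> snd a i \<in> residues p"
  using assms PiE_mem[of "snd a" "{..<d}" "\<lambda>_. residues p" i]
  by (simp_all add: all_columns_def mem_Times_iff)

lemma balanced_diff:
  "balanced p d F \<Longrightarrow> balanced p d G \<Longrightarrow> balanced p d (\<lambda>i s t. F i s t - G i s t)"
  by (simp add: balanced_def)

lemma sum_apply3: "(\<Sum>i\<in>I. f i) a b c = (\<Sum>i\<in>I. f i a b c)"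
  for f :: "'i \<Rightarrow> 'a \<Rightarrow> 'b \<Rightarrow> 'c \<Rightarrow> int"
  by (induction I rule: infinite_finite_induct) (auto simp: zero_fun_def plus_fun_def)

lemma balanced_even_total:
  assumes "balanced p d F" "i < d"
  shows "even (\<Sum>s\<in>residues p. \<Sum>t\<in>residues p. F i s t)"
proof -
  have fin: "finite (residues p)" by (simp add: residues_def)
  have "even (\<Sum>s\<in>S. \<Sum>t\<in>S. F i s t)" if "S \<subseteq> residues p" for S
    using finite_subset[OF that fin] that
  proof (induction S rule: finite_induct)
    case (insert u S)
    have "(\<Sum>s\<in>S. F i s u) = (\<Sum>t\<in>S. F i u t)"
      using insert.prems assms by (intro sum.cong) (auto simp: balanced_def)
    then have "(\<Sum>s\<in>insert u S. \<Sum>t\<in>insert u S. F i s t) =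
        F i u u + 2 * (\<Sum>t\<in>S. F i u t) + (\<Sum>s\<in>S. \<Sum>t\<in>S. F i s t)"
      using insert.hyps by (simp add: sum.distrib)
    moreover have "even (F i u u)" using insert.prems assms by (auto simp: balanced_def)
    ultimately show ?case using insert.IH insert.prems by simp
  qed simp
  then show ?thesis by blast
qed

lemma sum_incidence:
  assumes "a \<in> all_columns p d" "i < d"
  shows "(\<Sum>s\<in>residues p. \<Sum>t\<in>residues p. incidence a i s t) = 1"
proof -
  have fin: "finite (residues p)" by (simp add: residues_def)
  have in1: "fst a \<in> residues p" and in2: "snd a i \<in> residues p"
    using all_columnsD[OF assms(1)] assms(2) by auto
  have "(\<Sum>t\<in>residues p. incidence a i s t) = (if s = fst a then 1 else 0)" for s
  proof (cases "s = fst a")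
    case True
    then have "(\<Sum>t\<in>residues p. incidence a i s t) = (\<Sum>t\<in>residues p. if t = snd a i then 1 else 0)"
      by (simp add: incidence_def of_bool_def)
    then show ?thesis using True fin in2 by simp
  qed (simp add: incidence_def)
  then have "(\<Sum>s\<in>residues p. \<Sum>t\<in>residues p. incidence a i s t) = (\<Sum>s\<in>residues p. if s = fst a then 1 else 0)"
    by simp
  also have "\<dots> = 1" using fin in1 by simp
  finally show ?thesis .
qed

text \<open>
  Inserting one column \<open>b\<close> of arbitrary sum can be compensated by a bounded change \<open>D\<close> in the numbers
  of columns of sum zero: the number of vertices stays the same and the pair counts stay
  admissible. The compensation comes from \<open>columns_generate\<close>. Its total is odd, since a balanced change has even total, so it
  can be corrected to \<open>- 1\<close> by pairs of zero columns, whose pair counts are diagonal and even.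
\<close>

lemma balance_column:
  assumes d: "d \<ge> 3" and p: "prime p" "odd p" "\<not> p dvd int d" and b: "b \<in> all_columns p d"
  obtains D where
    "balanced p d (\<lambda>i s t. incidence b i s t + (\<Sum>a\<in>columns_of_sum p d 0. D a * incidence a i s t))"
    "(\<Sum>a\<in>columns_of_sum p d 0. D a) = - 1"
proof -
  have p0: "p > 0" using p(1) by (simp add: prime_gt_0_int)
  define C where "C = columns_of_sum p d 0"
  define L where "L = (\<lambda>F. \<exists>D. balanced p d (\<lambda>i s t. F i s t + (\<Sum>a\<in>C. D a * incidence a i s t)))"
  define e :: "nat \<Rightarrow> int \<Rightarrow> int \<Rightarrow> nat \<Rightarrow> int \<Rightarrow> int \<Rightarrow> int"
    where "e = (\<lambda>i s t i' s' t'. of_bool (i' = i \<and> s' = s mod p \<and> t' = t mod p))"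
  have se: "(\<Sum>i<d. e i x (y i)) i' s t = of_bool (s = x mod p \<and> t = y i' mod p)" if "i' < d" for x y i' s t
  proof -
    have "(\<Sum>i<d. e i x (y i)) i' s t = (\<Sum>i<d. if i' = i then of_bool (s = x mod p \<and> t = y i mod p) else 0)"
      unfolding sum_apply3 by (intro sum.cong) (auto simp: e_def)
    also have "\<dots> = of_bool (s = x mod p \<and> t = y i' mod p)" using that by simp
    finally show ?thesis .
  qed
  have "L (\<Sum>i<d. e i (fst b) (snd b i))"
  proof (rule columns_generate[where p = p and L = L and e = e and d = d])
    show "L 0" unfolding L_def by (rule exI[of _ "\<lambda>_. 0"]) (simp add: balanced_def zero_fun_def)
    show "L (F - G)" if "L F" "L G" for F G
    proof -
      from that obtain D1 D2 where D:
        "balanced p d (\<lambda>i s t. F i s t + (\<Sum>a\<in>C. D1 a * incidence a i s t))"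
        "balanced p d (\<lambda>i s t. G i s t + (\<Sum>a\<in>C. D2 a * incidence a i s t))"
        unfolding L_def by blast
      have *: "(F - G) i s t + (\<Sum>a\<in>C. (D1 a - D2 a) * incidence a i s t) =
          (F i s t + (\<Sum>a\<in>C. D1 a * incidence a i s t)) - (G i s t + (\<Sum>a\<in>C. D2 a * incidence a i s t))" for i s t
        by (simp add: left_diff_distrib sum_subtractf)
      show ?thesis unfolding L_def
        by (rule exI[of _ "\<lambda>a. D1 a - D2 a"]) (simp only: * balanced_diff[OF D])
    qed
    show "e i s (t mod p) = e i s t" for i s t by (simp add: e_def)
    show "L (e i s t + e i t s)" for i s t
      unfolding L_def by (rule exI[of _ "\<lambda>_. 0"]) (auto simp: balanced_def e_def)
    show "L (\<Sum>i<d. e i x (y i))" if "(\<Sum>i<d. y i) mod p = 0" for x y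
    proof -
      define a where "a = (x mod p, \<lambda>i\<in>{..<d}. y i mod p)"
      have "(\<Sum>i<d. snd a i) mod p = 0"
        using that by (simp add: a_def mod_sum_eq)
      then have aC: "a \<in> C" using p0 by (auto simp: C_def columns_of_sum_def all_columns_def a_def residues_def)
      have "(\<Sum>i<d. e i x (y i)) i' s t + (\<Sum>a'\<in>C. (if a' = a then - 1 else 0) * incidence a' i' s t) = 0"
        if "i' < d" for i' s t
      proof -
        have "(\<Sum>a'\<in>C. (if a' = a then - 1 else 0) * incidence a' i' s t) =
            (\<Sum>a'\<in>C. if a' = a then - incidence a i' s t else 0)" by (intro sum.cong) auto
        also have "\<dots> = - incidence a i' s t" using aC by (simp add: C_def)
        finally show ?thesis unfolding se[OF that] using that by (simp add: incidence_def a_def)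
      qed
      then have "balanced p d (\<lambda>i s t. (\<Sum>i<d. e i x (y i)) i s t + (\<Sum>a'\<in>C. (if a' = a then - 1 else 0) * incidence a' i s t))"
        unfolding balanced_def by (intro allI impI ballI conjI) (simp_all only: even_zero)
      then show ?thesis unfolding L_def by (intro exI[of _ "\<lambda>a'. if a' = a then - 1 else 0"])
    qed
    show "fst b \<ge> 0" "\<And>i. i < d \<Longrightarrow> snd b i \<ge> 0"
      using all_columnsD[OF b] by (auto simp: residues_def)
  qed (use d p in auto)
  then obtain D where D: "balanced p d (\<lambda>i s t. (\<Sum>i<d. e i (fst b) (snd b i)) i s t + (\<Sum>a\<in>C. D a * incidence a i s t))"
    unfolding L_def by blast
  have eb: "(\<Sum>i<d. e i (fst b) (snd b i)) i s t = incidence b i s t" if "i < d" for i s t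
    using all_columnsD[OF b] that unfolding se[OF that] by (simp add: incidence_def residues_def)
  let ?F = "\<lambda>D i s t. incidence b i s t + (\<Sum>a\<in>C. D a * incidence a i s t)"
  have bal: "balanced p d (?F D)" using D by (simp add: balanced_def eb)
  have tot: "(\<Sum>s\<in>residues p. \<Sum>t\<in>residues p. ?F D 0 s t) = 1 + (\<Sum>a\<in>C. D a)"
  proof -
    have "(\<Sum>s\<in>residues p. \<Sum>t\<in>residues p. \<Sum>a\<in>C. D a * incidence a 0 s t) =
        (\<Sum>a\<in>C. D a * (\<Sum>s\<in>residues p. \<Sum>t\<in>residues p. incidence a 0 s t))"
      by (simp add: sum_distrib_left sum.swap[of _ _ C])
    also have "\<dots> = (\<Sum>a\<in>C. D a)"
      using d by (intro sum.cong refl) (subst sum_incidence[of _ p d], auto simp: C_def columns_of_sum_def)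
    finally show ?thesis using sum_incidence[OF b, of 0] d by (simp add: sum.distrib)
  qed
  have "even (1 + (\<Sum>a\<in>C. D a))" using balanced_even_total[OF bal, of 0] d unfolding tot by simp
  then obtain r where r: "1 + (\<Sum>a\<in>C. D a) = 2 * r" by (rule evenE)
  define z :: column where "z = (0, \<lambda>i\<in>{..<d}. 0)"
  have zC: "z \<in> C" using p0 by (auto simp: z_def C_def columns_of_sum_def all_columns_def residues_def)
  define D' where "D' = (\<lambda>a. D a - (if a = z then 2 * r else 0))"
  have sumD': "(\<Sum>a\<in>C. D' a * f a) = (\<Sum>a\<in>C. D a * f a) - 2 * r * f z" for f
  proof -
    have "(\<Sum>a\<in>C. (if a = z then 2 * r else 0) * f a) = (\<Sum>a\<in>C. if a = z then 2 * r * f z else 0)"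
      by (intro sum.cong) auto
    also have "\<dots> = 2 * r * f z" using zC by (simp add: C_def)
    finally show ?thesis by (simp add: D'_def left_diff_distrib sum_subtractf)
  qed
  show ?thesis
  proof (rule that[of D'])
    show "(\<Sum>a\<in>columns_of_sum p d 0. D' a) = - 1" using sumD'[of "\<lambda>_. 1"] r by (simp add: C_def)
    have "incidence z i s t = incidence z i t s" if "i < d" for i s t
      using that by (auto simp: z_def incidence_def)
    then show "balanced p d (\<lambda>i s t. incidence b i s t + (\<Sum>a\<in>columns_of_sum p d 0. D' a * incidence a i s t))"
      using bal unfolding C_def[symmetric] sumD' by (auto simp: balanced_def)
  qed
qed

section \<open>An entropy inequality for symmetric laws of columns\<close>

text \<open>
  Nonnegativity of relative entropy. The total mass of \<open>r\<close> may be smaller than that of \<open>q\<close>, which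
  allows reference laws to be given on a larger set; the convention \<open>ln 0 = 0\<close> makes the terms with \<open>q a = 0\<close> vanish.
\<close>

lemma gibbs_inequality:
  fixes q r :: "'a \<Rightarrow> real"
  assumes fin: "finite A" and q: "\<And>a. a \<in> A \<Longrightarrow> q a \<ge> 0" and r: "\<And>a. a \<in> A \<Longrightarrow> r a \<ge> 0"
    and pos: "\<And>a. a \<in> A \<Longrightarrow> q a > 0 \<Longrightarrow> r a > 0" and le: "(\<Sum>a\<in>A. r a) \<le> (\<Sum>a\<in>A. q a)"
  shows "0 \<le> (\<Sum>a\<in>A. q a * (ln (q a) - ln (r a)))"
    and "(\<Sum>a\<in>A. q a * (ln (q a) - ln (r a))) \<le> 0 \<Longrightarrow> a \<in> A \<Longrightarrow> q a = r a"
proof -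
  define F where "F = (\<lambda>a. q a * (ln (q a) - ln (r a)) - (q a - r a))"
  have ln_quot: "ln (r a / q a) = ln (r a) - ln (q a)" if "a \<in> A" "q a > 0" for a
    using pos[OF that] that by (simp add: ln_div)
  have F0: "F a \<ge> 0" if "a \<in> A" for a
  proof (cases "q a = 0")
    case False
    then have "q a > 0" using q[OF that] by simp
    then have "q a * ln (r a / q a) \<le> q a * (r a / q a - 1)"
      using pos[OF that] by (intro mult_left_mono ln_le_minus_one) auto
    then show ?thesis using \<open>q a > 0\<close> ln_quot[OF that] by (simp add: F_def algebra_simps)
  qed (use r[OF that] in \<open>simp add: F_def\<close>)
  have sumF: "(\<Sum>a\<in>A. q a * (ln (q a) - ln (r a))) = (\<Sum>a\<in>A. F a) + ((\<Sum>a\<in>A. q a) - (\<Sum>a\<in>A. r a))"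
    by (simp add: F_def sum_subtractf)
  show "0 \<le> (\<Sum>a\<in>A. q a * (ln (q a) - ln (r a)))"
    unfolding sumF using F0 le by (simp add: sum_nonneg)
  assume "(\<Sum>a\<in>A. q a * (ln (q a) - ln (r a))) \<le> 0" and a: "a \<in> A"
  then have "(\<Sum>a\<in>A. F a) = 0" unfolding sumF using sum_nonneg[of A F, OF F0] le by linarith
  then have Fa: "F a = 0" using F0 fin a by (simp add: sum_nonneg_eq_0_iff)
  show "q a = r a"
  proof (cases "q a = 0")
    case False
    then have qa: "q a > 0" using q[OF a] by simp
    have "q a * (ln (r a / q a) - (r a / q a - 1)) = 0"
    proof -
      have "q a * (r a / q a - 1) = r a - q a" using qa by (simp add: field_simps)
      then show ?thesis using Fa unfolding ln_quot[OF a qa] F_def by (simp only: right_diff_distrib)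
    qed
    then have "ln (r a / q a) = r a / q a - 1" using qa by simp
    then have "r a / q a = 1" using pos[OF a qa] qa by (intro ln_eq_minus_one) auto
    then show ?thesis using qa by simp
  qed (use Fa in \<open>simp add: F_def\<close>)
qed

definition xlnx :: "real \<Rightarrow> real" where "xlnx t = t * ln t"

definition pair_mass :: "int \<Rightarrow> nat \<Rightarrow> (column \<Rightarrow> real) \<Rightarrow> nat \<Rightarrow> int \<Rightarrow> int \<Rightarrow> real" where
  "pair_mass p d Q i s t = (\<Sum>a\<in>{a \<in> columns_of_sum p d 0. (fst a, snd a i) = (s, t)}. Q a)"

definition entry_mass :: "int \<Rightarrow> nat \<Rightarrow> (column \<Rightarrow> real) \<Rightarrow> int \<Rightarrow> real" where
  "entry_mass p d Q s = (\<Sum>a\<in>{a \<in> columns_of_sum p d 0. fst a = s}. Q a)"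

text \<open>
  The limits of the empirical laws of columns for which compatible matchings exist.
\<close>

definition symmetric_laws :: "int \<Rightarrow> nat \<Rightarrow> (column \<Rightarrow> real) set" where
  "symmetric_laws p d = {Q. (\<forall>a\<in>columns_of_sum p d 0. Q a \<ge> 0) \<and> (\<Sum>a\<in>columns_of_sum p d 0. Q a) = 1 \<and>
     (\<forall>i<d. \<forall>s\<in>residues p. \<forall>t\<in>residues p. pair_mass p d Q i s t = pair_mass p d Q i t s)}"

text \<open>
  With \<open>(X, Y\<^sub>1, \<dots>, Y\<^sub>d)\<close> distributed as \<open>Q\<close>, this is \<open>H(X, Y\<^sub>1, \<dots>, Y\<^sub>d) - 1/2 \<Sum>\<^sub>i H(X, Y\<^sub>i)\<close>: the first entropy
  counts the arrays of type \<open>n Q\<close>, and \<open>exp (- n/2 H(X, Y\<^sub>i))\<close> is the probability that a random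
  matching produces row \<open>i\<close>, up to factors that are polynomial in \<open>n\<close>.
\<close>

definition growth_rate :: "int \<Rightarrow> nat \<Rightarrow> (column \<Rightarrow> real) \<Rightarrow> real" where
  "growth_rate p d Q = (\<Sum>i<d. \<Sum>s\<in>residues p. \<Sum>t\<in>residues p. xlnx (pair_mass p d Q i s t)) / 2
     - (\<Sum>a\<in>columns_of_sum p d 0. xlnx (Q a))"

lemma finite_residues [simp]: "finite (residues p)" by (simp add: residues_def)

lemma columnsD:
  assumes "a \<in> columns_of_sum p d g"
  shows "fst a \<in> residues p" "i < d \<Longrightarrow> snd a i \<in> residues p" "(\<Sum>i<d. snd a i) mod p = g"
    "snd a \<in> PiE {..<d} (\<lambda>_. residues p)"
  using assms all_columnsD(1)[of a p d] all_columnsD(2)[of a p d i] by (simp_all add: columns_of_sum_def all_columns_def mem_Times_iff)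

lemma sum_pair_mass:
  assumes "i < d"
  shows "(\<Sum>s\<in>residues p. \<Sum>t\<in>residues p. pair_mass p d Q i s t * F s t) =
    (\<Sum>a\<in>columns_of_sum p d 0. Q a * F (fst a) (snd a i))"
proof -
  have "(\<Sum>a\<in>columns_of_sum p d 0. Q a * F (fst a) (snd a i)) =
      (\<Sum>z\<in>residues p \<times> residues p. \<Sum>a\<in>{a \<in> columns_of_sum p d 0. (fst a, snd a i) = z}. Q a * F (fst a) (snd a i))"
    using assms by (intro sum.group[symmetric] finite_cartesian_product image_subsetI)
      (simp_all add: columnsD(1)[where g = 0] columnsD(2)[where g = 0])
  also have "\<dots> = (\<Sum>z\<in>residues p \<times> residues p. pair_mass p d Q i (fst z) (snd z) * F (fst z) (snd z))"
    unfolding pair_mass_def sum_distrib_right by (intro sum.cong) auto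
  finally show ?thesis by (simp add: sum.cartesian_product case_prod_beta)
qed

lemma sum_entry_mass:
  "(\<Sum>s\<in>residues p. entry_mass p d Q s * F s) = (\<Sum>a\<in>columns_of_sum p d 0. Q a * F (fst a))"
proof -
  have "(\<Sum>a\<in>columns_of_sum p d 0. Q a * F (fst a)) =
      (\<Sum>s\<in>residues p. \<Sum>a\<in>{a \<in> columns_of_sum p d 0. fst a = s}. Q a * F (fst a))"
    using columnsD(1)[of _ p d 0] by (intro sum.group[symmetric]) auto
  also have "\<dots> = (\<Sum>s\<in>residues p. entry_mass p d Q s * F s)"
    unfolding entry_mass_def sum_distrib_right by (intro sum.cong) auto
  finally show ?thesis by simp
qed

lemma entry_mass_eq:
  assumes "i < d"
  shows "entry_mass p d Q s = (\<Sum>t\<in>residues p. pair_mass p d Q i s t)"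
proof -
  have "(\<Sum>t\<in>residues p. \<Sum>a\<in>{a \<in> {a \<in> columns_of_sum p d 0. fst a = s}. snd a i = t}. Q a) = entry_mass p d Q s"
    unfolding entry_mass_def using columnsD(2)[of _ p d 0 i] assms by (intro sum.group) auto
  moreover have "{a \<in> {a \<in> columns_of_sum p d 0. fst a = s}. snd a i = t} = {a \<in> columns_of_sum p d 0. (fst a, snd a i) = (s, t)}" for t
    by auto
  ultimately show ?thesis by (simp add: pair_mass_def)
qed

lemma column_determined:
  assumes a: "a \<in> columns_of_sum p d g" and b: "b \<in> columns_of_sum p d g" and k: "k < d"
    and x: "fst a = fst b" and y: "restrict (snd a) ({..<d} - {k}) = restrict (snd b) ({..<d} - {k})"
  shows "a = b"
proof -
  have off: "snd a i = snd b i" if "i < d" "i \<noteq> k" for i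
    using fun_cong[OF y, of i] that by simp
  have "(\<Sum>i<d. snd a i) = snd a k + (\<Sum>i\<in>{..<d}-{k}. snd b i)"
    using k off by (subst sum.remove[of _ k]) (auto intro: sum.cong)
  moreover have "(\<Sum>i<d. snd b i) = snd b k + (\<Sum>i\<in>{..<d}-{k}. snd b i)"
    using k by (subst sum.remove[of _ k]) auto
  ultimately have "(snd a k - snd b k) mod p = ((\<Sum>i<d. snd a i) - (\<Sum>i<d. snd b i)) mod p" by simp
  also have "\<dots> = 0" using columnsD(3)[OF a] columnsD(3)[OF b] by (metis diff_self mod_0 mod_diff_eq)
  finally have "snd a k mod p = snd b k mod p" by (simp add: mod_eq_dvd_iff dvd_eq_mod_eq_0)
  moreover have "snd a k mod p = snd a k" "snd b k mod p = snd b k"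
    using columnsD(2)[OF a k] columnsD(2)[OF b k] by (simp_all add: residues_def)
  ultimately have "snd a k = snd b k" by simp
  then have "snd a i = snd b i" if "i < d" for i using off that by (cases "i = k") auto
  then have "snd a = snd b"
    using columnsD(4)[OF a] columnsD(4)[OF b] by (intro PiE_ext[of _ "{..<d}" "\<lambda>_. residues p"]) auto
  then show ?thesis using x by (simp add: prod_eq_iff)
qed

context
  fixes p :: int and d :: nat and Q :: "column \<Rightarrow> real"
  assumes d3: "d \<ge> 3" and Q: "Q \<in> symmetric_laws p d"
begin

private abbreviation (input) "C \<equiv> columns_of_sum p d 0"
private abbreviation (input) "m \<equiv> pair_mass p d Q"
private abbreviation (input) "\<pi> \<equiv> entry_mass p d Q"

text \<open>
  The law under which the \<open>Y\<^sub>i\<close> with \<open>i \<noteq> k\<close> are conditionally independent given \<open>X\<close> with the same pair laws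
  as under \<open>Q\<close>, while \<open>Y\<^sub>k\<close> is determined by the vanishing of the sum.
\<close>

private definition ref :: "nat \<Rightarrow> column \<Rightarrow> real" where
  "ref k a = (\<Prod>i\<in>{..<d} - {k}. m i (fst a) (snd a i)) / \<pi> (fst a) ^ (d - 2)"

private lemma Q_nonneg: "a \<in> C \<Longrightarrow> Q a \<ge> 0" and Q_total: "(\<Sum>a\<in>C. Q a) = 1"
  and m_sym: "i < d \<Longrightarrow> s \<in> residues p \<Longrightarrow> t \<in> residues p \<Longrightarrow> m i s t = m i t s"
  using Q by (auto simp: symmetric_laws_def)

private lemma m_nonneg: "m i s t \<ge> 0"
  unfolding pair_mass_def by (intro sum_nonneg) (auto intro: Q_nonneg)

private lemma \<pi>_nonneg: "\<pi> s \<ge> 0"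
  unfolding entry_mass_def by (intro sum_nonneg) (auto intro: Q_nonneg)

private lemma Q_le_m: "a \<in> C \<Longrightarrow> Q a \<le> m i (fst a) (snd a i)"
  unfolding pair_mass_def by (rule member_le_sum) (auto intro: Q_nonneg)

private lemma Q_le_\<pi>: "a \<in> C \<Longrightarrow> Q a \<le> \<pi> (fst a)"
  unfolding entry_mass_def by (rule member_le_sum) (auto intro: Q_nonneg)

private lemma m_le_\<pi>: "i < d \<Longrightarrow> t \<in> residues p \<Longrightarrow> m i s t \<le> \<pi> s"
  unfolding entry_mass_eq[of i d p Q s] by (rule member_le_sum) (auto intro: m_nonneg)

private lemma m_le_\<pi>': "i < d \<Longrightarrow> s \<in> residues p \<Longrightarrow> t \<in> residues p \<Longrightarrow> m i s t \<le> \<pi> t"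
  using m_le_\<pi>[of i s t] m_sym[of i s t] by simp

private lemma \<pi>_total: "(\<Sum>s\<in>residues p. \<pi> s) = 1"
  using sum_entry_mass[where F = "\<lambda>_. 1" and Q = Q and p = p and d = d] Q_total by simp

private lemma sum_ref_le: 
  assumes k: "k < d" shows "(\<Sum>a\<in>C. ref k a) \<le> 1"
proof -
  let ?I = "{..<d} - {k}"
  let ?g = "\<lambda>a::column. (fst a, restrict (snd a) ?I)"
  let ?h = "\<lambda>(x, y). (\<Prod>i\<in>?I. m i x (y i)) / \<pi> x ^ (d - 2)"
  have inj: "inj_on ?g C" by (rule inj_onI) (use column_determined k in auto)
  have "(\<Sum>a\<in>C. ref k a) = (\<Sum>a\<in>C. ?h (?g a))" by (intro sum.cong) (auto simp: ref_def)
  also have "\<dots> = (\<Sum>z\<in>?g ` C. ?h z)" by (simp add: sum.reindex[OF inj])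
  also have "\<dots> \<le> (\<Sum>z\<in>residues p \<times> PiE ?I (\<lambda>_. residues p). ?h z)"
  proof (rule sum_mono2)
    show "?g ` C \<subseteq> residues p \<times> PiE ?I (\<lambda>_. residues p)"
    proof
      fix z assume "z \<in> ?g ` C"
      then obtain a where a: "a \<in> C" "z = ?g a" by blast
      have "restrict (snd a) ?I \<in> PiE ?I (\<lambda>_. residues p)"
        by (rule restrict_PiE_iff[THEN iffD2]) (use columnsD(2)[OF a(1)] in auto)
      then show "z \<in> residues p \<times> PiE ?I (\<lambda>_. residues p)"
        unfolding a(2) using columnsD(1)[OF a(1)] by (rule SigmaI[rotated])
    qed
    show "0 \<le> ?h z" for z
      unfolding case_prod_beta
      by (rule divide_nonneg_nonneg[OF prod_nonneg zero_le_power]) (rule m_nonneg \<pi>_nonneg)+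
    show "finite (residues p \<times> PiE ?I (\<lambda>_. residues p))"
      by (intro finite_cartesian_product finite_PiE) auto
  qed
  also have "(\<Sum>z\<in>residues p \<times> PiE ?I (\<lambda>_. residues p). ?h z) = (\<Sum>x\<in>residues p. (\<Sum>y\<in>PiE ?I (\<lambda>_. residues p). \<Prod>i\<in>?I. m i x (y i)) / \<pi> x ^ (d - 2))"
    by (simp add: sum.cartesian_product[symmetric] sum_divide_distrib)
  also have "\<dots> = (\<Sum>x\<in>residues p. (\<Prod>i\<in>?I. \<Sum>t\<in>residues p. m i x t) / \<pi> x ^ (d - 2))"
    by (subst prod_sum_PiE) auto
  also have "\<dots> = (\<Sum>x\<in>residues p. \<pi> x)"
  proof (rule sum.cong[OF refl])
    fix x
    have "(\<Prod>i\<in>?I. \<Sum>t\<in>residues p. m i x t) = (\<Prod>i\<in>?I. \<pi> x)"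
      by (intro prod.cong refl) (auto simp: entry_mass_eq)
    also have "\<dots> = \<pi> x ^ (d - 1)" using k by simp
    also have "d - 1 = Suc (d - 2)" using d3 by simp
    finally show "(\<Prod>i\<in>?I. \<Sum>t\<in>residues p. m i x t) / \<pi> x ^ (d - 2) = \<pi> x" by simp
  qed
  finally show ?thesis using \<pi>_total by simp
qed

private lemma ref_pos: "a \<in> C \<Longrightarrow> Q a > 0 \<Longrightarrow> ref k a > 0"
  unfolding ref_def using Q_le_m[of a] Q_le_\<pi>[of a]
  by (intro divide_pos_pos prod_pos zero_less_power) (auto intro: less_le_trans)

private lemma ref_nonneg: "ref k a \<ge> 0"
  unfolding ref_def by (intro divide_nonneg_nonneg prod_nonneg zero_le_power) (auto simp: m_nonneg \<pi>_nonneg)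

text \<open>
  The relative entropy of \<open>Q\<close> with respect to \<open>ref k\<close>. These gaps and the mutual informations of \<open>X\<close> and
  \<open>Y\<^sub>i\<close> are the nonnegative quantities into which the growth rate decomposes.
\<close>

private definition gap :: "nat \<Rightarrow> real" where
  "gap k = (\<Sum>a\<in>C. Q a * (ln (Q a) - ln (ref k a)))"

private definition mutual :: "nat \<Rightarrow> real" where
  "mutual i = (\<Sum>z\<in>residues p \<times> residues p. m i (fst z) (snd z) * (ln (m i (fst z) (snd z)) - ln (\<pi> (fst z) * \<pi> (snd z))))"

private lemma
  assumes k: "k < d"
  shows gap_nonneg: "0 \<le> gap k"
    and gap_zero: "gap k \<le> 0 \<Longrightarrow> a \<in> C \<Longrightarrow> Q a = ref k a"
proof -
  have le: "(\<Sum>a\<in>C. ref k a) \<le> (\<Sum>a\<in>C. Q a)" using sum_ref_le[OF k] Q_total by simp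
  have r0: "0 \<le> ref k a" if "a \<in> C" for a by (rule ref_nonneg)
  note gibbs = gibbs_inequality[OF finite_columns Q_nonneg r0 ref_pos le, folded gap_def]
  show "0 \<le> gap k" by (rule gibbs(1))
  show "gap k \<le> 0 \<Longrightarrow> a \<in> C \<Longrightarrow> Q a = ref k a" by (rule gibbs(2))
qed

private lemma sum_m: "i < d \<Longrightarrow> (\<Sum>z\<in>residues p \<times> residues p. m i (fst z) (snd z)) = 1"
  using sum_pair_mass[of i d p Q "\<lambda>_ _. 1"] Q_total by (simp add: sum.cartesian_product case_prod_beta)

private lemma
  assumes i: "i < d"
  shows mutual_nonneg: "0 \<le> mutual i"
    and mutual_zero: "mutual i \<le> 0 \<Longrightarrow> s \<in> residues p \<Longrightarrow> t \<in> residues p \<Longrightarrow> m i s t = \<pi> s * \<pi> t"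
proof -
  have "(\<Sum>z\<in>residues p \<times> residues p. \<pi> (fst z) * \<pi> (snd z)) = (\<Sum>s\<in>residues p. \<pi> s) * (\<Sum>t\<in>residues p. \<pi> t)"
    unfolding sum_product sum.cartesian_product case_prod_beta by (rule refl)
  then have le: "(\<Sum>z\<in>residues p \<times> residues p. \<pi> (fst z) * \<pi> (snd z)) \<le>
      (\<Sum>z\<in>residues p \<times> residues p. m i (fst z) (snd z))" using \<pi>_total sum_m[OF i] by simp
  have pos: "0 < \<pi> (fst z) * \<pi> (snd z)" if "z \<in> residues p \<times> residues p" "0 < m i (fst z) (snd z)" for z
  proof (rule mult_pos_pos)
    have z: "fst z \<in> residues p" "snd z \<in> residues p" using that(1) by (simp_all add: mem_Times_iff)
    show "0 < \<pi> (fst z)" by (rule less_le_trans[OF that(2) m_le_\<pi>[OF i z(2)]])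
    show "0 < \<pi> (snd z)" by (rule less_le_trans[OF that(2) m_le_\<pi>'[OF i z]])
  qed
  have q0: "0 \<le> m i (fst z) (snd z)" if "z \<in> residues p \<times> residues p" for z by (rule m_nonneg)
  have r0: "0 \<le> \<pi> (fst z) * \<pi> (snd z)" if "z \<in> residues p \<times> residues p" for z
    by (intro mult_nonneg_nonneg \<pi>_nonneg)
  note gibbs = gibbs_inequality[of "residues p \<times> residues p", OF _ q0 r0 pos le, folded mutual_def]
  show "0 \<le> mutual i" by (rule gibbs(1)) simp
  assume a: "mutual i \<le> 0" "s \<in> residues p" "t \<in> residues p"
  have "m i (fst (s,t)) (snd (s,t)) = \<pi> (fst (s,t)) * \<pi> (snd (s,t))"
    by (rule gibbs(2)) (use a in simp_all)
  then show "m i s t = \<pi> s * \<pi> t" by simp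
qed

private definition "hQ = (\<Sum>a\<in>C. xlnx (Q a))"
private definition "hm i = (\<Sum>s\<in>residues p. \<Sum>t\<in>residues p. xlnx (m i s t))"
private definition "h\<pi> = (\<Sum>s\<in>residues p. xlnx (\<pi> s))"

private lemma hm_eq: "i < d \<Longrightarrow> hm i = (\<Sum>a\<in>C. Q a * ln (m i (fst a) (snd a i)))"
  unfolding hm_def xlnx_def by (rule sum_pair_mass)

private lemma h\<pi>_eq: "h\<pi> = (\<Sum>a\<in>C. Q a * ln (\<pi> (fst a)))"
  unfolding h\<pi>_def xlnx_def by (rule sum_entry_mass)

private lemma h\<pi>_eq': "i < d \<Longrightarrow> h\<pi> = (\<Sum>a\<in>C. Q a * ln (\<pi> (snd a i)))"
proof -
  assume i: "i < d"
  have "(\<Sum>a\<in>C. Q a * ln (\<pi> (snd a i))) = (\<Sum>s\<in>residues p. \<Sum>t\<in>residues p. m i s t * ln (\<pi> t))"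
    by (rule sum_pair_mass[OF i, symmetric])
  also have "\<dots> = (\<Sum>t\<in>residues p. (\<Sum>s\<in>residues p. m i s t) * ln (\<pi> t))"
    by (subst sum.swap) (simp add: sum_distrib_right)
  also have "\<dots> = (\<Sum>t\<in>residues p. (\<Sum>s\<in>residues p. m i t s) * ln (\<pi> t))"
    by (rule sum.cong[OF refl], rule arg_cong2[where f = "(*)"], rule sum.cong[OF refl])
      (use m_sym[OF i] in auto)
  also have "\<dots> = h\<pi>" unfolding h\<pi>_def xlnx_def using entry_mass_eq[OF i] by simp
  finally show ?thesis by simp
qed

private lemma gap_eq: 
  assumes k: "k < d" shows "gap k = hQ - (\<Sum>i\<in>{..<d} - {k}. hm i) + real (d - 2) * h\<pi>"
proof -
  have "Q a * (ln (Q a) - ln (ref k a)) = xlnx (Q a) - (\<Sum>i\<in>{..<d} - {k}. Q a * ln (m i (fst a) (snd a i)))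
      + real (d - 2) * (Q a * ln (\<pi> (fst a)))" if a: "a \<in> C" for a
  proof (cases "Q a = 0")
    case False
    then have pos: "Q a > 0" using Q_nonneg[OF a] by simp
    have mp: "m i (fst a) (snd a i) > 0" for i using Q_le_m[OF a, of i] pos by simp
    have pp: "\<pi> (fst a) > 0" using Q_le_\<pi>[OF a] pos by simp
    have "(\<Prod>i\<in>{..<d} - {k}. m i (fst a) (snd a i)) > 0" by (intro prod_pos) (simp add: mp)
    then have "ln (ref k a) = ln (\<Prod>i\<in>{..<d} - {k}. m i (fst a) (snd a i)) - ln (\<pi> (fst a) ^ (d - 2))"
      unfolding ref_def by (rule ln_divide_pos[OF _ zero_less_power[OF pp]])
    also have "ln (\<Prod>i\<in>{..<d} - {k}. m i (fst a) (snd a i)) = (\<Sum>i\<in>{..<d} - {k}. ln (m i (fst a) (snd a i)))"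
      by (intro ln_prod) (simp_all add: less_imp_neq[OF mp, symmetric])
    also have "ln (\<pi> (fst a) ^ (d - 2)) = real (d - 2) * ln (\<pi> (fst a))" using pp by (intro ln_realpow)
    finally have e: "ln (ref k a) = (\<Sum>i\<in>{..<d} - {k}. ln (m i (fst a) (snd a i))) - real (d - 2) * ln (\<pi> (fst a))" .
    show ?thesis unfolding e sum_distrib_left[symmetric] xlnx_def by (simp add: algebra_simps)
  qed (simp add: xlnx_def)
  then have "gap k = (\<Sum>a\<in>C. xlnx (Q a) - (\<Sum>i\<in>{..<d} - {k}. Q a * ln (m i (fst a) (snd a i)))
      + real (d - 2) * (Q a * ln (\<pi> (fst a))))" unfolding gap_def by simp
  also have "\<dots> = hQ - (\<Sum>i\<in>{..<d} - {k}. \<Sum>a\<in>C. Q a * ln (m i (fst a) (snd a i))) + real (d - 2) * h\<pi>"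
    unfolding sum.distrib sum_subtractf hQ_def h\<pi>_eq by (simp add: sum_distrib_left sum.swap[of _ _ C])
  finally show ?thesis by (simp add: hm_eq)
qed

private lemma mutual_eq:
  assumes i: "i < d" shows "mutual i = hm i - 2 * h\<pi>"
proof -
  have "mutual i = (\<Sum>a\<in>C. Q a * (ln (m i (fst a) (snd a i)) - ln (\<pi> (fst a) * \<pi> (snd a i))))"
    unfolding mutual_def using sum_pair_mass[OF i, of p Q "\<lambda>s t. ln (m i s t) - ln (\<pi> s * \<pi> t)"]
    by (simp add: sum.cartesian_product case_prod_beta)
  also have "\<dots> = (\<Sum>a\<in>C. Q a * ln (m i (fst a) (snd a i)) - Q a * ln (\<pi> (fst a)) - Q a * ln (\<pi> (snd a i)))"
  proof (rule sum.cong[OF refl])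
    fix a assume a: "a \<in> C"
    show "Q a * (ln (m i (fst a) (snd a i)) - ln (\<pi> (fst a) * \<pi> (snd a i))) =
       Q a * ln (m i (fst a) (snd a i)) - Q a * ln (\<pi> (fst a)) - Q a * ln (\<pi> (snd a i))"
    proof (cases "Q a = 0")
      case False
      then have pos: "Q a > 0" using Q_nonneg[OF a] by simp
      have "\<pi> (fst a) > 0" "\<pi> (snd a i) > 0"
        using Q_le_\<pi>[OF a] Q_le_m[OF a, of i] m_le_\<pi>'[OF i, of "fst a" "snd a i"] columnsD(1,2)[OF a] i pos by auto
      then show ?thesis by (simp add: ln_mult algebra_simps)
    qed simp
  qed
  finally show ?thesis using hm_eq[OF i] h\<pi>_eq h\<pi>_eq'[OF i] by (simp add: sum_subtractf)
qed

text \<open>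
  Both sides are linear in the entropy of \<open>Q\<close>, the entropies of the pairs \<open>(X, Y\<^sub>i)\<close> and the entropy
  of \<open>X\<close>. The coefficients of the last one cancel, which fixes the weight \<open>(d - 2) / 2\<close> of the mutual informations;
  this weight is positive exactly for \<open>d \<ge> 3\<close>.
\<close>

private lemma growth_rate_eq:
  "real d * growth_rate p d Q = - (\<Sum>k<d. gap k) - real (d - 2) / 2 * (\<Sum>i<d. mutual i)"
proof -
  have d2: "real (d - 2) = real d - 2" using d3 by simp
  have "(\<Sum>k<d. gap k) = (\<Sum>k<d. hQ - ((\<Sum>i<d. hm i) - hm k) + real (d - 2) * h\<pi>)"
    by (intro sum.cong refl) (simp add: gap_eq sum.remove[of "{..<d}"])
  also have "\<dots> = real d * hQ - (real d - 1) * (\<Sum>i<d. hm i) + real d * real (d - 2) * h\<pi>"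
    by (simp add: sum.distrib sum_subtractf algebra_simps)
  finally have 1: "(\<Sum>k<d. gap k) = real d * hQ - (real d - 1) * (\<Sum>i<d. hm i) + real d * real (d - 2) * h\<pi>" .
  have 2: "(\<Sum>i<d. mutual i) = (\<Sum>i<d. hm i) - 2 * real d * h\<pi>"
    by (simp add: mutual_eq sum_subtractf)
  have 3: "growth_rate p d Q = (\<Sum>i<d. hm i) / 2 - hQ" by (simp add: growth_rate_def hm_def hQ_def)
  show ?thesis unfolding 1 2 3 d2 by (simp add: field_simps)
qed


private lemma growth_rate_nonpos': "growth_rate p d Q \<le> 0"
proof -
  have "0 \<le> (\<Sum>k<d. gap k)" by (intro sum_nonneg) (simp add: gap_nonneg)
  moreover have "0 \<le> real (d - 2) / 2 * (\<Sum>i<d. mutual i)"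
    by (intro mult_nonneg_nonneg sum_nonneg) (simp_all add: mutual_nonneg)
  ultimately have "real d * growth_rate p d Q \<le> 0" unfolding growth_rate_eq by linarith
  then show ?thesis using d3 by (simp add: mult_le_0_iff)
qed

text \<open>
  If the growth rate vanishes, all gaps and mutual informations vanish, so any \<open>d - 1\<close> of the \<open>Y\<^sub>i\<close> are
  independent of each other and of \<open>X\<close>.
\<close>

private lemma extremal:
  assumes "growth_rate p d Q \<ge> 0"
  shows "k < d \<Longrightarrow> a \<in> C \<Longrightarrow> Q a = \<pi> (fst a) * (\<Prod>i\<in>{..<d} - {k}. \<pi> (snd a i))"
proof -
  have "growth_rate p d Q = 0" using assms growth_rate_nonpos' by simp
  then have eq: "(\<Sum>k<d. gap k) + real (d - 2) / 2 * (\<Sum>i<d. mutual i) = 0" using growth_rate_eq by simp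
  have g0: "(\<Sum>k<d. gap k) \<ge> 0" and u0: "(\<Sum>i<d. mutual i) \<ge> 0"
    by (auto intro!: sum_nonneg simp: gap_nonneg mutual_nonneg)
  have u0': "real (d - 2) / 2 * (\<Sum>i<d. mutual i) \<ge> 0" using u0 by simp
  have gz: "(\<Sum>k<d. gap k) = 0" and uz: "real (d - 2) / 2 * (\<Sum>i<d. mutual i) = 0"
    using eq g0 u0' by linarith+
  have "(\<Sum>i<d. mutual i) = 0" using uz d3 by simp
  then have mz: "mutual i = 0" if "i < d" for i
    using that by (subst (asm) sum_nonneg_eq_0_iff) (auto simp: mutual_nonneg)
  have gz: "gap k = 0" if "k < d" for k
    using gz that by (subst (asm) sum_nonneg_eq_0_iff) (auto simp: gap_nonneg)
  assume k: "k < d" and a: "a \<in> C"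
  have "Q a = (\<Prod>i\<in>{..<d} - {k}. m i (fst a) (snd a i)) / \<pi> (fst a) ^ (d - 2)"
    using gap_zero[OF k _ a] gz[OF k] by (simp add: ref_def)
  also have "(\<Prod>i\<in>{..<d} - {k}. m i (fst a) (snd a i)) = (\<Prod>i\<in>{..<d} - {k}. \<pi> (fst a) * \<pi> (snd a i))"
  proof (rule prod.cong[OF refl])
    fix i assume "i \<in> {..<d} - {k}"
    then show "m i (fst a) (snd a i) = \<pi> (fst a) * \<pi> (snd a i)"
      using mz[of i] columnsD(1,2)[OF a] by (intro mutual_zero) auto
  qed
  also have "\<dots> = \<pi> (fst a) ^ Suc (d - 2) * (\<Prod>i\<in>{..<d} - {k}. \<pi> (snd a i))"
  proof -
    have "card ({..<d} - {k}) = Suc (d - 2)" using k d3 by simp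
    then show ?thesis by (simp add: prod.distrib)
  qed
  finally show "Q a = \<pi> (fst a) * (\<Prod>i\<in>{..<d} - {k}. \<pi> (snd a i))" by simp
qed

private lemma ex_entry_mass_pos: "\<exists>x\<in>residues p. \<pi> x > 0"
proof (rule ccontr)
  assume "\<not> ?thesis"
  then have "(\<Sum>s\<in>residues p. \<pi> s) \<le> 0" by (intro sum_nonpos) (auto simp: not_less)
  then show False using \<pi>_total by simp
qed

text \<open>
  Comparing two of the product formulas of \<open>extremal\<close>, for \<open>k = 0\<close> and \<open>k = 1\<close>, at a column whose
  entries from index \<open>2\<close> on are in the support of \<open>\<pi>\<close>.
\<close>

private lemma reflection:
  assumes rate: "growth_rate p d Q \<ge> 0" and p0: "p > 0"
    and u: "u \<in> residues p" and z: "\<And>i. i \<in> {2..<d} \<Longrightarrow> z i \<in> residues p \<and> \<pi> (z i) > 0"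
  shows "\<pi> u = \<pi> ((- u - (\<Sum>i\<in>{2..<d}. z i)) mod p)"
proof -
  obtain x where x: "x \<in> residues p" "\<pi> x > 0"
    using ex_entry_mass_pos by blast
  define v where "v = (- u - (\<Sum>i\<in>{2..<d}. z i)) mod p"
  define y where "y = (\<lambda>i\<in>{..<d}. if i = 0 then u else if i = 1 then v else z i)"
  define a where "a = (x, y)"
  have vR: "v \<in> residues p" using p0 by (simp add: v_def residues_def)
  have split: "{..<d} = insert 0 (insert 1 {2..<d})" using d3 by auto
  have y2: "y i = z i" if "i \<in> {2..<d}" for i
    using that d3 by (auto simp: y_def)
  have yv: "y 0 = u" "y 1 = v" using d3 by (auto simp: y_def)
  have "(\<Sum>i<d. y i) = u + (v + (\<Sum>i\<in>{2..<d}. z i))"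
    unfolding split using yv y2 by simp
  also have "\<dots> = v + (u + (\<Sum>i\<in>{2..<d}. z i))" by simp
  also have "\<dots> mod p = ((- u - (\<Sum>i\<in>{2..<d}. z i)) + (u + (\<Sum>i\<in>{2..<d}. z i))) mod p"
    unfolding v_def by (rule mod_add_left_eq)
  finally have "(\<Sum>i<d. y i) mod p = 0" by simp
  moreover have "y \<in> PiE {..<d} (\<lambda>_. residues p)"
    using u vR z by (auto simp: y_def PiE_def Pi_def)
  ultimately have aC: "a \<in> C" using x by (simp add: a_def columns_of_sum_def all_columns_def)
  define P where "P = (\<Prod>i\<in>{2..<d}. \<pi> (z i))"
  have P: "P > 0" unfolding P_def using z by (intro prod_pos) auto
  have d0: "{..<d} - {0} = insert 1 {2..<d}" and d1: "{..<d} - {1} = insert 0 {2..<d}" using d3 by auto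
  have "Q a = \<pi> x * (\<pi> v * P)"
    using extremal[OF rate _ aC, of 0] d3 y2 yv unfolding d0 by (simp add: a_def P_def)
  moreover have "Q a = \<pi> x * (\<pi> u * P)"
    using extremal[OF rate _ aC, of 1] d3 y2 yv unfolding d1 by (simp add: a_def P_def)
  ultimately have "\<pi> u = \<pi> v" using x(2) P by simp
  then show ?thesis by (simp only: v_def)
qed

text \<open>
  If \<open>\<pi>\<close> charges two residues \<open>b\<close> and \<open>b'\<close>, changing the entry with index \<open>2\<close> from \<open>b\<close> to \<open>b'\<close>,
  which exists as \<open>d \<ge> 3\<close>, yields two reflections whose sums differ by \<open>b' - b\<close>. They compose to a nontrivial translation that preserves \<open>\<pi>\<close>; translations act transitively on residues modulo a prime, so \<open>\<pi>\<close> is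
  uniform. If \<open>\<pi>\<close> is concentrated at \<open>b\<close>, the reflection must fix \<open>b\<close>, that is \<open>d b = 0\<close>, and \<open>b = 0\<close>
  since \<open>p\<close> does not divide \<open>d\<close>.
\<close>

lemma growth_rate_extremal:
  assumes rate: "growth_rate p d Q \<ge> 0" and p: "prime p" "\<not> p dvd int d"
  shows "\<pi> 0 = 1 \<or> (\<forall>a\<in>C. Q a = 1 / of_int p ^ d)"
proof -
  have p0: "p > 0" using p(1) by (simp add: prime_gt_0_int)
  obtain b where b: "b \<in> residues p" "\<pi> b > 0"
    using ex_entry_mass_pos by blast
  show ?thesis
  proof (cases "\<exists>b'\<in>residues p. \<pi> b' > 0 \<and> b' \<noteq> b")
    case True
    then obtain b' where b': "b' \<in> residues p" "\<pi> b' > 0" "b' \<noteq> b" by blast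
    have shift: "\<pi> u = \<pi> ((u + (b - b')) mod p)" if u: "u \<in> residues p" for u
    proof -
      define w where "w = (- u - (\<Sum>i\<in>{2..<d}. b)) mod p"
      have wR: "w \<in> residues p" using p0 by (simp add: w_def residues_def)
      have "\<pi> u = \<pi> w" unfolding w_def by (rule reflection[OF rate p0 u]) (use b in auto)
      also have "\<dots> = \<pi> ((- w - (\<Sum>i\<in>{2..<d}. if i = 2 then b' else b)) mod p)"
        by (rule reflection[OF rate p0 wR]) (use b b' in auto)
      also have "(\<Sum>i\<in>{2..<d}. if i = 2 then b' else b) = (\<Sum>i\<in>{2..<d}. b) + (b' - b)"
      proof -
        have "2 \<in> {2..<d}" using d3 by simp
        then show ?thesis by (subst (1 2) sum.remove[of _ 2]) auto
      qed
      also have "(- w - ((\<Sum>i\<in>{2..<d}. b) + (b' - b))) mod p = (u + (b - b')) mod p"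
      proof -
        have "(- ((\<Sum>i\<in>{2..<d}. b) + (b' - b)) - w) mod p =
            (- ((\<Sum>i\<in>{2..<d}. b) + (b' - b)) - (- u - (\<Sum>i\<in>{2..<d}. b))) mod p"
          unfolding w_def by (rule mod_diff_right_eq)
        then show ?thesis by (simp add: algebra_simps)
      qed
      finally show ?thesis .
    qed
    have iter: "\<pi> ((u + int k * (b - b')) mod p) = \<pi> u" if u: "u \<in> residues p" for u k
    proof (induction k)
      case 0
      then show ?case using u by (simp add: residues_def)
    next
      case (Suc k)
      have "(u + int k * (b - b')) mod p \<in> residues p" using p0 by (simp add: residues_def)
      note this' = shift[OF this]
      have "((u + int k * (b - b')) mod p + (b - b')) mod p = (u + int k * (b - b') + (b - b')) mod p"
        by (rule mod_add_left_eq)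
      also have "u + int k * (b - b') + (b - b') = u + int (Suc k) * (b - b')" by (simp add: algebra_simps)
      finally show ?case using this' Suc by (simp only:)
    qed
    have cop: "coprime (b - b') p"
    proof -
      have "\<not> p dvd (b - b')"
      proof
        assume "p dvd (b - b')"
        then have "b mod p = b' mod p" by (simp add: mod_eq_dvd_iff)
        then show False using b(1) b'(1,3) by (simp add: residues_def)
      qed
      then show ?thesis using p(1) by (metis coprime_commute prime_imp_coprime_int prime_int_iff)
    qed
    have const: "\<pi> u = \<pi> 0" if u: "u \<in> residues p" for u
    proof -
      obtain v w where vw: "v * (b - b') + w * p = 1"
        using bezout_int[of "b - b'" p] cop by (metis coprime_imp_gcd_eq_1)
      define k where "k = nat ((v * u) mod p)"
      have "int k mod p = (v * u) mod p" using p0 by (simp add: k_def)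
      then have "(0 + int k * (b - b')) mod p = ((v * u) * (b - b')) mod p"
        by (metis add_0 mod_mult_left_eq)
      also have "(v * u) * (b - b') = u - (u * w) * p" using arg_cong[OF vw, of "(*) u"] by (simp add: algebra_simps)
      also have "(u - (u * w) * p) mod p = u" using u by (simp add: residues_def mod_diff_right_eq[symmetric])
      finally show ?thesis using iter[of 0 k] p0 by (simp add: residues_def)
    qed
    have "of_int p * \<pi> 0 = 1"
    proof -
      have "(\<Sum>s\<in>residues p. \<pi> s) = (\<Sum>s\<in>residues p. \<pi> 0)" by (intro sum.cong refl const)
      then show ?thesis using \<pi>_total p0 by (simp add: residues_def)
    qed
    then have pi0: "\<pi> u = 1 / of_int p" if "u \<in> residues p" for u using const[OF that] p0 by (simp add: field_simps)
    have "Q a = 1 / of_int p ^ d" if a: "a \<in> C" for a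
    proof -
      have "Q a = \<pi> (fst a) * (\<Prod>i\<in>{..<d} - {0}. \<pi> (snd a i))" using d3 by (intro extremal[OF rate _ a]) simp
      also have "\<dots> = (1 / of_int p) * (\<Prod>i\<in>{..<d} - {0}. 1 / of_int p)"
        by (intro arg_cong2[where f = "(*)"] prod.cong refl pi0 columnsD[OF a]) auto
      also have "\<dots> = (1 / of_int p) ^ (d - 1) * (1 / of_int p)" using d3 by simp
      also have "\<dots> = (1 / real_of_int p) ^ d" using d3 by (intro power_minus_mult) simp
      also have "\<dots> = 1 / of_int p ^ d" by (rule power_one_over)
      finally show ?thesis .
    qed
    then show ?thesis by blast
  next
    case False
    then have others: "\<pi> b' = 0" if "b' \<in> residues p" "b' \<noteq> b" for b'
      using that \<pi>_nonneg[of b'] by (metis less_eq_real_def)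
    have "\<pi> b = \<pi> ((- b - (\<Sum>i\<in>{2..<d}. b)) mod p)" by (rule reflection[OF rate p0 b(1)]) (use b in auto)
    also have "- b - (\<Sum>i\<in>{2..<d}. b) = - ((int d - 1) * b)" using d3 by (simp add: of_nat_diff algebra_simps)
    finally have "(- ((int d - 1) * b)) mod p = b"
      using others[of "(- ((int d - 1) * b)) mod p"] b(2) p0 by (fastforce simp: residues_def)
    then have "(- ((int d - 1) * b)) mod p = b mod p" using b(1) by (simp add: residues_def)
    then have "p dvd (- ((int d - 1) * b) - b)" by (simp add: mod_eq_dvd_iff)
    then have "p dvd int d * b" by (simp add: algebra_simps)
    then have "p dvd b" using p by (simp add: prime_dvd_mult_iff)
    then have "b = 0" using b(1) by (auto simp: residues_def dest: zdvd_imp_le)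
    moreover have "(\<Sum>s\<in>residues p. \<pi> s) = \<pi> b"
      using b(1) others by (subst sum.remove[of _ b]) (auto intro!: sum.neutral)
    ultimately show ?thesis using \<pi>_total by simp
  qed
qed

end


lemma continuous_on_xlnx: "continuous_on {0..} xlnx"
proof -
  have "continuous (at t within {0..}) xlnx" if "t \<ge> 0" for t
  proof (cases "t = 0")
    case True
    have "((\<lambda>x::real. x * ln x) \<longlongrightarrow> 0) (at_right 0)" by real_asymp
    then have "(xlnx \<longlongrightarrow> xlnx 0) (at 0 within {0<..})" by (simp add: xlnx_def[abs_def])
    then have "(xlnx \<longlongrightarrow> xlnx 0) (at 0 within {0..})"
      unfolding at_within_def by (simp add: Diff_eq atLeast_def greaterThan_def Int_def Compl_eq less_le conj_commute)
        (smt (verit) Collect_cong)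
    then show ?thesis using True by (simp add: continuous_within)
  next
    case False
    then have "t > 0" using that by simp
    then have "isCont xlnx t" unfolding xlnx_def[abs_def] by (intro continuous_intros) auto
    then show ?thesis by (rule continuous_at_imp_continuous_at_within)
  qed
  then show ?thesis by (simp add: continuous_on_eq_continuous_within)
qed

text \<open>
  The laws that stay away from both extremal ones form a compact set, on which the continuous function \<open>growth_rate\<close>
  attains its maximum; this maximum is negative.
\<close>

lemma growth_rate_uniformly_negative:
  assumes d: "d \<ge> 3" and p: "prime p" "\<not> p dvd int d" and eps: "\<epsilon>0 > 0" "\<epsilon> > 0"
  obtains \<eta> where "\<eta> > 0"
    "\<And>Q. Q \<in> symmetric_laws p d \<Longrightarrow> (\<And>a. a \<notin> columns_of_sum p d 0 \<Longrightarrow> Q a = 0) \<Longrightarrow>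
      entry_mass p d Q 0 \<le> 1 - \<epsilon>0 \<Longrightarrow> (\<exists>a\<in>columns_of_sum p d 0. \<bar>Q a - 1 / of_int p ^ d\<bar> \<ge> \<epsilon>) \<Longrightarrow>
      growth_rate p d Q \<le> - \<eta>"
proof -
  let ?C = "columns_of_sum p d 0"
  define K where "K = {Q. Q \<in> symmetric_laws p d \<and> (\<forall>a. a \<notin> ?C \<longrightarrow> Q a = 0) \<and>
      entry_mass p d Q 0 \<le> 1 - \<epsilon>0 \<and> (\<exists>a\<in>?C. \<bar>Q a - 1 / of_int p ^ d\<bar> \<ge> \<epsilon>)}"
  define B :: "(column \<Rightarrow> real) set" where "B = (PiE UNIV (\<lambda>a. if a \<in> ?C then {0..1} else {0}))"
  have "compactin (product_topology (\<lambda>_. euclidean) UNIV) B"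
    unfolding B_def compactin_PiE by auto
  then have compB: "compact B" by (simp add: euclidean_product_topology)
  have Q01: "Q a \<in> {0..1}" if "Q \<in> symmetric_laws p d" "a \<in> ?C" for Q a
  proof -
    have "Q a \<le> (\<Sum>a\<in>?C. Q a)" using that by (intro member_le_sum) (auto simp: symmetric_laws_def)
    then show ?thesis using that by (auto simp: symmetric_laws_def)
  qed
  have K_eq: "K = B \<inter> ({Q. (\<Sum>a\<in>?C. Q a) = 1} \<inter>
      (\<Inter>i\<in>{..<d}. \<Inter>s\<in>residues p. \<Inter>t\<in>residues p. {Q. pair_mass p d Q i s t = pair_mass p d Q i t s}) \<inter>
      {Q. entry_mass p d Q 0 \<le> 1 - \<epsilon>0} \<inter> (\<Union>a\<in>?C. {Q. \<bar>Q a - 1 / of_int p ^ d\<bar> \<ge> \<epsilon>}))" (is "_ = B \<inter> ?R")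
  proof (rule Set.set_eqI)
    fix Q
    have B_iff: "Q \<in> B \<longleftrightarrow> (\<forall>a\<in>?C. 0 \<le> Q a \<and> Q a \<le> 1) \<and> (\<forall>a. a \<notin> ?C \<longrightarrow> Q a = 0)"
      unfolding B_def by (auto simp: PiE_iff)
    show "Q \<in> K \<longleftrightarrow> Q \<in> B \<inter> ?R"
    proof
      assume Q: "Q \<in> K"
      then have "Q \<in> symmetric_laws p d" by (simp add: K_def)
      then show "Q \<in> B \<inter> ?R" using Q Q01[of Q] B_iff by (auto simp: K_def symmetric_laws_def)
    next
      assume "Q \<in> B \<inter> ?R"
      then show "Q \<in> K" using B_iff by (auto simp: K_def symmetric_laws_def)
    qed
  qed
  have "closed ?R"
    unfolding pair_mass_def entry_mass_def
    by (intro closed_Int closed_INT closed_UN ballI closed_Collect_eq closed_Collect_le continuous_intros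
        continuous_on_product_coordinates finite_columns)
  then have compK: "compact K" unfolding K_eq by (rule compact_Int_closed[OF compB])
  have nonneg: "0 \<le> Q a" if "Q \<in> K" "a \<in> ?C" for Q a
    using that Q01[of Q a] by (auto simp: K_def)
  have cont: "continuous_on K (growth_rate p d)"
  proof -
    have "continuous_on K (\<lambda>Q. (\<Sum>i<d. \<Sum>s\<in>residues p. \<Sum>t\<in>residues p. xlnx (pair_mass p d Q i s t)) / 2
     - (\<Sum>a\<in>?C. xlnx (Q a)))"
    proof (intro continuous_on_diff continuous_on_divide continuous_on_sum continuous_on_const)
      show "continuous_on K (\<lambda>Q. xlnx (pair_mass p d Q i s t))" for i s t
        by (rule continuous_on_compose2[OF continuous_on_xlnx])
          (auto simp: pair_mass_def intro!: continuous_intros sum_nonneg nonneg continuous_on_subset[OF continuous_on_product_coordinates])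
      show "continuous_on K (\<lambda>Q. xlnx (Q a))" if "a \<in> ?C" for a
        by (rule continuous_on_compose2[OF continuous_on_xlnx])
          (use that in \<open>auto intro!: nonneg continuous_on_subset[OF continuous_on_product_coordinates]\<close>)
    qed simp
    then show ?thesis by (simp add: growth_rate_def[abs_def])
  qed
  have neg: "growth_rate p d Q < 0" if "Q \<in> K" for Q
  proof (rule ccontr)
    assume "\<not> growth_rate p d Q < 0"
    then have "entry_mass p d Q 0 = 1 \<or> (\<forall>a\<in>?C. Q a = 1 / of_int p ^ d)"
      using that d p by (intro growth_rate_extremal) (auto simp: K_def)
    then show False using that eps by (auto simp: K_def)
  qed
  show ?thesis
  proof (cases "K = {}")
    case True
    show ?thesis
    proof (rule that[of 1])
      fix Q assume "Q \<in> symmetric_laws p d" "\<And>a. a \<notin> ?C \<Longrightarrow> Q a = 0" "entry_mass p d Q 0 \<le> 1 - \<epsilon>0"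
        "\<exists>a\<in>?C. \<epsilon> \<le> \<bar>Q a - 1 / of_int p ^ d\<bar>"
      then have "Q \<in> K" unfolding K_def by blast
      then show "growth_rate p d Q \<le> - 1" using True by blast
    qed simp
  next
    case False
    then obtain Q0 where Q0: "Q0 \<in> K" "\<And>Q. Q \<in> K \<Longrightarrow> growth_rate p d Q \<le> growth_rate p d Q0"
      using continuous_attains_sup[OF compK _ cont] by blast
    show ?thesis
      by (rule that[of "- growth_rate p d Q0"]) (use Q0 neg[OF Q0(1)] in \<open>auto simp: K_def\<close>)
  qed
qed

section \<open>Counting column arrays by type\<close>

text \<open>
  Together with the next lemma this is Stirling's formula up to a logarithmic error, which is all that the exponential estimates need.
\<close>

lemma ln_fact_lower: "xlnx (real k) - real k \<le> ln (fact k)"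
proof (induction k)
  case (Suc k)
  have "real k * ln (real k + 1) \<le> real k * ln (real k) + 1"
  proof (cases "k = 0")
    case False
    then have "ln ((real k + 1) / real k) \<le> (real k + 1) / real k - 1" by (intro ln_le_minus_one) auto
    also have "\<dots> = 1 / real k" using False by (simp add: field_simps)
    also have "ln ((real k + 1) / real k) = ln (real k + 1) - ln (real k)" using False by (intro ln_divide_pos) auto
    finally have "real k * (ln (real k + 1) - ln (real k)) \<le> real k * (1 / real k)" by (intro mult_left_mono) auto
    then show ?thesis using False by (simp add: right_diff_distrib)
  qed simp
  moreover have "ln (fact (Suc k) :: real) = ln (real k + 1) + ln (fact k)"
    by (simp add: ln_mult add.commute)
  ultimately show ?case using Suc.IH by (simp add: xlnx_def algebra_simps)
qed (simp add: xlnx_def)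

lemma ln_fact_upper: "ln (fact k) \<le> xlnx (real k) - real k + 1 + 2 * ln (real k + 1)"
proof (induction k)
  case (Suc k)
  have lower: "1 - 1 / x \<le> ln x" if "x > 0" for x :: real
    using ln_le_minus_one[of "1 / x"] that by (simp add: ln_div)
  have "1 \<le> real k * (ln (real k + 1) - ln (real k)) + 2 * (ln (real k + 2) - ln (real k + 1))"
  proof (cases "k = 0")
    case True
    have "1 / 2 \<le> ln (2::real)" using lower[of 2] by simp
    then show ?thesis using True by simp
  next
    case False
    have "ln ((real k + 1) / real k) = ln (real k + 1) - ln (real k)" using False by (intro ln_divide_pos) auto
    moreover have "1 - 1 / ((real k + 1) / real k) = 1 / (real k + 1)" using False by (simp add: field_simps)
    ultimately have "1 / (real k + 1) \<le> ln (real k + 1) - ln (real k)"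
      using lower[of "(real k + 1) / real k"] False by simp
    then have 1: "real k * (1 / (real k + 1)) \<le> real k * (ln (real k + 1) - ln (real k))"
      by (intro mult_left_mono) auto
    have "ln ((real k + 2) / (real k + 1)) = ln (real k + 2) - ln (real k + 1)" by (intro ln_divide_pos) auto
    moreover have "1 - 1 / ((real k + 2) / (real k + 1)) = 1 / (real k + 2)" by (simp add: field_simps)
    ultimately have 2: "1 / (real k + 2) \<le> ln (real k + 2) - ln (real k + 1)"
      using lower[of "(real k + 2) / (real k + 1)"] by simp
    have "real k * (1 / (real k + 1)) = 1 - 1 / (real k + 1)" by (simp add: field_simps)
    moreover have "1 / (real k + 1) \<le> 2 * (1 / (real k + 2))" by (simp add: field_simps)
    ultimately have "1 \<le> real k * (1 / (real k + 1)) + 2 * (1 / (real k + 2))" by linarith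
    then show ?thesis by (rule order_trans[OF _ add_mono[OF 1 mult_left_mono[OF 2]]]) simp
  qed
  moreover have "ln (fact (Suc k) :: real) = ln (real k + 1) + ln (fact k)"
    by (simp add: ln_mult add.commute)
  moreover have "xlnx (real (Suc k)) = (real k + 1) * ln (real k + 1)" by (simp add: xlnx_def add.commute)
  moreover have "ln (real (Suc k) + 1) = ln (real k + 2)" by simp
  ultimately show ?case using Suc.IH unfolding xlnx_def by (simp add: algebra_simps)
qed (simp add: xlnx_def)

lemma odd_fact_square_le: "odd_fact k * odd_fact k \<le> fact k"
proof (induction k rule: odd_fact.induct)
  case (3 k)
  have "odd_fact (Suc (Suc k)) * odd_fact (Suc (Suc k)) = Suc k * Suc k * (odd_fact k * odd_fact k)"
    by (simp only: odd_fact.simps mult_ac)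
  also have "\<dots> \<le> (Suc (Suc k) * Suc k) * fact k" using 3 by (intro mult_mono) auto
  finally show ?case by (simp add: algebra_simps)
qed auto

lemma fact_le_odd_fact_square: "even k \<Longrightarrow> fact k \<le> (k + 1) * (odd_fact k * odd_fact k)"
proof (induction k rule: odd_fact.induct)
  case (3 k)
  have "fact (Suc (Suc k)) = (Suc (Suc k) * Suc k) * fact k" by (simp add: algebra_simps)
  also have "\<dots> \<le> (Suc (Suc k) * Suc k) * ((k + 1) * (odd_fact k * odd_fact k))"
    using 3 by (intro mult_left_mono) auto
  also have "\<dots> = Suc (Suc k) * (odd_fact (Suc (Suc k)) * odd_fact (Suc (Suc k)))" by (simp add: algebra_simps)
  also have "\<dots> \<le> (Suc (Suc k) + 1) * (odd_fact (Suc (Suc k)) * odd_fact (Suc (Suc k)))"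
    by (intro mult_right_mono) auto
  finally show ?case .
qed auto

lemma odd_fact_pos: "even k \<Longrightarrow> odd_fact k > 0"
  by (induction k rule: odd_fact.induct) auto

text \<open>
  Squaring removes the asymmetry between \<open>s < t\<close> and \<open>s > t\<close>: the square of the number of
  compatible matchings is at most the product of all factorials of pair counts.
\<close>

lemma prod_pair_weight_square_le:
  fixes m :: "'a::linorder \<Rightarrow> 'a \<Rightarrow> nat"
  assumes "\<And>s t. s \<in> R \<Longrightarrow> t \<in> R \<Longrightarrow> m s t = m t s"
  shows "(\<Prod>(s,t)\<in>R \<times> R. pair_weight s t (m s t))\<^sup>2 \<le> (\<Prod>(s,t)\<in>R \<times> R. fact (m s t))"
proof -
  have "(\<Prod>(s,t)\<in>R \<times> R. pair_weight s t (m s t)) = (\<Prod>(s,t)\<in>R \<times> R. pair_weight t s (m t s))"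
    by (rule prod.reindex_bij_witness[where i = prod.swap and j = prod.swap]) auto
  then have "(\<Prod>(s,t)\<in>R \<times> R. pair_weight s t (m s t))\<^sup>2 =
      (\<Prod>(s,t)\<in>R \<times> R. pair_weight s t (m s t)) * (\<Prod>(s,t)\<in>R \<times> R. pair_weight t s (m t s))"
    by (simp only: power2_eq_square)
  also have "\<dots> = (\<Prod>z\<in>R \<times> R. pair_weight (fst z) (snd z) (m (fst z) (snd z)) * pair_weight (snd z) (fst z) (m (snd z) (fst z)))"
    by (simp only: prod.distrib case_prod_beta')
  also have "\<dots> \<le> (\<Prod>z\<in>R \<times> R. fact (m (fst z) (snd z)))"
  proof (intro prod_mono conjI)
    fix z assume "z \<in> R \<times> R"
    then have eq: "m (snd z) (fst z) = m (fst z) (snd z)" using assms by (simp add: mem_Times_iff)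
    consider "fst z < snd z" | "fst z = snd z" | "fst z > snd z" by fastforce
    then show "pair_weight (fst z) (snd z) (m (fst z) (snd z)) * pair_weight (snd z) (fst z) (m (snd z) (fst z)) \<le> fact (m (fst z) (snd z))"
      by cases (auto simp add: eq pair_weight_def odd_fact_square_le)
  qed simp
  finally show ?thesis by (simp only: case_prod_beta')
qed

definition type_count :: "'v set \<Rightarrow> ('v \<Rightarrow> 'a) \<Rightarrow> 'a \<Rightarrow> nat" where
  "type_count V c a = card {j\<in>V. c j = a}"

text \<open>
  The type of an array records how often it uses each column.
\<close>

definition arrays_of_type :: "'v set \<Rightarrow> 'a set \<Rightarrow> ('a \<Rightarrow> nat) \<Rightarrow> ('v \<Rightarrow> 'a) set" where
  "arrays_of_type V A T = {c \<in> PiE V (\<lambda>_. A). \<forall>a\<in>A. type_count V c a = T a}"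

lemma finite_arrays_of_type: "finite V \<Longrightarrow> finite A \<Longrightarrow> finite (arrays_of_type V A T)"
  unfolding arrays_of_type_def by (rule finite_subset[of _ "PiE V (\<lambda>_. A)"]) (auto intro: finite_PiE)

lemma type_count_insert:
  assumes "finite V" "v \<notin> V"
  shows "type_count (insert v V) c a = of_bool (c v = a) + type_count V c a"
proof -
  have "{j \<in> insert v V. c j = a} = (if c v = a then insert v {j \<in> V. c j = a} else {j \<in> V. c j = a})" by auto
  then show ?thesis using assms by (simp add: type_count_def)
qed

lemma sum_type_count:
  assumes "finite V" "finite A" "c \<in> PiE V (\<lambda>_. A)"
  shows "(\<Sum>a\<in>A. type_count V c a) = card V"
proof -
  have "(\<Sum>a\<in>A. \<Sum>j\<in>{j\<in>V. c j = a}. 1) = (\<Sum>j\<in>V. 1::nat)"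
    using assms by (intro sum.group) auto
  then show ?thesis by (simp add: type_count_def)
qed

lemma card_arrays_of_type:
  fixes V :: "'v set" and A :: "'a set"
  assumes "finite V" "finite A" "(\<Sum>a\<in>A. T a) = card V"
  shows "card (arrays_of_type V A T) * (\<Prod>a\<in>A. fact (T a)) = fact (card V)"
  using assms
proof (induction V arbitrary: T rule: finite_induct)
  case empty
  then have "T a = 0" if "a \<in> A" for a using that by simp
  then have "arrays_of_type ({} :: 'v set) A T = {\<lambda>_. undefined}" and "(\<Prod>a\<in>A. fact (T a) :: nat) = 1"
    by (auto simp: arrays_of_type_def type_count_def)
  then show ?case by (simp only:) simp
next
  case (insert v V)
  let ?T = "\<lambda>a. T(a := T a - 1)"
  let ?B = "{a\<in>A. T a > 0}"
  let ?f = "\<lambda>a c. c(v := a)"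
  have eq: "arrays_of_type (insert v V) A T = (\<Union>a\<in>?B. ?f a ` arrays_of_type V A (?T a))"
  proof (intro equalityI subsetI)
    fix c assume c: "c \<in> arrays_of_type (insert v V) A T"
    then have cA: "c v \<in> A" by (auto simp: arrays_of_type_def)
    have cT: "of_bool (c v = b) + type_count V c b = T b" if "b \<in> A" for b
      using c that unfolding type_count_insert[OF insert.hyps(1,2), symmetric] by (simp add: arrays_of_type_def)
    have tc: "type_count V (c(v := undefined)) b = type_count V c b" for b
      unfolding type_count_def using insert.hyps(2) by (intro arg_cong[where f = card]) auto
    have "c(v := undefined) \<in> PiE V (\<lambda>_. A)"
      using c insert.hyps(2) by (auto simp: arrays_of_type_def PiE_iff extensional_def)
    then have "c(v := undefined) \<in> arrays_of_type V A (?T (c v))"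
    proof -
      have "type_count V (c(v := undefined)) b = ?T (c v) b" if "b \<in> A" for b
        using cT[OF that] unfolding tc by (cases "b = c v") auto
      then show ?thesis using \<open>c(v := undefined) \<in> PiE V (\<lambda>_. A)\<close> by (simp add: arrays_of_type_def)
    qed
    moreover have "c = ?f (c v) (c(v := undefined))" by simp
    moreover have "c v \<in> ?B" using cT[OF cA] cA by auto
    ultimately show "c \<in> (\<Union>a\<in>?B. ?f a ` arrays_of_type V A (?T a))" by blast
  next
    fix c assume "c \<in> (\<Union>a\<in>?B. ?f a ` arrays_of_type V A (?T a))"
    then obtain a c' where a: "a \<in> A" "T a > 0" and c': "c' \<in> arrays_of_type V A (?T a)" and c: "c = c'(v := a)" by blast
    have tc: "type_count V c b = type_count V c' b" for b
      unfolding type_count_def c using insert.hyps(2) by (intro arg_cong[where f = card]) auto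
    have "c \<in> PiE (insert v V) (\<lambda>_. A)" using c' a unfolding c arrays_of_type_def by (auto simp: PiE_iff extensional_def)
    moreover have "type_count (insert v V) c b = T b" if "b \<in> A" for b
      using c' a that unfolding type_count_insert[OF insert.hyps(1,2)] tc by (auto simp: c arrays_of_type_def)
    ultimately show "c \<in> arrays_of_type (insert v V) A T" by (simp add: arrays_of_type_def)
  qed
  have inj: "inj_on (?f a) (arrays_of_type V A (?T a))" for a
  proof (rule inj_onI, rule ext)
    fix c c' j assume c: "c \<in> arrays_of_type V A (?T a)" "c' \<in> arrays_of_type V A (?T a)" and e: "c(v := a) = c'(v := a)"
    show "c j = c' j"
    proof (cases "j = v")
      case True
      then show ?thesis using c insert.hyps(2) by (auto simp: arrays_of_type_def PiE_iff extensional_def)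
    next
      case False
      then show ?thesis using fun_cong[OF e, of j] by simp
    qed
  qed
  have "card (arrays_of_type (insert v V) A T) = (\<Sum>a\<in>?B. card (?f a ` arrays_of_type V A (?T a)))"
    unfolding eq
  proof (rule card_UN_disjoint)
    show "\<forall>a\<in>?B. finite (?f a ` arrays_of_type V A (?T a))" using insert by (simp add: finite_arrays_of_type)
    show "\<forall>a\<in>?B. \<forall>b\<in>?B. a \<noteq> b \<longrightarrow> ?f a ` arrays_of_type V A (?T a) \<inter> ?f b ` arrays_of_type V A (?T b) = {}"
    proof (intro ballI impI)
      fix a b assume "a \<in> ?B" "b \<in> ?B" and "a \<noteq> b"
      then have "?f a c \<noteq> ?f b c'" for c c' by (metis fun_upd_same)
      then show "?f a ` arrays_of_type V A (?T a) \<inter> ?f b ` arrays_of_type V A (?T b) = {}" by blast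
    qed
  qed (use insert.prems in auto)
  then have "card (arrays_of_type (insert v V) A T) * (\<Prod>a\<in>A. fact (T a)) =
      (\<Sum>a\<in>?B. card (arrays_of_type V A (?T a)) * (\<Prod>b\<in>A. fact (T b)))"
    by (simp only: card_image[OF inj] sum_distrib_right)
  also have "\<dots> = (\<Sum>a\<in>?B. T a * fact (card V))"
  proof (rule sum.cong[OF refl])
    fix a assume a: "a \<in> ?B"
    have "(\<Sum>b\<in>A. T b) = T a + (\<Sum>b\<in>A-{a}. T b)" using a insert.prems by (intro sum.remove) auto
    moreover have "(\<Sum>b\<in>A. ?T a b) = (T a - 1) + (\<Sum>b\<in>A-{a}. T b)"
      using a insert.prems by (subst sum.remove[of _ a]) (auto intro!: sum.cong)
    ultimately have "(\<Sum>b\<in>A. ?T a b) = card V" using insert a by simp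
    then have IH: "card (arrays_of_type V A (?T a)) * (\<Prod>b\<in>A. fact (?T a b)) = fact (card V)"
      using insert.prems by (intro insert.IH) auto
    have "(\<Prod>b\<in>A. fact (T b) :: nat) = fact (T a) * (\<Prod>b\<in>A-{a}. fact (T b))"
      using a insert.prems by (intro prod.remove) auto
    also have "fact (T a) = T a * (fact (T a - 1) :: nat)" using a by (simp add: fact_reduce)
    also have "T a * fact (T a - 1) * (\<Prod>b\<in>A-{a}. fact (T b)) = T a * (\<Prod>b\<in>A. fact (?T a b))"
      using a insert.prems by (subst (2) prod.remove[of _ a]) (auto intro!: prod.cong)
    finally show "card (arrays_of_type V A (?T a)) * (\<Prod>b\<in>A. fact (T b)) = T a * fact (card V)"
      using IH by (simp add: mult_ac)
  qed
  also have "\<dots> = (\<Sum>a\<in>A. T a) * fact (card V)"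
    unfolding sum_distrib_right using insert.prems by (intro sum.mono_neutral_left) auto
  also have "\<dots> = fact (card (insert v V))" using insert by simp
  finally show ?case .
qed


text \<open>
  The pair counts of row \<open>i\<close>, expressed through the type of the array.
\<close>

definition pair_total :: "column set \<Rightarrow> (column \<Rightarrow> nat) \<Rightarrow> nat \<Rightarrow> int \<Rightarrow> int \<Rightarrow> nat" where
  "pair_total A T i s t = (\<Sum>a\<in>{a \<in> A. (fst a, snd a i) = (s, t)}. T a)"

definition matching_count :: "int \<Rightarrow> column set \<Rightarrow> (column \<Rightarrow> nat) \<Rightarrow> nat \<Rightarrow> nat" where
  "matching_count p A T i =
    (if \<forall>s\<in>residues p. \<forall>t\<in>residues p. pair_total A T i s t = pair_total A T i t s
     then \<Prod>(s,t)\<in>residues p \<times> residues p. pair_weight s t (pair_total A T i s t) else 0)"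

lemma pair_count_eq_pair_total:
  assumes "finite V" "finite A" "c \<in> PiE V (\<lambda>_. A)"
  shows "pair_count V (\<lambda>j. fst (c j)) (\<lambda>j. snd (c j) i) s t = pair_total A (type_count V c) i s t"
proof -
  let ?J = "{j\<in>V. fst (c j) = s \<and> snd (c j) i = t}"
  let ?A = "{a \<in> A. (fst a, snd a i) = (s, t)}"
  have "(\<Sum>a\<in>?A. \<Sum>j\<in>{j\<in>?J. c j = a}. 1) = (\<Sum>j\<in>?J. 1::nat)"
    using assms by (intro sum.group) auto
  moreover have "{j\<in>?J. c j = a} = {j\<in>V. c j = a}" if "a \<in> ?A" for a using that by auto
  ultimately show ?thesis by (simp add: pair_count_def pair_total_def type_count_def)
qed

lemma card_compatible_matchings_array:
  assumes "finite V" "A \<subseteq> all_columns p d" "c \<in> PiE V (\<lambda>_. A)" "i < d"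
  shows "card (compatible_matchings V (\<lambda>j. fst (c j)) (\<lambda>j. snd (c j) i)) = matching_count p A (type_count V c) i"
proof -
  have fin: "finite A" using assms(2) by (rule finite_subset) simp
  have "c j \<in> all_columns p d" if "j \<in> V" for j using assms(2,3) that by auto
  then have "fst (c j) \<in> residues p" "snd (c j) i \<in> residues p" if "j \<in> V" for j
    using that all_columnsD assms(4) by blast+
  then have "(\<lambda>j. fst (c j)) ` V \<subseteq> residues p" "(\<lambda>j. snd (c j) i) ` V \<subseteq> residues p" by blast+
  then show ?thesis
    using card_compatible_matchings[OF assms(1) finite_residues, of "\<lambda>j. fst (c j)" p "\<lambda>j. snd (c j) i"]
    unfolding pair_count_eq_pair_total[OF assms(1) fin assms(3)] matching_count_def by simp
qed

definition matching_tuples :: "nat \<Rightarrow> 'v set \<Rightarrow> (nat \<Rightarrow> 'v \<Rightarrow> 'v) set" where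
  "matching_tuples d V = PiE {..<d} (\<lambda>_. fpf_involutions V)"

definition neighbour_sum :: "int \<Rightarrow> nat \<Rightarrow> (nat \<Rightarrow> 'v \<Rightarrow> 'v) \<Rightarrow> ('v \<Rightarrow> int) \<Rightarrow> 'v \<Rightarrow> int" where
  "neighbour_sum p d M x j = (\<Sum>i<d. x (M i j)) mod p"

text \<open>
  The solutions modulo \<open>p\<close> of the linear system with right-hand side \<open>z\<close> whose matrix is the sum of the permutation matrices of \<open>M\<close>.
\<close>

definition solutions :: "int \<Rightarrow> nat \<Rightarrow> 'v set \<Rightarrow> (nat \<Rightarrow> 'v \<Rightarrow> 'v) \<Rightarrow> ('v \<Rightarrow> int) \<Rightarrow> ('v \<Rightarrow> int) set" where
  "solutions p d V M z = {x \<in> PiE V (\<lambda>_. residues p). \<forall>j\<in>V. neighbour_sum p d M x j = z j}"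

definition column_array :: "nat \<Rightarrow> 'v set \<Rightarrow> (nat \<Rightarrow> 'v \<Rightarrow> 'v) \<Rightarrow> ('v \<Rightarrow> int) \<Rightarrow> 'v \<Rightarrow> column" where
  "column_array d V M x = (\<lambda>j\<in>V. (x j, \<lambda>i\<in>{..<d}. x (M i j)))"

lemma finite_matching_tuples [simp]: "finite V \<Longrightarrow> finite (matching_tuples d V)"
  by (simp add: matching_tuples_def finite_PiE finite_fpf_involutions)

lemma card_matching_tuples: "finite V \<Longrightarrow> card (matching_tuples d V) = odd_fact (card V) ^ d"
  by (simp add: matching_tuples_def card_PiE card_fpf_involutions)

lemma finite_solutions [simp]: "finite V \<Longrightarrow> finite (solutions p d V M z)"
  unfolding solutions_def by (rule finite_subset[of _ "PiE V (\<lambda>_. residues p)"]) (auto intro: finite_PiE)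

lemma matching_tuples_in:
  assumes "M \<in> matching_tuples d V" "i < d" "j \<in> V" shows "M i j \<in> V"
  using assms fpf_involutionsD(2)[of "M i" V j] by (auto simp: matching_tuples_def)

lemma column_array_in:
  assumes M: "M \<in> matching_tuples d V" and x: "x \<in> solutions p d V M z"
  shows "column_array d V M x \<in> PiE V (\<lambda>j. columns_of_sum p d (z j))"
proof (rule PiE_I)
  fix j assume j: "j \<in> V"
  have xR: "x k \<in> residues p" if "k \<in> V" for k using x that by (auto simp: solutions_def)
  have "(\<lambda>i\<in>{..<d}. x (M i j)) \<in> PiE {..<d} (\<lambda>_. residues p)"
    using xR matching_tuples_in[OF M _ j] by (simp add: PiE_iff)
  moreover have "(\<Sum>i<d. x (M i j)) mod p = z j" using x j by (simp add: solutions_def neighbour_sum_def)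
  ultimately show "column_array d V M x j \<in> columns_of_sum p d (z j)"
    using xR[OF j] j by (simp add: column_array_def columns_of_sum_def all_columns_def)
qed (simp add: column_array_def)

abbreviation solution_pairs :: "int \<Rightarrow> nat \<Rightarrow> 'v set \<Rightarrow> ('v \<Rightarrow> int) \<Rightarrow>
    ((nat \<Rightarrow> 'v \<Rightarrow> 'v) \<Rightarrow> ('v \<Rightarrow> int) \<Rightarrow> bool) \<Rightarrow> ((nat \<Rightarrow> 'v \<Rightarrow> 'v) \<times> ('v \<Rightarrow> int)) set" where
  "solution_pairs p d V z P \<equiv>
    {(M, x). M \<in> matching_tuples d V \<and> x \<in> solutions p d V M z \<and> P M x}"

text \<open>
  A pair \<open>(M, x)\<close> is the same as the array of its columns together with the matchings \<open>M i\<close>, where each \<open>M i\<close> is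
  subject only to compatibility with row \<open>i\<close> of the array. Given the array, the \<open>d\<close> choices are therefore independent.
\<close>

lemma card_solutions_by_arrays:
  assumes V: "finite V" and CS: "CS = PiE V (\<lambda>j. columns_of_sum p d (z j))"
  shows "card (solution_pairs p d V z (\<lambda>M x. P (column_array d V M x))) =
    (\<Sum>c\<in>{c\<in>CS. P c}. \<Prod>i<d. card (compatible_matchings V (\<lambda>j. fst (c j)) (\<lambda>j. snd (c j) i)))"
proof -
  let ?S = "(solution_pairs p d V z (\<lambda>M x. P (column_array d V M x)))"
  let ?T = "SIGMA c:{c\<in>CS. P c}. PiE {..<d} (\<lambda>i. compatible_matchings V (\<lambda>j. fst (c j)) (\<lambda>j. snd (c j) i))"
  have col: "c j \<in> columns_of_sum p d (z j)" if "c \<in> CS" "j \<in> V" for c j using that CS by auto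
  have comp: "M i \<in> fpf_involutions V" "j \<in> V \<Longrightarrow> fst (c (M i j)) = snd (c j) i" "j \<in> V \<Longrightarrow> M i j \<in> V"
    if "M \<in> PiE {..<d} (\<lambda>i. compatible_matchings V (\<lambda>j. fst (c j)) (\<lambda>j. snd (c j) i))" "i < d" for c M i j
  proof -
    have "M i \<in> compatible_matchings V (\<lambda>j. fst (c j)) (\<lambda>j. snd (c j) i)" using that by (simp add: PiE_iff)
    then show "M i \<in> fpf_involutions V" "j \<in> V \<Longrightarrow> fst (c (M i j)) = snd (c j) i" "j \<in> V \<Longrightarrow> M i j \<in> V"
      using fpf_involutionsD(2)[of "M i" V j] by (simp_all add: compatible_matchings_def)
  qed
  have arr: "column_array d V M (\<lambda>j\<in>V. fst (c j)) = c"
    if c: "c \<in> CS" and M: "M \<in> PiE {..<d} (\<lambda>i. compatible_matchings V (\<lambda>j. fst (c j)) (\<lambda>j. snd (c j) i))" for c M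
  proof
    fix j
    show "column_array d V M (\<lambda>j\<in>V. fst (c j)) j = c j"
    proof (cases "j \<in> V")
      case True
      have "(\<lambda>i\<in>{..<d}. (\<lambda>j\<in>V. fst (c j)) (M i j)) = snd (c j)"
      proof
        fix i
        show "(\<lambda>i\<in>{..<d}. (\<lambda>j\<in>V. fst (c j)) (M i j)) i = snd (c j) i"
          using comp(2,3)[OF M _ True, of i] PiE_arb[OF columnsD(4)[OF col[OF c True]], of i] by simp
      qed
      then show ?thesis using True by (simp add: column_array_def)
    next
      case False
      then show ?thesis using c by (simp add: column_array_def CS PiE_arb[OF c[unfolded CS]])
    qed
  qed
  have "bij_betw (\<lambda>(M, x). (column_array d V M x, M)) ?S ?T"
  proof (rule bij_betw_byWitness[where f' = "\<lambda>(c, M). (M, \<lambda>j\<in>V. fst (c j))"])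
    show "\<forall>a\<in>?S. (\<lambda>(c, M). (M, \<lambda>j\<in>V. fst (c j))) ((\<lambda>(M, x). (column_array d V M x, M)) a) = a"
    proof
      fix a assume "a \<in> ?S"
      then obtain M x where a: "a = (M, x)" "x \<in> solutions p d V M z" by blast
      have "(\<lambda>j\<in>V. fst (column_array d V M x j)) = x"
      proof
        fix j
        have "x \<in> PiE V (\<lambda>_. residues p)" using a(2) by (simp add: solutions_def)
        then show "(\<lambda>j\<in>V. fst (column_array d V M x j)) j = x j"
          using PiE_arb[of x V "\<lambda>_. residues p" j] by (simp add: column_array_def)
      qed
      then show "(\<lambda>(c, M). (M, \<lambda>j\<in>V. fst (c j))) ((\<lambda>(M, x). (column_array d V M x, M)) a) = a" by (simp add: a)
    qed
    show "\<forall>a'\<in>?T. (\<lambda>(M, x). (column_array d V M x, M)) ((\<lambda>(c, M). (M, \<lambda>j\<in>V. fst (c j))) a') = a'"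
      using arr by (simp add: split_def)
    show "(\<lambda>(M, x). (column_array d V M x, M)) ` ?S \<subseteq> ?T"
    proof
      fix b assume "b \<in> (\<lambda>(M, x). (column_array d V M x, M)) ` ?S"
      then obtain a where a: "a \<in> ?S" "b = (\<lambda>(M, x). (column_array d V M x, M)) a" by (rule imageE)
      obtain M x where Mx: "a = (M, x)" by (cases a)
      have M: "M \<in> matching_tuples d V" and x: "x \<in> solutions p d V M z"
        and P: "P (column_array d V M x)" and b: "b = (column_array d V M x, M)"
        using a unfolding Mx by simp_all
      have "M \<in> PiE {..<d} (\<lambda>i. compatible_matchings V (\<lambda>j. fst (column_array d V M x j)) (\<lambda>j. snd (column_array d V M x j) i))"
      proof (rule PiE_I)
        fix i assume i: "i \<in> {..<d}"
        then have "M i \<in> fpf_involutions V" using M by (simp add: matching_tuples_def PiE_iff)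
        moreover have "fst (column_array d V M x (M i j)) = snd (column_array d V M x j) i" if "j \<in> V" for j
          using i that matching_tuples_in[OF M, of i j] by (simp add: column_array_def)
        ultimately show "M i \<in> compatible_matchings V (\<lambda>j. fst (column_array d V M x j)) (\<lambda>j. snd (column_array d V M x j) i)"
          by (simp add: compatible_matchings_def)
      next
        fix i assume "i \<notin> {..<d}"
        then show "M i = undefined" using M by (auto simp: matching_tuples_def PiE_iff extensional_def)
      qed
      then show "b \<in> ?T" using column_array_in[OF M x] P by (simp add: b CS)
    qed
    show "(\<lambda>(c, M). (M, \<lambda>j\<in>V. fst (c j))) ` ?T \<subseteq> ?S"
    proof
      fix b assume "b \<in> (\<lambda>(c, M). (M, \<lambda>j\<in>V. fst (c j))) ` ?T"
      then obtain a where a: "a \<in> ?T" "b = (\<lambda>(c, M). (M, \<lambda>j\<in>V. fst (c j))) a" by (rule imageE)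
      obtain c M where cM: "a = (c, M)" by (cases a)
      have c: "c \<in> CS" "P c"
        and M: "M \<in> PiE {..<d} (\<lambda>i. compatible_matchings V (\<lambda>j. fst (c j)) (\<lambda>j. snd (c j) i))"
        and b: "b = (M, \<lambda>j\<in>V. fst (c j))" using a unfolding cM by simp_all
      have Mt: "M \<in> matching_tuples d V"
        unfolding matching_tuples_def
      proof (rule PiE_I)
        show "M i \<in> fpf_involutions V" if "i \<in> {..<d}" for i using comp(1)[OF M] that by simp
        show "M i = undefined" if "i \<notin> {..<d}" for i by (rule PiE_arb[OF M that])
      qed
      have "(\<lambda>j\<in>V. fst (c j)) \<in> solutions p d V M z"
        unfolding solutions_def
      proof (intro CollectI conjI ballI)
        show "(\<lambda>j\<in>V. fst (c j)) \<in> PiE V (\<lambda>_. residues p)" using columnsD(1)[OF col[OF c(1)]] by (simp add: PiE_iff)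
        fix j assume j: "j \<in> V"
        have "(\<Sum>i<d. (\<lambda>j\<in>V. fst (c j)) (M i j)) = (\<Sum>i<d. snd (c j) i)"
          using comp(2,3)[OF M _ j] by (intro sum.cong) auto
        then show "neighbour_sum p d M (\<lambda>j\<in>V. fst (c j)) j = z j"
          using columnsD(3)[OF col[OF c(1) j]] by (simp add: neighbour_sum_def)
      qed
      then show "b \<in> ?S" using Mt c(2) arr[OF c(1) M] by (simp add: b)
    qed
  qed
  then have "card ?S = card ?T" by (rule bij_betw_same_card)
  also have "\<dots> = (\<Sum>c\<in>{c\<in>CS. P c}. card (PiE {..<d} (\<lambda>i. compatible_matchings V (\<lambda>j. fst (c j)) (\<lambda>j. snd (c j) i))))"
    using V by (intro card_SigmaI) (auto simp: CS finite_PiE finite_compatible_matchings)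
  finally show ?thesis by (simp add: card_PiE)
qed

section \<open>Kernel vectors of atypical type\<close>

definition near_uniform :: "int \<Rightarrow> nat \<Rightarrow> real \<Rightarrow> 'v set \<Rightarrow> ('v \<Rightarrow> column) \<Rightarrow> bool" where
  "near_uniform p d \<epsilon> V c \<longleftrightarrow> (\<forall>a\<in>columns_of_sum p d 0.
     \<bar>real (type_count V c a) - real (card V) / of_int p ^ d\<bar> \<le> \<epsilon> * (real (card V) / of_int p ^ d))"

lemma xlnx_scale: "n > 0 \<Longrightarrow> q \<ge> 0 \<Longrightarrow> xlnx (n * q) = n * xlnx q + n * q * ln n"
  by (cases "q = 0") (auto simp: xlnx_def ln_mult_pos algebra_simps)

lemma pair_total_le:
  assumes "finite A" shows "pair_total A T i s t \<le> (\<Sum>a\<in>A. T a)"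
  unfolding pair_total_def using assms by (intro sum_mono2) auto

lemma sum_pair_total:
  assumes "i < d"
  shows "(\<Sum>s\<in>residues p. \<Sum>t\<in>residues p. pair_total (columns_of_sum p d 0) T i s t) = (\<Sum>a\<in>columns_of_sum p d 0. T a)"
proof -
  have "(\<Sum>z\<in>residues p \<times> residues p. \<Sum>a\<in>{a \<in> columns_of_sum p d 0. (fst a, snd a i) = z}. T a) = (\<Sum>a\<in>columns_of_sum p d 0. T a)"
    using assms by (intro sum.group finite_cartesian_product image_subsetI)
      (simp_all add: columnsD(1)[where g = 0] columnsD(2)[where g = 0])
  then show ?thesis by (simp add: pair_total_def sum.cartesian_product case_prod_beta' prod_eq_iff)
qed

text \<open>
  One factor of the exponential estimate: \<open>N\<^sub>i / (n - 1)!! \<le> exp (- n/2 H(X, Y\<^sub>i))\<close> up to a polynomial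
  factor, where \<open>N\<^sub>i\<close> is the number of matchings compatible with row \<open>i\<close>. It follows from the
  bound on the square of \<open>N\<^sub>i\<close> and \<open>(n - 1)!!\<^sup>2 \<ge> n! / (n + 1)\<close>.
\<close>

lemma log_count_of_type:
  fixes V :: "'v set"
  assumes d: "i < d" and V: "finite V" "card V > 0" "even (card V)"
    and T: "(\<Sum>a\<in>columns_of_sum p d 0. T a) = card V"
    and pos: "matching_count p (columns_of_sum p d 0) T i > 0"
    and Q: "\<And>a. a \<in> columns_of_sum p d 0 \<Longrightarrow> Q a = real (T a) / real (card V)"
  shows "ln (matching_count p (columns_of_sum p d 0) T i) \<le> ln (odd_fact (card V)) +
     (real (card V) * (\<Sum>s\<in>residues p. \<Sum>t\<in>residues p. xlnx (pair_mass p d Q i s t)) +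
      real (card (residues p \<times> residues p)) * (1 + 2 * ln (real (card V) + 1)) + ln (real (card V) + 1)) / 2"
proof -
  define n where "n = card V"
  define m where "m = (\<lambda>z. pair_total (columns_of_sum p d 0) T i (fst z) (snd z))"
  define w where "w = matching_count p (columns_of_sum p d 0) T i"
  define L where "L = ln (real n + 1)"
  have n: "n > 0" "even n" using V by (auto simp: n_def)
  have sym: "\<forall>s\<in>residues p. \<forall>t\<in>residues p. pair_total (columns_of_sum p d 0) T i s t = pair_total (columns_of_sum p d 0) T i t s"
  proof (rule ccontr)
    assume "\<not> ?thesis"
    then have "matching_count p (columns_of_sum p d 0) T i = 0" unfolding matching_count_def by (rule if_not_P)
    then show False using pos by simp
  qed
  have weq: "w = (\<Prod>(s,t)\<in>residues p \<times> residues p. pair_weight s t (pair_total (columns_of_sum p d 0) T i s t))"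
    unfolding w_def matching_count_def by (rule if_P[OF sym])
  have "w\<^sup>2 \<le> (\<Prod>z\<in>residues p \<times> residues p. fact (m z))"
    using prod_pair_weight_square_le[of "residues p" "pair_total (columns_of_sum p d 0) T i"] sym
    unfolding weq m_def by (simp only: case_prod_beta')
  then have "real (w\<^sup>2) \<le> real (\<Prod>z\<in>residues p \<times> residues p. fact (m z))" by (simp only: of_nat_le_iff)
  also have "\<dots> = (\<Prod>z\<in>residues p \<times> residues p. fact (m z))" by simp
  finally have "real (w\<^sup>2) \<le> (\<Prod>z\<in>residues p \<times> residues p. fact (m z))" .
  then have "ln (real (w\<^sup>2)) \<le> ln (\<Prod>z\<in>residues p \<times> residues p. fact (m z))"
    using pos by (intro ln_mono) (auto simp: w_def)
  moreover have "ln (real (w\<^sup>2)) = 2 * ln (real w)" using pos by (simp add: w_def ln_realpow)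
  moreover have "ln (\<Prod>z\<in>residues p \<times> residues p. fact (m z) :: real) = (\<Sum>z\<in>residues p \<times> residues p. ln (fact (m z)))"
    by (rule ln_prod) auto
  moreover have "(\<Sum>z\<in>residues p \<times> residues p. ln (fact (m z))) \<le>
      (\<Sum>z\<in>residues p \<times> residues p. xlnx (real (m z)) - real (m z) + (1 + 2 * L))"
  proof (rule sum_mono)
    fix z
    have "m z \<le> n" unfolding m_def n_def T[symmetric] by (rule pair_total_le) simp
    then have "ln (real (m z) + 1) \<le> L" unfolding L_def by (intro ln_mono) auto
    then show "ln (fact (m z)) \<le> xlnx (real (m z)) - real (m z) + (1 + 2 * L)"
      using ln_fact_upper[of "m z"] by linarith
  qed
  moreover have "(\<Sum>z\<in>residues p \<times> residues p. xlnx (real (m z)) - real (m z) + (1 + 2 * L)) =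
      (\<Sum>z\<in>residues p \<times> residues p. xlnx (real (m z))) - (\<Sum>z\<in>residues p \<times> residues p. real (m z))
       + real (card (residues p \<times> residues p)) * (1 + 2 * L)"
    by (simp only: sum.distrib sum_subtractf sum_constant of_nat_id distrib_left)
  moreover have "(\<Sum>z\<in>residues p \<times> residues p. m z) = n"
    using sum_pair_total[OF d, of p T] T by (simp add: n_def m_def sum.cartesian_product case_prod_beta')
  then have summ: "(\<Sum>z\<in>residues p \<times> residues p. real (m z)) = real n"
    by (metis of_nat_sum)
  moreover have "(\<Sum>z\<in>residues p \<times> residues p. xlnx (real (m z))) =
     real n * (\<Sum>s\<in>residues p. \<Sum>t\<in>residues p. xlnx (pair_mass p d Q i s t)) + real n * ln (real n)"
  proof -
    have pm: "pair_mass p d Q i (fst z) (snd z) = real (m z) / real n" for z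
      unfolding pair_mass_def m_def pair_total_def n_def by (simp add: Q sum_divide_distrib)
    have "xlnx (real (m z)) = real n * xlnx (pair_mass p d Q i (fst z) (snd z)) + real (m z) * ln (real n)" for z
      using xlnx_scale[of "real n" "real (m z) / real n"] n by (simp add: pm)
    then have "(\<Sum>z\<in>residues p \<times> residues p. xlnx (real (m z))) =
        real n * (\<Sum>z\<in>residues p \<times> residues p. xlnx (pair_mass p d Q i (fst z) (snd z))) + real n * ln (real n)"
      by (simp add: sum.distrib sum_distrib_left[symmetric] sum_distrib_right[symmetric] summ)
    then show ?thesis by (simp add: sum.cartesian_product case_prod_beta')
  qed
  ultimately have up: "2 * ln (real w) \<le> real n * (\<Sum>s\<in>residues p. \<Sum>t\<in>residues p. xlnx (pair_mass p d Q i s t))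
      + real n * ln (real n) - real n + real (card (residues p \<times> residues p)) * (1 + 2 * L)"
    by linarith
  have op: "real (odd_fact n) > 0" using odd_fact_pos[OF n(2)] by simp
  have "(fact n :: real) \<le> (real n + 1) * (real (odd_fact n) * real (odd_fact n))"
    using fact_le_odd_fact_square[OF n(2)] by (metis of_nat_1 of_nat_add of_nat_fact of_nat_le_iff of_nat_mult)
  then have "ln (fact n :: real) \<le> ln ((real n + 1) * (real (odd_fact n) * real (odd_fact n)))"
    by (intro ln_mono) auto
  also have "\<dots> = L + 2 * ln (real (odd_fact n))" using op by (simp add: ln_mult_pos L_def)
  finally have "xlnx (real n) - real n \<le> L + 2 * ln (real (odd_fact n))" using ln_fact_lower[of n] by linarith
  then have "real n * ln (real n) - real n \<le> L + 2 * ln (real (odd_fact n))" by (simp add: xlnx_def)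
  then show ?thesis using up unfolding w_def n_def L_def by argo
qed

lemma log_card_arrays_of_type:
  fixes V :: "'v set"
  assumes V: "finite V" "card V > 0"
    and T: "(\<Sum>a\<in>columns_of_sum p d 0. T a) = card V"
    and Q: "\<And>a. a \<in> columns_of_sum p d 0 \<Longrightarrow> Q a = real (T a) / real (card V)"
  shows "card (arrays_of_type V (columns_of_sum p d 0) T) > 0"
    and "ln (card (arrays_of_type V (columns_of_sum p d 0) T)) \<le>
      - real (card V) * (\<Sum>a\<in>columns_of_sum p d 0. xlnx (Q a)) + 1 + 2 * ln (real (card V) + 1)"
proof -
  define n where "n = card V"
  define N where "N = card (arrays_of_type V (columns_of_sum p d 0) T)"
  let ?C = "columns_of_sum p d 0"
  have n: "n > 0" using V by (simp add: n_def)
  have eq: "N * (\<Prod>a\<in>?C. fact (T a)) = fact n"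
    unfolding N_def n_def by (rule card_arrays_of_type[OF V(1) finite_columns T])
  show N0: "N > 0"
  proof (rule ccontr)
    assume "\<not> N > 0"
    then show False using eq by simp
  qed
  have "real N * (\<Prod>a\<in>?C. fact (T a)) = fact n"
    using arg_cong[OF eq, of real] by (simp add: of_nat_prod)
  moreover have Pp: "(\<Prod>a\<in>?C. fact (T a) :: real) > 0" by (intro prod_pos) simp
  ultimately have "ln (fact n :: real) = ln (real N) + ln (\<Prod>a\<in>?C. fact (T a))"
    using N0 by (metis ln_mult_pos of_nat_0_less_iff)
  also have "ln (\<Prod>a\<in>?C. fact (T a) :: real) = (\<Sum>a\<in>?C. ln (fact (T a)))" by (rule ln_prod) auto
  finally have "ln (real N) = ln (fact n) - (\<Sum>a\<in>?C. ln (fact (T a)))" by simp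
  moreover have "(\<Sum>a\<in>?C. xlnx (real (T a)) - real (T a)) \<le> (\<Sum>a\<in>?C. ln (fact (T a)))"
    by (intro sum_mono ln_fact_lower)
  moreover have "(\<Sum>a\<in>?C. xlnx (real (T a)) - real (T a)) = (\<Sum>a\<in>?C. xlnx (real (T a))) - real n"
  proof -
    have "(\<Sum>a\<in>?C. real (T a)) = real n" using T by (metis n_def of_nat_sum)
    then show ?thesis by (simp add: sum_subtractf)
  qed
  moreover have "(\<Sum>a\<in>?C. xlnx (real (T a))) = real n * (\<Sum>a\<in>?C. xlnx (Q a)) + real n * ln (real n)"
  proof -
    have "xlnx (real (T a)) = real n * xlnx (Q a) + real (T a) * ln (real n)" if "a \<in> ?C" for a
      using xlnx_scale[of "real n" "Q a"] n Q[OF that] by (simp add: n_def)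
    then have "(\<Sum>a\<in>?C. xlnx (real (T a))) = real n * (\<Sum>a\<in>?C. xlnx (Q a)) + (\<Sum>a\<in>?C. real (T a)) * ln (real n)"
      by (simp add: sum.distrib sum_distrib_left sum_distrib_right)
    also have "(\<Sum>a\<in>?C. real (T a)) = real n" using T by (metis n_def of_nat_sum)
    finally show ?thesis .
  qed
  moreover have "ln (fact n) \<le> real n * ln (real n) - real n + 1 + 2 * ln (real n + 1)"
    using ln_fact_upper[of n] by (simp add: xlnx_def)
  ultimately have "ln (real N) \<le> - (real n * (\<Sum>a\<in>?C. xlnx (Q a))) + 1 + 2 * ln (real n + 1)" by linarith
  then show "ln (real N) \<le> - real n * (\<Sum>a\<in>?C. xlnx (Q a)) + 1 + 2 * ln (real n + 1)" by simp
qed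


lemma matching_count_cong:
  assumes "\<And>a. a \<in> A \<Longrightarrow> T a = T' a"
  shows "matching_count p A T i = matching_count p A T' i"
proof -
  have "pair_total A T i s t = pair_total A T' i s t" for s t
    unfolding pair_total_def using assms by (intro sum.cong) auto
  then show ?thesis by (simp only: matching_count_def)
qed

text \<open>
  There are only polynomially many types, and each type away from the two extremal laws contributes at most
  \<open>exp (n \<Phi>(Q)) \<le> exp (- \<eta> n)\<close> up to a polynomial factor, relative to the number of all tuples of matchings.
\<close>

theorem atypical_solutions_rare:
  assumes d: "d \<ge> 3" and p: "prime p" "\<not> p dvd int d" and eps: "\<epsilon>0 > 0" "\<epsilon> > 0"
  obtains \<eta> K1 K2 where "\<eta> > 0"
    "\<And>V :: 'v set. finite V \<Longrightarrow> even (card V) \<Longrightarrow> card V > 0 \<Longrightarrow>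
      real (card (solution_pairs p d V (\<lambda>_. 0)
          (\<lambda>M x. \<not> near_uniform p d \<epsilon> V (column_array d V M x) \<and> real (card {j\<in>V. fst (column_array d V M x j) = 0}) \<le> (1 - \<epsilon>0) * real (card V))))
      \<le> real (odd_fact (card V)) ^ d * exp (- \<eta> * real (card V) + K1 + K2 * ln (real (card V) + 1))"
proof -
  let ?C = "columns_of_sum p d 0"
  have p0: "p > 0" using p(1) by (simp add: prime_gt_0_int)
  have "\<epsilon> / of_int p ^ d > 0" using eps p0 by simp
  from growth_rate_uniformly_negative[OF d p eps(1) this]
  obtain \<eta> where \<eta>: "\<eta> > 0"
    "\<And>Q. Q \<in> symmetric_laws p d \<Longrightarrow> (\<And>a. a \<notin> ?C \<Longrightarrow> Q a = 0) \<Longrightarrow>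
      entry_mass p d Q 0 \<le> 1 - \<epsilon>0 \<Longrightarrow> (\<exists>a\<in>?C. \<bar>Q a - 1 / of_int p ^ d\<bar> \<ge> \<epsilon> / of_int p ^ d) \<Longrightarrow>
      growth_rate p d Q \<le> - \<eta>" by blast
  define k where "k = real (card (residues p \<times> residues p))"
  define K1 where "K1 = 1 + real d * k / 2"
  define K2 where "K2 = 2 + real d * (2 * k + 1) / 2"
  show ?thesis
  proof (rule that[of \<eta> K1 "K2 + real (card ?C)"])
    fix V :: "'v set" assume V: "finite V" "even (card V)" "card V > 0"
    define n where "n = card V"
    define L where "L = ln (real n + 1)"
    have n: "n > 0" "even n" using V by (auto simp: n_def)
    have op: "real (odd_fact n) > 0" using odd_fact_pos[OF n(2)] by simp
    define P where "P = (\<lambda>c. \<not> near_uniform p d \<epsilon> V c \<and> real (card {j\<in>V. fst (c j) = 0}) \<le> (1 - \<epsilon>0) * real (card V))"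
    define S where "S = {c \<in> PiE V (\<lambda>_. ?C). P c}"
    define w where "w = (\<lambda>c. \<Prod>i<d. matching_count p ?C (type_count V c) i)"
    define bd where "bd = real (odd_fact n) ^ d * exp (- \<eta> * real n + K1 + K2 * L)"
    have "finite (PiE V (\<lambda>_. ?C))" using V(1) by (intro finite_PiE) auto
    then have finS: "finite S" by (rule finite_subset[rotated]) (auto simp: S_def)
    have sub: "?C \<subseteq> all_columns p d" by (auto simp: columns_of_sum_def)
    have per_type: "real (card (arrays_of_type V ?C (type_count V c)) * w c) \<le> bd" if c: "c \<in> S" for c
    proof (cases "w c = 0")
      case True
      then show ?thesis using op by (simp add: bd_def)
    next
      case False
      define T where "T = type_count V c"
      define Q where "Q = (\<lambda>a. if a \<in> ?C then real (T a) / real n else 0)"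
      have cC: "c \<in> PiE V (\<lambda>_. ?C)" using c by (simp add: S_def)
      have sumT: "(\<Sum>a\<in>?C. T a) = card V" unfolding T_def by (rule sum_type_count[OF V(1) finite_columns cC])
      have QC: "Q a = real (T a) / real (card V)" if "a \<in> ?C" for a using that by (simp add: Q_def n_def)
      have mpos: "matching_count p ?C T i > 0" if "i < d" for i using False that by (auto simp: w_def T_def)
      have sym: "pair_total ?C T i s t = pair_total ?C T i t s" if "i < d" "s \<in> residues p" "t \<in> residues p" for i s t
      proof (rule ccontr)
        assume "pair_total ?C T i s t \<noteq> pair_total ?C T i t s"
        then have "matching_count p ?C T i = 0" unfolding matching_count_def using that by (intro if_not_P) blast
        then show False using mpos[OF that(1)] by simp
      qed
      have pm: "pair_mass p d Q i s t = real (pair_total ?C T i s t) / real n" for i s t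
        unfolding pair_mass_def pair_total_def by (simp add: Q_def sum_divide_distrib)
      have "Q \<in> symmetric_laws p d"
      proof -
        have "(\<Sum>a\<in>?C. Q a) = real (\<Sum>a\<in>?C. T a) / real n" by (simp add: Q_def sum_divide_distrib)
        then have "(\<Sum>a\<in>?C. Q a) = 1" using sumT n by (simp add: n_def)
        then show ?thesis unfolding symmetric_laws_def using sym by (auto simp: pm) (simp add: Q_def)
      qed
      moreover have "entry_mass p d Q 0 \<le> 1 - \<epsilon>0"
      proof -
        have "(\<Sum>a\<in>{a \<in> ?C. fst a = 0}. \<Sum>j\<in>{j \<in> {j\<in>V. fst (c j) = 0}. c j = a}. 1) = (\<Sum>j\<in>{j\<in>V. fst (c j) = 0}. 1::nat)"
          using V(1) cC by (intro sum.group) auto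
        moreover have "{j \<in> {j\<in>V. fst (c j) = 0}. c j = a} = {j\<in>V. c j = a}" if "a \<in> {a \<in> ?C. fst a = 0}" for a
          using that by auto
        ultimately have "(\<Sum>a\<in>{a \<in> ?C. fst a = 0}. T a) = card {j\<in>V. fst (c j) = 0}"
          by (simp add: T_def type_count_def)
        then have "entry_mass p d Q 0 = real (card {j\<in>V. fst (c j) = 0}) / real n"
          unfolding entry_mass_def by (simp add: Q_def sum_divide_distrib[symmetric] flip: of_nat_sum)
        moreover have "real (card {j\<in>V. fst (c j) = 0}) \<le> (1 - \<epsilon>0) * real n" using c by (simp add: S_def P_def n_def)
        ultimately show ?thesis using n by (simp add: pos_divide_le_eq)
      qed
      moreover have "\<exists>a\<in>?C. \<bar>Q a - 1 / of_int p ^ d\<bar> \<ge> \<epsilon> / of_int p ^ d"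
      proof -
        have "\<not> near_uniform p d \<epsilon> V c" using c by (simp add: S_def P_def)
        then obtain a where a: "a \<in> ?C"
          "\<epsilon> * (real n / of_int p ^ d) < \<bar>real (T a) - real n / of_int p ^ d\<bar>"
          by (auto simp: near_uniform_def T_def n_def not_le)
        have "real (T a) - real n / of_int p ^ d = real n * (Q a - 1 / of_int p ^ d)"
          using a n by (simp add: Q_def right_diff_distrib)
        then have "\<bar>real (T a) - real n / of_int p ^ d\<bar> = real n * \<bar>Q a - 1 / of_int p ^ d\<bar>"
          by (simp add: abs_mult)
        then have "real n * (\<epsilon> / of_int p ^ d) < real n * \<bar>Q a - 1 / of_int p ^ d\<bar>" using a(2) by (simp add: mult_ac)
        then have "\<epsilon> / of_int p ^ d < \<bar>Q a - 1 / of_int p ^ d\<bar>" using n by (simp only: mult_less_cancel_left_pos of_nat_0_less_iff)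
        then show ?thesis using a(1) by (intro bexI[of _ a]) auto
      qed
      ultimately have rate: "growth_rate p d Q \<le> - \<eta>" by (intro \<eta>(2)) (auto simp: Q_def)
      define N where "N = card (arrays_of_type V ?C T)"
      have N: "N > 0" "ln (real N) \<le> - real n * (\<Sum>a\<in>?C. xlnx (Q a)) + 1 + 2 * L"
        using log_card_arrays_of_type[OF V(1,3) sumT QC] by (auto simp: N_def n_def L_def)
      have wpos: "real (w c) > 0" using False by simp
      have "ln (real (w c)) = (\<Sum>i<d. ln (real (matching_count p ?C T i)))"
        unfolding w_def T_def[symmetric] of_nat_prod by (rule ln_prod) (use mpos in \<open>auto simp: less_imp_neq\<close>)
      also have "\<dots> \<le> (\<Sum>i<d. ln (real (odd_fact n)) + (real n * (\<Sum>s\<in>residues p. \<Sum>t\<in>residues p. xlnx (pair_mass p d Q i s t))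
           + k * (1 + 2 * L) + L) / 2)"
        unfolding k_def n_def L_def
        by (intro sum_mono log_count_of_type[OF _ V(1,3,2) sumT _ QC] mpos) auto
      also have "\<dots> = real d * ln (real (odd_fact n)) + real n * ((\<Sum>i<d. \<Sum>s\<in>residues p. \<Sum>t\<in>residues p. xlnx (pair_mass p d Q i s t)) / 2)
           + real d * (k * (1 + 2 * L) + L) / 2"
        by (simp add: sum.distrib sum_divide_distrib[symmetric] sum_distrib_left[symmetric] add_divide_distrib distrib_left)
      finally have "ln (real N) + ln (real (w c)) \<le> real d * ln (real (odd_fact n)) + real n * growth_rate p d Q
          + (1 + 2 * L + real d * (k * (1 + 2 * L) + L) / 2)"
        using N(2) unfolding growth_rate_def right_diff_distrib by linarith
      also have "\<dots> \<le> real d * ln (real (odd_fact n)) + (- \<eta> * real n + K1 + K2 * L)"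
      proof -
        have "real n * growth_rate p d Q \<le> real n * (- \<eta>)" by (rule mult_left_mono[OF rate]) simp
        moreover have "1 + 2 * L + real d * (k * (1 + 2 * L) + L) / 2 = K1 + K2 * L"
          by (simp add: K1_def K2_def field_simps)
        ultimately show ?thesis by (simp add: mult.commute)
      qed
      finally have "ln (real N * real (w c)) \<le> real d * ln (real (odd_fact n)) + (- \<eta> * real n + K1 + K2 * L)"
        using N(1) wpos by (subst ln_mult_pos) auto
      then have "real N * real (w c) \<le> exp (real d * ln (real (odd_fact n)) + (- \<eta> * real n + K1 + K2 * L))"
        using N(1) wpos by (metis exp_le_cancel_iff exp_ln mult_pos_pos of_nat_0_less_iff)
      also have "\<dots> = bd" using op by (simp add: exp_add bd_def exp_of_nat_mult)
      finally show ?thesis by (simp add: N_def T_def)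
    qed
    let ?g = "\<lambda>c. restrict (type_count V c) ?C"
    let ?G = "PiE ?C (\<lambda>_. {..n})"
    have finG: "finite ?G" by (auto intro!: finite_PiE)
    have gG: "?g ` S \<subseteq> ?G"
    proof (rule image_subsetI)
      fix c :: "'v \<Rightarrow> column"
      have "type_count V c a \<le> n" for a unfolding type_count_def n_def using V(1) by (intro card_mono) auto
      then show "?g c \<in> ?G" by (simp add: restrict_PiE_iff)
    qed
    have class_bound: "(\<Sum>c\<in>{c\<in>S. ?g c = T}. real (w c)) \<le> bd" for T
    proof (cases "{c\<in>S. ?g c = T} = {}")
      case True
      have "bd \<ge> 0" unfolding bd_def by simp
      then show ?thesis unfolding True by simp
    next
      case False
      then obtain c0 where c0: "c0 \<in> S" "?g c0 = T" by blast
      have same: "type_count V c a = type_count V c0 a" if "c \<in> {c\<in>S. ?g c = T}" "a \<in> ?C" for c a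
      proof -
        have "?g c = ?g c0" using that(1) c0(2) by simp
        from fun_cong[OF this, of a] show ?thesis using that(2) by simp
      qed
      have "w c = w c0" if "c \<in> {c\<in>S. ?g c = T}" for c
        unfolding w_def by (intro prod.cong refl matching_count_cong same that)
      then have "(\<Sum>c\<in>{c\<in>S. ?g c = T}. real (w c)) = real (card {c\<in>S. ?g c = T}) * real (w c0)" by simp
      also have "\<dots> \<le> real (card (arrays_of_type V ?C (type_count V c0))) * real (w c0)"
      proof (intro mult_right_mono of_nat_mono card_mono)
        show "finite (arrays_of_type V ?C (type_count V c0))" by (rule finite_arrays_of_type[OF V(1) finite_columns])
        show "{c\<in>S. ?g c = T} \<subseteq> arrays_of_type V ?C (type_count V c0)"
          using same by (auto simp: arrays_of_type_def S_def)
      qed simp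
      also have "\<dots> \<le> bd" using per_type[OF c0(1)] by simp
      finally show ?thesis .
    qed
    have "card (solution_pairs p d V (\<lambda>_. 0) (\<lambda>M x. P (column_array d V M x))) =
        (\<Sum>c\<in>S. \<Prod>i<d. card (compatible_matchings V (\<lambda>j. fst (c j)) (\<lambda>j. snd (c j) i)))"
      unfolding S_def by (rule card_solutions_by_arrays[OF V(1)]) simp
    also have "\<dots> = (\<Sum>c\<in>S. w c)"
      unfolding w_def using card_compatible_matchings_array[OF V(1) sub]
      by (intro sum.cong prod.cong refl) (auto simp: S_def)
    finally have "real (card (solution_pairs p d V (\<lambda>_. 0) (\<lambda>M x. P (column_array d V M x))))
        = (\<Sum>c\<in>S. real (w c))" by simp
    also have "\<dots> = (\<Sum>T\<in>?G. \<Sum>c\<in>{c\<in>S. ?g c = T}. real (w c))"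
      by (rule sum.group[symmetric, OF finS finG gG])
    also have "\<dots> \<le> (\<Sum>T\<in>?G. bd)" by (intro sum_mono class_bound)
    also have "\<dots> = (real n + 1) ^ card ?C * bd" by (simp add: card_PiE add.commute)
    also have "(real n + 1) ^ card ?C = exp (real (card ?C) * L)" by (simp add: L_def exp_of_nat_mult)
    also have "exp (real (card ?C) * L) * bd = real (odd_fact n) ^ d * exp (- \<eta> * real n + K1 + (K2 + real (card ?C)) * L)"
      by (simp add: bd_def exp_add[symmetric] algebra_simps)
    finally show "real (card (solution_pairs p d V (\<lambda>_. 0)
          (\<lambda>M x. \<not> near_uniform p d \<epsilon> V (column_array d V M x) \<and> real (card {j\<in>V. fst (column_array d V M x j) = 0}) \<le> (1 - \<epsilon>0) * real (card V))))
      \<le> real (odd_fact (card V)) ^ d * exp (- \<eta> * real (card V) + K1 + (K2 + real (card ?C)) * ln (real (card V) + 1))"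
      unfolding P_def n_def L_def .
  qed (rule \<eta>(1))
qed

section \<open>Ratios of factorials, and sizes of sets of columns\<close>

text \<open>
  If all numbers involved are close to \<open>\<mu>\<close>, a bounded change of the argument multiplies the
  factorial at least by the corresponding power of \<open>\<mu>\<close>, up to the factor \<open>r ^ K\<close> close to \<open>1\<close>. The next lemma is the analogue
  for \<open>odd_fact\<close>, where two steps contribute one factor.
\<close>

lemma fact_ratio_bound:
  fixes \<mu> r :: real
  assumes r: "0 < r" "r \<le> 1" and \<mu>: "\<mu> > 0"
    and k: "r * \<mu> \<le> real k" "real k \<le> \<mu> / r" and k': "r * \<mu> \<le> real k'" "real k' \<le> \<mu> / r"
    and D: "\<bar>int k' - int k\<bar> \<le> int K"
  shows "r ^ K * \<mu> powr real_of_int (int k' - int k) * fact k \<le> fact k'"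
proof (cases "k \<le> k'")
  case True
  then obtain h where h: "k' = k + h" by (metis le_add_diff_inverse)
  have up: "(r * \<mu>) ^ h * fact k \<le> (fact (k + h) :: real)"
  proof (induction h)
    case (Suc h)
    have "(r * \<mu>) ^ Suc h * fact k = (r * \<mu>) * ((r * \<mu>) ^ h * fact k)" by simp
    also have "\<dots> \<le> real (Suc (k + h)) * fact (k + h)"
      using Suc k r \<mu> by (intro mult_mono) auto
    finally show ?case by simp
  qed simp
  have "r ^ K \<le> r ^ h" using D h r by (intro power_decreasing) auto
  moreover have "\<mu> powr real_of_int (int k' - int k) = \<mu> ^ h" using h \<mu> by (simp add: powr_realpow)
  ultimately have "r ^ K * \<mu> powr real_of_int (int k' - int k) * fact k \<le> r ^ h * \<mu> ^ h * fact k"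
    using \<mu> by (simp add: mult_right_mono)
  also have "\<dots> \<le> fact k'" using up h by (simp add: power_mult_distrib)
  finally show ?thesis .
next
  case False
  then obtain h where h: "k = k' + h" by (metis le_add_diff_inverse nat_le_linear)
  have up: "(fact (k' + j) :: real) \<le> (\<mu> / r) ^ j * fact k'" if "j \<le> h" for j
    using that
  proof (induction j)
    case (Suc j)
    have "(fact (k' + Suc j) :: real) = real (Suc (k' + j)) * fact (k' + j)" by simp
    also have "\<dots> \<le> (\<mu> / r) * ((\<mu> / r) ^ j * fact k')"
    proof (intro mult_mono)
      have "real (Suc (k' + j)) \<le> real k" using Suc.prems h by simp
      then show "real (Suc (k' + j)) \<le> \<mu> / r" using k(2) by linarith
    qed (use Suc \<mu> r in auto)
    finally show ?case by simp
  qed simp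
  have "r ^ K \<le> r ^ h" using D h r by (intro power_decreasing) auto
  have e: "\<mu> powr real_of_int (int k' - int k) = 1 / \<mu> ^ h"
    using h \<mu> by (simp add: powr_minus_divide powr_realpow)
  have "r ^ K * \<mu> powr real_of_int (int k' - int k) * fact k \<le> r ^ h * (1 / \<mu> ^ h) * fact k"
    unfolding e by (rule mult_right_mono[OF mult_right_mono[OF \<open>r ^ K \<le> r ^ h\<close>]]) (use \<mu> in auto)
  also have "\<dots> \<le> r ^ h * (1 / \<mu> ^ h) * ((\<mu> / r) ^ h * fact k')"
    using up[of h] h r \<mu> by (intro mult_left_mono) auto
  also have "\<dots> = fact k'" using r \<mu> by (simp add: power_divide)
  finally show ?thesis .
qed

lemma odd_fact_ratio_bound:
  fixes \<mu> r :: real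
  assumes r: "0 < r" "r \<le> 1" and \<mu>: "\<mu> > 0"
    and k: "r * \<mu> \<le> real k" "real k \<le> \<mu> / r" and k': "r * \<mu> \<le> real k'" "real k' \<le> \<mu> / r"
    and D: "\<bar>int k' - int k\<bar> \<le> int K" "even (int k' - int k)"
  shows "r ^ K * \<mu> powr (real_of_int (int k' - int k) / 2) * odd_fact k \<le> odd_fact k'"
proof (cases "k \<le> k'")
  case True
  obtain h where h: "k' = k + 2 * h"
  proof -
    have "even (k' - k)" using D(2) True by (metis even_of_nat of_nat_diff)
    then show ?thesis using that True by (metis evenE le_add_diff_inverse)
  qed
  have up: "(r * \<mu>) ^ h * real (odd_fact k) \<le> real (odd_fact (k + 2 * h))"
  proof (induction h)
    case (Suc h)
    have "(r * \<mu>) ^ Suc h * odd_fact k = (r * \<mu>) * ((r * \<mu>) ^ h * odd_fact k)" by simp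
    also have "\<dots> \<le> real (Suc (k + 2 * h)) * odd_fact (k + 2 * h)"
      using Suc k r \<mu> by (intro mult_mono) auto
    finally show ?case by (simp add: distrib_right)
  qed simp
  have "r ^ K \<le> r ^ h" using D h r by (intro power_decreasing) auto
  moreover have "\<mu> powr (real_of_int (int k' - int k) / 2) = \<mu> ^ h" using h \<mu> by (simp add: powr_realpow)
  ultimately have "r ^ K * \<mu> powr (real_of_int (int k' - int k) / 2) * odd_fact k \<le> r ^ h * \<mu> ^ h * odd_fact k"
    using \<mu> by (simp add: mult_right_mono)
  also have "\<dots> \<le> odd_fact k'" using up h by (simp add: power_mult_distrib)
  finally show ?thesis .
next
  case False
  obtain h where h: "k = k' + 2 * h"
  proof -
    have "even (k - k')" using D(2) False by (metis even_of_nat even_diff of_nat_diff nat_le_linear even_minus minus_diff_eq)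
    then show ?thesis using that False by (metis evenE le_add_diff_inverse nat_le_linear)
  qed
  have up: "real (odd_fact (k' + 2 * j)) \<le> (\<mu> / r) ^ j * odd_fact k'" if "j \<le> h" for j
    using that
  proof (induction j)
    case (Suc j)
    have "real (odd_fact (k' + 2 * Suc j)) = real (Suc (k' + 2 * j)) * odd_fact (k' + 2 * j)" by (simp add: distrib_right)
    also have "\<dots> \<le> (\<mu> / r) * ((\<mu> / r) ^ j * odd_fact k')"
    proof (intro mult_mono)
      have "real (Suc (k' + 2 * j)) \<le> real k" using Suc.prems h by simp
      then show "real (Suc (k' + 2 * j)) \<le> \<mu> / r" using k(2) by linarith
    qed (use Suc \<mu> r in auto)
    finally show ?case by simp
  qed simp
  have "r ^ K \<le> r ^ h" using D h r by (intro power_decreasing) auto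
  have e: "\<mu> powr (real_of_int (int k' - int k) / 2) = 1 / \<mu> ^ h"
    using h \<mu> by (simp add: powr_minus_divide powr_realpow)
  have "r ^ K * \<mu> powr (real_of_int (int k' - int k) / 2) * odd_fact k \<le> r ^ h * (1 / \<mu> ^ h) * odd_fact k"
    unfolding e by (rule mult_right_mono[OF mult_right_mono[OF \<open>r ^ K \<le> r ^ h\<close>]]) (use \<mu> in auto)
  also have "\<dots> \<le> r ^ h * (1 / \<mu> ^ h) * ((\<mu> / r) ^ h * odd_fact k')"
    using up[of h] h r \<mu> by (intro mult_left_mono) auto
  also have "\<dots> = odd_fact k'" using r \<mu> by (simp add: power_divide)
  finally show ?thesis .
qed

text \<open>
  All entries but one can be chosen freely, and the sum determines the remaining one.
\<close>

lemma card_residue_vectors: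
  assumes I: "finite I" "k \<in> I" and g: "g \<in> residues p" and p: "p > 0"
  shows "card {y \<in> PiE I (\<lambda>_. residues p). (\<Sum>i\<in>I. y i) mod p = g} = card (residues p) ^ (card I - 1)"
proof -
  let ?I = "I - {k}"
  let ?S = "{y \<in> PiE I (\<lambda>_. residues p). (\<Sum>i\<in>I. y i) mod p = g}"
  let ?f = "\<lambda>y. y(k := (g - (\<Sum>i\<in>?I. y i)) mod p)"
  have sumI: "(\<Sum>i\<in>I. y i) = y k + (\<Sum>i\<in>?I. y i)" for y :: "'a \<Rightarrow> int"
    using I by (rule sum.remove)
  have "bij_betw (\<lambda>y. restrict y ?I) ?S (PiE ?I (\<lambda>_. residues p))"
  proof (rule bij_betw_byWitness[where f' = ?f])
    show "\<forall>y\<in>?S. ?f (restrict y ?I) = y"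
    proof (rule ballI, rule ext)
      fix y j assume y: "y \<in> ?S"
      have yk: "y k \<in> residues p" using y I(2) by (auto simp: PiE_iff)
      have "(g - (\<Sum>i\<in>?I. restrict y ?I i)) mod p = ((\<Sum>i\<in>I. y i) mod p - (\<Sum>i\<in>?I. y i)) mod p" using y by simp
      also have "\<dots> = ((\<Sum>i\<in>I. y i) - (\<Sum>i\<in>?I. y i)) mod p" by (rule mod_diff_left_eq)
      also have "\<dots> = y k" using yk unfolding sumI by (simp add: residues_def)
      finally show "?f (restrict y ?I) j = y j"
        using y by (cases "j = k"; cases "j \<in> I") (auto simp: PiE_iff extensional_def)
    qed
    show "\<forall>y\<in>PiE ?I (\<lambda>_. residues p). restrict (?f y) ?I = y"
      by (auto simp: PiE_iff extensional_def fun_eq_iff)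
    show "(\<lambda>y. restrict y ?I) ` ?S \<subseteq> PiE ?I (\<lambda>_. residues p)"
    proof (rule image_subsetI)
      fix y assume "y \<in> ?S"
      then have "y \<in> PiE I (\<lambda>_. residues p)" by simp
      then show "restrict y ?I \<in> PiE ?I (\<lambda>_. residues p)"
        by (intro restrict_PiE_iff[THEN iffD2] ballI PiE_mem[of y I]) auto
    qed
    show "?f ` (PiE ?I (\<lambda>_. residues p)) \<subseteq> ?S"
    proof (rule image_subsetI)
      fix y assume y: "y \<in> PiE ?I (\<lambda>_. residues p)"
      have R: "(g - (\<Sum>i\<in>?I. y i)) mod p \<in> residues p" using p by (simp add: residues_def)
      have "(\<Sum>i\<in>?I. ?f y i) = (\<Sum>i\<in>?I. y i)" by (intro sum.cong) auto
      then have "(\<Sum>i\<in>I. ?f y i) mod p = g" unfolding sumI using g by (simp add: mod_add_left_eq residues_def)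
      moreover have "?f y \<in> PiE I (\<lambda>_. residues p)" using y R I by (auto simp: PiE_iff extensional_def)
      ultimately show "?f y \<in> ?S" by simp
    qed
  qed
  then have "card ?S = card (PiE ?I (\<lambda>_. residues p))" by (rule bij_betw_same_card)
  also have "\<dots> = card (residues p) ^ (card I - 1)" using I by (simp add: card_PiE)
  finally show ?thesis .
qed

lemma card_columns:
  assumes "d \<ge> 1" "g \<in> residues p" "p > 0"
  shows "card (columns_of_sum p d g) = card (residues p) ^ d"
proof -
  have "columns_of_sum p d g = residues p \<times> {y \<in> PiE {..<d} (\<lambda>_. residues p). (\<Sum>i<d. y i) mod p = g}"
    by (rule Set.set_eqI) (simp add: columns_of_sum_def all_columns_def mem_Times_iff)
  then have "card (columns_of_sum p d g) = card (residues p) * card (residues p) ^ (d - 1)"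
    using card_residue_vectors[of "{..<d}" 0 g p] assms by (simp add: card_cartesian_product)
  then show ?thesis using assms(1) by (simp add: power_eq_if)
qed

lemma card_column_fiber:
  assumes "d \<ge> 2" "i < d" "p > 0" "s \<in> residues p" "t \<in> residues p"
  shows "card {a \<in> columns_of_sum p d 0. (fst a, snd a i) = (s, t)} = card (residues p) ^ (d - 2)"
proof -
  let ?I = "{..<d} - {i}"
  let ?F = "{a \<in> columns_of_sum p d 0. (fst a, snd a i) = (s, t)}"
  let ?S = "{y \<in> PiE ?I (\<lambda>_. residues p). (\<Sum>j\<in>?I. y j) mod p = (- t) mod p}"
  have sumI: "(\<Sum>j<d. y j) = y i + (\<Sum>j\<in>?I. y j)" for y :: "nat \<Rightarrow> int"
    using assms(2) by (intro sum.remove) auto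
  have iff: "(t + u) mod p = 0 \<longleftrightarrow> u mod p = (- t) mod p" for u
  proof -
    have 1: "(u mod p = (- t) mod p) = (p dvd u - - t)" by (rule mod_eq_dvd_iff)
    have 2: "(p dvd t + u) = ((t + u) mod p = 0)" by (rule dvd_eq_mod_eq_0)
    have 3: "u - - t = t + u" by simp
    show ?thesis unfolding 1 3 2 by (rule refl)
  qed
  have "bij_betw (\<lambda>a. restrict (snd a) ?I) ?F ?S"
  proof (rule bij_betw_byWitness[where f' = "\<lambda>y. (s, y(i := t))"])
    show "\<forall>a\<in>?F. (s, (restrict (snd a) ?I)(i := t)) = a"
    proof
      fix a assume a: "a \<in> ?F"
      then have aC: "a \<in> columns_of_sum p d 0" and ai: "snd a i = t" by simp_all
      note aP = columnsD(4)[OF aC]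
      have "(restrict (snd a) ?I)(i := t) = snd a"
      proof
        fix j
        show "((restrict (snd a) ?I)(i := t)) j = snd a j"
          using ai PiE_arb[OF aP, of j] by (cases "j < d") auto
      qed
      then show "(s, (restrict (snd a) ?I)(i := t)) = a" using a by (simp add: prod_eq_iff)
    qed
    show "\<forall>y\<in>?S. restrict (snd (s, y(i := t))) ?I = y" by (auto simp: PiE_iff extensional_def fun_eq_iff)
    show "(\<lambda>a. restrict (snd a) ?I) ` ?F \<subseteq> ?S"
    proof (rule image_subsetI)
      fix a assume a: "a \<in> ?F"
      then have "(t + (\<Sum>j\<in>?I. snd a j)) mod p = 0" using columnsD(3)[of a p d 0] unfolding sumI by simp
      then have "(\<Sum>j\<in>?I. snd a j) mod p = (- t) mod p" by (simp only: iff)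
      moreover have "restrict (snd a) ?I \<in> PiE ?I (\<lambda>_. residues p)"
        by (rule restrict_PiE_iff[THEN iffD2]) (use columnsD(2)[of a p d 0] a in auto)
      ultimately show "restrict (snd a) ?I \<in> ?S" by simp
    qed
    show "(\<lambda>y. (s, y(i := t))) ` ?S \<subseteq> ?F"
    proof (rule image_subsetI)
      fix y assume y: "y \<in> ?S"
      have "(\<Sum>j\<in>?I. (y(i := t)) j) = (\<Sum>j\<in>?I. y j)" by (intro sum.cong) auto
      then have "(\<Sum>j<d. (y(i := t)) j) mod p = 0" unfolding sumI using y iff by simp
      moreover have "y(i := t) \<in> PiE {..<d} (\<lambda>_. residues p)" using y assms(2,5) by (auto simp: PiE_iff extensional_def)
      ultimately show "(s, y(i := t)) \<in> ?F" using assms(4) by (simp add: columns_of_sum_def all_columns_def)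
    qed
  qed
  then have "card ?F = card ?S" by (rule bij_betw_same_card)
  also have "\<dots> = card (residues p) ^ (card ?I - 1)"
  proof -
    obtain k where "k \<in> ?I" using assms(1,2) by (metis Diff_iff One_nat_def lessThan_iff less_le_trans lessI not_less_eq_eq numeral_2_eq_2 singletonD zero_less_Suc)
    then show ?thesis using assms(3) by (intro card_residue_vectors[of _ k]) (auto simp: residues_def)
  qed
  also have "card ?I - 1 = d - 2" using assms(2) by simp
  finally show ?thesis .
qed


text \<open>
  The number of compatible matchings is almost unchanged by a balanced change \<open>F\<close> of nearly equal pair
  counts: the powers of \<open>\<mu>\<close> from the single cells have total exponent \<open>\<Sum> \<kappa> s t * F s t\<close>, which is half
  of the sum of all \<open>F s t\<close> and vanishes.
\<close>

lemma pair_weight_product_bound: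
  fixes F :: "int \<Rightarrow> int \<Rightarrow> int" and m m' :: "int \<Rightarrow> int \<Rightarrow> nat"
  assumes r: "0 < r" "r \<le> 1" and \<mu>: "\<mu> > 0"
    and m: "\<And>s t. s \<in> R \<Longrightarrow> t \<in> R \<Longrightarrow> r * \<mu> \<le> real (m s t) \<and> real (m s t) \<le> \<mu> / r"
    and m': "\<And>s t. s \<in> R \<Longrightarrow> t \<in> R \<Longrightarrow> r * \<mu> \<le> real (m' s t) \<and> real (m' s t) \<le> \<mu> / r"
    and F: "\<And>s t. s \<in> R \<Longrightarrow> t \<in> R \<Longrightarrow> F s t = int (m' s t) - int (m s t) \<and> \<bar>F s t\<bar> \<le> int K \<and> F s t = F t s \<and> even (F s s)"
    and total: "(\<Sum>s\<in>R. \<Sum>t\<in>R. F s t) = 0" and fin: "finite R"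
  shows "r ^ (K * card (R \<times> R)) * (\<Prod>(s,t)\<in>R \<times> R. pair_weight s t (m s t)) \<le>
    (\<Prod>(s,t)\<in>R \<times> R. pair_weight s t (m' s t))"
proof -
  \<comment> \<open>The exponent of \<open>\<mu>\<close> for one unit of \<open>F\<close> at the given cell; opposite cells have exponents with sum \<open>1\<close>.\<close>
  define \<kappa> :: "int \<Rightarrow> int \<Rightarrow> real" where "\<kappa> = (\<lambda>s t. if s < t then 1 else if s = t then 1 / 2 else 0)"
  have cell: "r ^ K * \<mu> powr (\<kappa> s t * of_int (F s t)) * pair_weight s t (m s t) \<le> pair_weight s t (m' s t)"
    if st: "s \<in> R" "t \<in> R" for s t
  proof -
    consider "s < t" | "s = t" | "t < s" by linarith
    then show ?thesis
    proof cases
      case 1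
      have "r ^ K * \<mu> powr real_of_int (int (m' s t) - int (m s t)) * fact (m s t) \<le> fact (m' s t)"
        by (rule fact_ratio_bound[OF r \<mu>]) (use m[OF st] m'[OF st] F[OF st] in auto)
      moreover have "F s t = int (m' s t) - int (m s t)" using F[OF st] by blast
      ultimately show ?thesis using 1 by (simp add: \<kappa>_def pair_weight_def)
    next
      case 2
      have Fe: "F s t = int (m' s t) - int (m s t)" "\<bar>F s t\<bar> \<le> int K" "even (F s t)"
        using F[OF st] 2 by blast+
      have "r ^ K * \<mu> powr (real_of_int (int (m' s t) - int (m s t)) / 2) * odd_fact (m s t) \<le> odd_fact (m' s t)"
        by (rule odd_fact_ratio_bound[OF r \<mu>]) (use m[OF st] m'[OF st] Fe in auto)
      then show ?thesis using 2 Fe(1) by (simp add: \<kappa>_def pair_weight_def)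
    next
      case 3
      then show ?thesis using power_le_one[of r K] r by (simp add: \<kappa>_def pair_weight_def)
    qed
  qed
  have "(\<Sum>z\<in>R \<times> R. \<kappa> (fst z) (snd z) * of_int (F (fst z) (snd z))) = 0"
  proof -
    let ?S = "\<Sum>z\<in>R \<times> R. \<kappa> (fst z) (snd z) * of_int (F (fst z) (snd z))"
    have "?S = (\<Sum>z\<in>R \<times> R. \<kappa> (snd z) (fst z) * of_int (F (snd z) (fst z)))"
      by (rule sum.reindex_bij_witness[where i = prod.swap and j = prod.swap]) auto
    also have "\<dots> = (\<Sum>z\<in>R \<times> R. \<kappa> (snd z) (fst z) * of_int (F (fst z) (snd z)))"
    proof (rule sum.cong[OF refl])
      fix z assume "z \<in> R \<times> R"
      then have "F (snd z) (fst z) = F (fst z) (snd z)" using F[of "snd z" "fst z"] by (simp add: mem_Times_iff)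
      then show "\<kappa> (snd z) (fst z) * of_int (F (snd z) (fst z)) = \<kappa> (snd z) (fst z) * real_of_int (F (fst z) (snd z))"
        by (simp only:)
    qed
    finally have "2 * ?S = (\<Sum>z\<in>R \<times> R. (\<kappa> (fst z) (snd z) + \<kappa> (snd z) (fst z)) * of_int (F (fst z) (snd z)))"
      by (simp add: sum.distrib distrib_right)
    also have "\<dots> = (\<Sum>z\<in>R \<times> R. of_int (F (fst z) (snd z)))"
      by (rule sum.cong[OF refl]) (auto simp: \<kappa>_def)
    also have "\<dots> = of_int (\<Sum>s\<in>R. \<Sum>t\<in>R. F s t)"
      by (simp add: sum.cartesian_product case_prod_beta')
    finally show ?thesis using total by simp
  qed
  then have "1 = (\<Prod>z\<in>R \<times> R. \<mu> powr (\<kappa> (fst z) (snd z) * of_int (F (fst z) (snd z))))"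
    using \<mu> fin by (subst powr_sum[symmetric]) auto
  moreover have "r ^ (K * card (R \<times> R)) = (\<Prod>z\<in>R \<times> R. r ^ K)" by (simp add: power_mult)
  ultimately have "r ^ (K * card (R \<times> R)) * (\<Prod>(s,t)\<in>R \<times> R. pair_weight s t (m s t)) =
      (\<Prod>z\<in>R \<times> R. r ^ K * \<mu> powr (\<kappa> (fst z) (snd z) * of_int (F (fst z) (snd z))) * pair_weight (fst z) (snd z) (m (fst z) (snd z)))"
    by (simp only: prod.distrib case_prod_beta' of_nat_prod mult_1_right)
  also have "\<dots> \<le> (\<Prod>z\<in>R \<times> R. real (pair_weight (fst z) (snd z) (m' (fst z) (snd z))))"
  proof (intro prod_mono conjI)
    fix z assume "z \<in> R \<times> R"
    then have z: "fst z \<in> R" "snd z \<in> R" by (simp_all add: mem_Times_iff)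
    show "0 \<le> r ^ K * \<mu> powr (\<kappa> (fst z) (snd z) * of_int (F (fst z) (snd z))) * pair_weight (fst z) (snd z) (m (fst z) (snd z))"
      using r \<mu> by simp
    show "r ^ K * \<mu> powr (\<kappa> (fst z) (snd z) * of_int (F (fst z) (snd z))) * pair_weight (fst z) (snd z) (m (fst z) (snd z))
       \<le> real (pair_weight (fst z) (snd z) (m' (fst z) (snd z)))" by (rule cell[OF z])
  qed
  finally show ?thesis by (simp only: case_prod_beta' of_nat_prod)
qed

section \<open>Moving from kernel vectors to preimages of unit vectors\<close>

text \<open>
  The type \<open>T\<close> changed by \<open>D\<close>. The truncation by \<open>nat\<close> has no effect where \<open>T\<close> is at least \<open>\<bar>D\<bar>\<close>.
\<close>

definition shifted_type :: "(column \<Rightarrow> int) \<Rightarrow> (column \<Rightarrow> nat) \<Rightarrow> column \<Rightarrow> nat" where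
  "shifted_type D T a = nat (int (T a) + D a)"

text \<open>
  Removing a vertex and replacing \<open>T\<close> by \<open>T + D\<close>, whose total is smaller by one, divides the multinomial coefficient
  by at most about \<open>n / \<nu>\<close>.
\<close>

lemma shifted_multinomial:
  assumes C: "finite C" and V: "finite V" "v \<in> V"
    and T: "(\<Sum>a\<in>C. T a) = card V" and D: "(\<Sum>a\<in>C. D a) = - 1"
    and pos: "\<And>a. a \<in> C \<Longrightarrow> int (T a) + D a \<ge> 0"
    and r: "0 < r" "r \<le> 1" and \<nu>: "\<nu> > 0"
    and T1: "\<And>a. a \<in> C \<Longrightarrow> r * \<nu> \<le> real (T a) \<and> real (T a) \<le> \<nu> / r"
    and T2: "\<And>a. a \<in> C \<Longrightarrow> r * \<nu> \<le> real (shifted_type D T a) \<and> real (shifted_type D T a) \<le> \<nu> / r"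
    and DK: "\<And>a. a \<in> C \<Longrightarrow> \<bar>D a\<bar> \<le> int K"
  shows "r ^ (K * card C) * \<nu> * card (arrays_of_type V C T) \<le>
    real (card V) * card (arrays_of_type (V - {v}) C (shifted_type D T))"
proof -
  let ?T = "shifted_type D T"
  have intT: "int (?T a) = int (T a) + D a" if "a \<in> C" for a using pos[OF that] by (simp add: shifted_type_def)
  have cardV: "card V = Suc (card (V - {v}))" using V by (metis card_Suc_Diff1)
  have "int (\<Sum>a\<in>C. ?T a) = int (\<Sum>a\<in>C. T a) + (\<Sum>a\<in>C. D a)"
    using intT by (simp add: sum.distrib)
  also have "\<dots> = int (card (V - {v}))" unfolding T D cardV by simp
  finally have sumT': "(\<Sum>a\<in>C. ?T a) = card (V - {v})" by (simp only: of_nat_eq_iff)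
  have N: "card (arrays_of_type V C T) * (\<Prod>a\<in>C. fact (T a)) = fact (card V)"
    by (rule card_arrays_of_type[OF V(1) C T])
  have N': "card (arrays_of_type (V - {v}) C ?T) * (\<Prod>a\<in>C. fact (?T a)) = fact (card (V - {v}))"
    using V(1) by (intro card_arrays_of_type C sumT') simp
  have "r ^ (K * card C) * \<nu> * (\<Prod>a\<in>C. fact (?T a)) = (\<Prod>a\<in>C. r ^ K * \<nu> powr of_int (- D a) * fact (?T a))"
  proof -
    have "\<nu> = \<nu> powr (\<Sum>a\<in>C. of_int (- D a))"
      using D \<nu> by (simp add: sum_negf flip: of_int_sum)
    also have "\<dots> = (\<Prod>a\<in>C. \<nu> powr of_int (- D a))" using \<nu> by (intro powr_sum) simp
    finally have e: "\<nu> = (\<Prod>a\<in>C. \<nu> powr of_int (- D a))" .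
    have "r ^ (K * card C) = (\<Prod>a\<in>C. r ^ K)" by (simp add: power_mult)
    then show ?thesis by (subst e) (simp only: prod.distrib)
  qed
  also have "\<dots> \<le> (\<Prod>a\<in>C. fact (T a))"
  proof (intro prod_mono conjI)
    fix a assume a: "a \<in> C"
    show "0 \<le> r ^ K * \<nu> powr of_int (- D a) * fact (?T a)" using r by simp
    have "r ^ K * \<nu> powr real_of_int (int (T a) - int (?T a)) * fact (?T a) \<le> fact (T a)"
      by (rule fact_ratio_bound[OF r \<nu>]) (use T1[OF a] T2[OF a] intT[OF a] DK[OF a] in auto)
    moreover have "int (T a) - int (?T a) = - D a" using intT[OF a] by simp
    ultimately show "r ^ K * \<nu> powr of_int (- D a) * fact (?T a) \<le> fact (T a)" by simp
  qed
  finally have "card (arrays_of_type V C T) * (r ^ (K * card C) * \<nu> * (\<Prod>a\<in>C. fact (?T a))) \<le>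
      card (arrays_of_type V C T) * (\<Prod>a\<in>C. fact (T a) :: real)" by (intro mult_left_mono) auto
  also have "\<dots> = real (card (arrays_of_type V C T) * (\<Prod>a\<in>C. fact (T a)))" by simp
  also have "\<dots> = fact (card V)" by (simp only: N of_nat_fact)
  also have "\<dots> = real (card V) * fact (card (V - {v}))" using cardV by simp
  also have "(fact (card (V - {v})) :: real) = real (card (arrays_of_type (V - {v}) C ?T) * (\<Prod>a\<in>C. fact (?T a)))"
    by (simp only: N' of_nat_fact)
  finally have "(r ^ (K * card C) * \<nu> * card (arrays_of_type V C T)) * (\<Prod>a\<in>C. fact (?T a)) \<le>
      (real (card V) * card (arrays_of_type (V - {v}) C ?T)) * (\<Prod>a\<in>C. fact (?T a) :: real)"
    by (simp add: mult_ac)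
  moreover have "(\<Prod>a\<in>C. fact (?T a) :: real) > 0" by (intro prod_pos) simp
  ultimately show ?thesis by (simp only: mult_le_cancel_right_pos)
qed

text \<open>
  The columns of the shifted type together with one extra column \<open>b\<close> have pair counts that differ from
  those of \<open>T\<close> by the balanced change of \<open>balance_column\<close>. For \<open>T\<close> close to uniform with \<open>\<nu>\<close> vertices for
  each column, every pair count is close to \<open>\<mu> = p ^ (d - 2) \<nu>\<close>.
\<close>

lemma shifted_matching_count:
  assumes p: "p > 0" and d: "d \<ge> 2" "i < d" and b: "b \<in> all_columns p d"
    and bal: "balanced p d (\<lambda>i s t. incidence b i s t + (\<Sum>a\<in>columns_of_sum p d 0. D a * incidence a i s t))"
    and D: "(\<Sum>a\<in>columns_of_sum p d 0. D a) = - 1"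
    and pos: "\<And>a. a \<in> columns_of_sum p d 0 \<Longrightarrow> int (T a) + D a \<ge> 0"
    and \<epsilon>: "0 < \<epsilon>" "\<epsilon> \<le> 1 / 4" and \<nu>: "\<nu> > 0"
    and T: "\<And>a. a \<in> columns_of_sum p d 0 \<Longrightarrow> \<bar>real (T a) - \<nu>\<bar> \<le> \<epsilon> * \<nu>"
    and K: "1 + (\<Sum>a\<in>columns_of_sum p d 0. \<bar>D a\<bar>) \<le> int K" "real K \<le> \<epsilon> * \<nu>"
  shows "(1 - 2 * \<epsilon>) ^ (K * card (residues p \<times> residues p)) * matching_count p (columns_of_sum p d 0) T i \<le>
    matching_count p (all_columns p d)
      (\<lambda>a. of_bool (a = b) + (if a \<in> columns_of_sum p d 0 then shifted_type D T a else 0)) i"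
proof (cases "matching_count p (columns_of_sum p d 0) T i = 0")
  case False
  let ?C = "columns_of_sum p d 0"
  let ?R = "residues p"
  let ?T = "\<lambda>a. of_bool (a = b) + (if a \<in> ?C then shifted_type D T a else 0)"
  define F where "F = (\<lambda>s t. incidence b i s t + (\<Sum>a\<in>?C. D a * incidence a i s t))"
  define m where "m = pair_total ?C T i"
  define m' where "m' = pair_total (all_columns p d) ?T i"
  \<comment> \<open>Counts in the interval from \<open>(1 - 2 * \<epsilon>) * \<mu>\<close> to \<open>(1 + 2 * \<epsilon>) * \<mu>\<close> lie between \<open>r * \<mu>\<close> and \<open>\<mu> / r\<close>.\<close>
  define r where "r = 1 - 2 * \<epsilon>"
  define \<mu> where "\<mu> = real (card ?R) ^ (d - 2) * \<nu>"
  have r: "0 < r" "r \<le> 1" using \<epsilon> by (auto simp: r_def)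
  have cR: "real (card ?R) \<ge> 1" using p by (simp add: residues_def)
  have \<nu>\<mu>: "\<nu> \<le> \<mu>" unfolding \<mu>_def using one_le_power[OF cR, of "d - 2"] \<nu> by simp
  have \<mu>: "\<mu> > 0" using \<nu> \<nu>\<mu> by simp
  have sub: "?C \<subseteq> all_columns p d" by (auto simp: columns_of_sum_def)
  have sym: "m s t = m t s" if "s \<in> ?R" "t \<in> ?R" for s t
  proof (rule ccontr)
    assume "m s t \<noteq> m t s"
    then have "matching_count p ?C T i = 0" unfolding matching_count_def m_def using that by (intro if_not_P) blast
    then show False using False by simp
  qed
  have Fbal: "F s t = F t s \<and> even (F s s)" if "s \<in> ?R" "t \<in> ?R" for s t
    using bal d(2) that unfolding balanced_def F_def by blast
  have FK: "\<bar>F s t\<bar> \<le> int K" for s t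
  proof -
    have "\<bar>F s t\<bar> \<le> \<bar>incidence b i s t\<bar> + (\<Sum>a\<in>?C. \<bar>D a * incidence a i s t\<bar>)"
      unfolding F_def by (rule order_trans[OF abs_triangle_ineq add_left_mono[OF sum_abs]])
    also have "\<dots> \<le> 1 + (\<Sum>a\<in>?C. \<bar>D a\<bar>)"
      by (intro add_mono sum_mono) (auto simp: incidence_def abs_mult)
    finally show ?thesis using K(1) by simp
  qed
  have m'eq: "int (m' s t) = int (m s t) + F s t" for s t
  proof -
    have inc: "incidence a i s t = of_bool ((fst a, snd a i) = (s, t))" for a by (auto simp: incidence_def)
    have e1: "int (pair_total A T i s t) = (\<Sum>a\<in>A. int (T a) * incidence a i s t)" if "finite A" for A T
    proof -
      have "(\<Sum>a\<in>A. int (T a) * incidence a i s t) = (\<Sum>a\<in>A. if (fst a, snd a i) = (s, t) then int (T a) else 0)"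
        unfolding inc by (intro sum.cong) auto
      also have "\<dots> = (\<Sum>a\<in>{a\<in>A. (fst a, snd a i) = (s, t)}. int (T a))" by (rule sum.inter_filter[OF that, symmetric])
      finally show ?thesis by (simp add: pair_total_def)
    qed
    have "int (m' s t) = (\<Sum>a\<in>all_columns p d. (if a = b then incidence b i s t else 0)
        + (if a \<in> ?C then int (shifted_type D T a) * incidence a i s t else 0))"
      unfolding m'_def e1[OF finite_all_columns] by (intro sum.cong) (auto simp: distrib_right)
    also have "\<dots> = incidence b i s t + (\<Sum>a\<in>all_columns p d. if a \<in> ?C then int (shifted_type D T a) * incidence a i s t else 0)"
      unfolding sum.distrib using b by simp
    also have "(\<Sum>a\<in>all_columns p d. if a \<in> ?C then int (shifted_type D T a) * incidence a i s t else 0)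
        = (\<Sum>a\<in>?C. int (shifted_type D T a) * incidence a i s t)"
      using sub by (simp add: sum.inter_restrict[symmetric] Int_absorb1)
    also have "\<dots> = (\<Sum>a\<in>?C. (int (T a) + D a) * incidence a i s t)"
      using pos by (intro sum.cong) (auto simp: shifted_type_def)
    also have "\<dots> = int (m s t) + (\<Sum>a\<in>?C. D a * incidence a i s t)"
      unfolding m_def e1[OF finite_columns] by (simp add: distrib_right sum.distrib)
    finally show ?thesis by (simp add: F_def)
  qed
  have mclose: "\<bar>real (m s t) - \<mu>\<bar> \<le> \<epsilon> * \<mu>" if "s \<in> ?R" "t \<in> ?R" for s t
  proof -
    let ?S = "{a \<in> ?C. (fst a, snd a i) = (s, t)}"
    have cS: "card ?S = card ?R ^ (d - 2)" by (rule card_column_fiber[OF d p that])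
    have "real (m s t) - \<mu> = (\<Sum>a\<in>?S. real (T a) - \<nu>)"
      unfolding sum_subtractf sum_constant cS by (simp add: m_def pair_total_def \<mu>_def)
    also have "\<bar>\<dots>\<bar> \<le> (\<Sum>a\<in>?S. \<bar>real (T a) - \<nu>\<bar>)" by (rule sum_abs)
    also have "\<dots> \<le> (\<Sum>a\<in>?S. \<epsilon> * \<nu>)" by (intro sum_mono T) auto
    also have "\<dots> = \<epsilon> * \<mu>" unfolding sum_constant cS by (simp add: \<mu>_def)
    finally show ?thesis .
  qed
  have bounds: "r * \<mu> \<le> x \<and> x \<le> \<mu> / r" if "\<bar>x - \<mu>\<bar> \<le> 2 * \<epsilon> * \<mu>" for x
  proof
    show "r * \<mu> \<le> x" using that by (simp add: r_def algebra_simps abs_le_iff)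
    have "x \<le> (1 + 2 * \<epsilon>) * \<mu>" using that by (simp add: algebra_simps abs_le_iff)
    also have "1 + 2 * \<epsilon> \<le> 1 / r" using r by (simp add: pos_le_divide_eq r_def algebra_simps)
    finally show "x \<le> \<mu> / r" using \<mu> by (simp add: mult_right_mono)
  qed
  have \<epsilon>\<mu>: "\<epsilon> * \<mu> > 0" using \<epsilon> \<mu> by simp
  have mb: "r * \<mu> \<le> real (m s t) \<and> real (m s t) \<le> \<mu> / r" if "s \<in> ?R" "t \<in> ?R" for s t
    using mclose[OF that] \<epsilon>\<mu> by (intro bounds) simp
  have m'b: "r * \<mu> \<le> real (m' s t) \<and> real (m' s t) \<le> \<mu> / r" if "s \<in> ?R" "t \<in> ?R" for s t
  proof (rule bounds)
    have "real (m' s t) = real (m s t) + of_int (F s t)"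
      using arg_cong[OF m'eq, of real_of_int s t] by simp
    moreover have "\<bar>real_of_int (F s t)\<bar> \<le> real K" using FK[of s t] by linarith
    moreover have "real K \<le> \<epsilon> * \<mu>" using \<epsilon> by (intro order_trans[OF K(2) mult_left_mono[OF \<nu>\<mu>]]) simp
    ultimately show "\<bar>real (m' s t) - \<mu>\<bar> \<le> 2 * \<epsilon> * \<mu>" using mclose[OF that] by linarith
  qed
  have Ftot: "(\<Sum>s\<in>?R. \<Sum>t\<in>?R. F s t) = 0"
  proof -
    have "(\<Sum>s\<in>?R. \<Sum>t\<in>?R. \<Sum>a\<in>?C. D a * incidence a i s t) = (\<Sum>a\<in>?C. D a * (\<Sum>s\<in>?R. \<Sum>t\<in>?R. incidence a i s t))"
      by (simp add: sum_distrib_left sum.swap[of _ _ ?C])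
    also have "\<dots> = (\<Sum>a\<in>?C. D a)"
    proof (rule sum.cong[OF refl])
      fix a assume "a \<in> ?C"
      then have "a \<in> all_columns p d" using sub by blast
      then show "D a * (\<Sum>s\<in>?R. \<Sum>t\<in>?R. incidence a i s t) = D a" using sum_incidence[of a p d i] d(2) by simp
    qed
    finally show ?thesis unfolding F_def sum.distrib using sum_incidence[OF b d(2)] D by simp
  qed
  have sym': "m' s t = m' t s" if "s \<in> ?R" "t \<in> ?R" for s t
    using m'eq[of s t] m'eq[of t s] sym[OF that] Fbal[OF that] by simp
  have "r ^ (K * card (?R \<times> ?R)) * (\<Prod>(s,t)\<in>?R \<times> ?R. pair_weight s t (m s t)) \<le>
    (\<Prod>(s,t)\<in>?R \<times> ?R. pair_weight s t (m' s t))"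
  proof (rule pair_weight_product_bound[OF r \<mu> mb m'b _ Ftot finite_residues])
    fix s t assume st: "s \<in> ?R" "t \<in> ?R"
    show "F s t = int (m' s t) - int (m s t) \<and> \<bar>F s t\<bar> \<le> int K \<and> F s t = F t s \<and> even (F s s)"
      using m'eq[of s t] FK[of s t] Fbal[OF st] by (intro conjI) linarith+
  qed
  moreover have "matching_count p ?C T i = (\<Prod>(s,t)\<in>?R \<times> ?R. pair_weight s t (m s t))"
    unfolding matching_count_def m_def[symmetric] by (rule if_P) (use sym in blast)
  moreover have "matching_count p (all_columns p d) ?T i = (\<Prod>(s,t)\<in>?R \<times> ?R. pair_weight s t (m' s t))"
    unfolding matching_count_def m'_def[symmetric] by (rule if_P) (use sym' in blast)
  ultimately show ?thesis by (simp only: r_def)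
qed simp


text \<open>
  For each column \<open>b\<close> of sum \<open>g\<close> and each nearly uniform type \<open>T\<close>, the arrays with column \<open>b\<close> at \<open>v\<close> and type \<open>T + D\<^sub>b\<close>
  elsewhere solve the system with right-hand side \<open>g\<close> at \<open>v\<close>. By the two preceding lemmas their weight is about
  \<open>p\<^sup>-\<^sup>d\<close> times the weight of the arrays of type \<open>T\<close>, and there are \<open>p\<^sup>d\<close> columns \<open>b\<close>. Different pairs
  \<open>(b, T)\<close> give different arrays, so nothing is counted twice.
\<close>

theorem typical_solutions_transfer:
  assumes d: "d \<ge> 3" and p: "prime p" "odd p" "\<not> p dvd int d" and \<delta>: "\<delta> > 0" and \<epsilon>1: "\<epsilon>1 > 0"
  obtains \<epsilon> n0 where "0 < \<epsilon>" "\<epsilon> \<le> \<epsilon>1"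
    "\<And>(V :: 'v set) v g. finite V \<Longrightarrow> card V \<ge> n0 \<Longrightarrow> v \<in> V \<Longrightarrow> g \<in> residues p \<Longrightarrow>
      (1 - \<delta>) * real (card (solution_pairs p d V (\<lambda>_. 0)
          (\<lambda>M x. near_uniform p d \<epsilon> V (column_array d V M x))))
      \<le> real (card (solution_pairs p d V (\<lambda>j. if j = v then g else 0) (\<lambda>M x. True)))"
proof -
  let ?C = "columns_of_sum p d 0"
  let ?R = "residues p"
  have p0: "p > 0" using p(1) by (simp add: prime_gt_0_int)
  have sub: "columns_of_sum p d g \<subseteq> all_columns p d" for g by (auto simp: columns_of_sum_def)
  have "\<forall>b\<in>all_columns p d. \<exists>D. balanced p d (\<lambda>i s t. incidence b i s t + (\<Sum>a\<in>?C. D a * incidence a i s t)) \<and>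
      (\<Sum>a\<in>?C. D a) = - 1"
  proof
    fix b assume "b \<in> all_columns p d"
    from balance_column[OF d p this] obtain D where
      "balanced p d (\<lambda>i s t. incidence b i s t + (\<Sum>a\<in>?C. D a * incidence a i s t))" "(\<Sum>a\<in>?C. D a) = - 1" .
    then show "\<exists>D. balanced p d (\<lambda>i s t. incidence b i s t + (\<Sum>a\<in>?C. D a * incidence a i s t)) \<and>
      (\<Sum>a\<in>?C. D a) = - 1" by (intro exI[of _ D] conjI)
  qed
  from bchoice[OF this] obtain D where D': "\<forall>b\<in>all_columns p d.
      balanced p d (\<lambda>i s t. incidence b i s t + (\<Sum>a\<in>?C. D b a * incidence a i s t)) \<and> (\<Sum>a\<in>?C. D b a) = - 1" ..
  have D: "balanced p d (\<lambda>i s t. incidence b i s t + (\<Sum>a\<in>?C. D b a * incidence a i s t))"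
    "(\<Sum>a\<in>?C. D b a) = - 1" if "b \<in> all_columns p d" for b
    using bspec[OF D' that] by simp_all
  define K where "K = nat (1 + (\<Sum>b\<in>all_columns p d. \<Sum>a\<in>?C. \<bar>D b a\<bar>))"
  have K1: "1 + (\<Sum>a\<in>?C. \<bar>D b a\<bar>) \<le> int K" if "b \<in> all_columns p d" for b
  proof -
    have "(\<Sum>a\<in>?C. \<bar>D b a\<bar>) \<le> (\<Sum>b\<in>all_columns p d. \<Sum>a\<in>?C. \<bar>D b a\<bar>)"
      using that by (intro member_le_sum) (auto intro: sum_nonneg)
    then show ?thesis unfolding K_def by simp
  qed
  have DK: "\<bar>D b a\<bar> \<le> int K" if "b \<in> all_columns p d" "a \<in> ?C" for a b
  proof -
    have "\<bar>D b a\<bar> \<le> (\<Sum>a\<in>?C. \<bar>D b a\<bar>)" using that(2) by (intro member_le_sum) auto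
    then show ?thesis using K1[OF that(1)] by simp
  qed
  define e where "e = K * card (?R \<times> ?R)"
  \<comment> \<open>The total number of factors \<open>r\<close> lost in the multinomial coefficient and in the \<open>d\<close> matching counts.\<close>
  define m0 where "m0 = K * card ?C + d * e"
  define \<epsilon> where "\<epsilon> = min \<epsilon>1 (min (1 / 4) (\<delta> / (2 * (real m0 + 1))))"
  have \<epsilon>: "0 < \<epsilon>" "\<epsilon> \<le> \<epsilon>1" using \<epsilon>1 \<delta> unfolding \<epsilon>_def by simp_all
  have \<epsilon>4: "\<epsilon> \<le> 1 / 4" unfolding \<epsilon>_def by (rule order_trans[OF min.cobounded2 min.cobounded1])
  note \<epsilon> = \<epsilon>(1) \<epsilon>4 \<epsilon>(2)
  define r where "r = 1 - 2 * \<epsilon>"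
  have r: "0 < r" "r \<le> 1" using \<epsilon> by (auto simp: r_def)
  have rm0: "1 - \<delta> \<le> r ^ m0"
  proof -
    have "1 + real m0 * (- 2 * \<epsilon>) \<le> (1 + (- 2 * \<epsilon>)) ^ m0" using \<epsilon> by (intro Bernoulli_inequality) simp
    moreover have "real m0 * (2 * \<epsilon>) \<le> \<delta>"
    proof -
      have "\<epsilon> \<le> \<delta> / (2 * (real m0 + 1))" by (simp add: \<epsilon>_def)
      then have "\<epsilon> * (2 * (real m0 + 1)) \<le> \<delta>" by (subst (asm) pos_le_divide_eq) auto
      then show ?thesis using \<epsilon>(1) by (simp add: algebra_simps)
    qed
    ultimately show ?thesis by (simp add: r_def)
  qed
  define P where "P = real_of_int p ^ d"
  have P: "P > 0" using p0 by (simp add: P_def)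
  \<comment> \<open>For \<open>n \<ge> n0\<close> a shift by at most \<open>K\<close> is small compared with the common count \<open>\<nu> = n / p\<^sup>d\<close>.\<close>
  define n0 where "n0 = nat \<lceil>real K * P / \<epsilon>\<rceil> + 1"
  show ?thesis
  proof (rule that[OF \<epsilon>(1,3), of n0])
    fix V :: "'v set" and v g
    assume V: "finite V" "card V \<ge> n0" "v \<in> V" and g: "g \<in> ?R"
    define n where "n = card V"
    define \<nu> where "\<nu> = real n / P"
    have n: "n > 0" using V by (simp add: n_def n0_def)
    have \<nu>: "\<nu> > 0" using n P by (simp add: \<nu>_def)
    have K\<nu>: "real K \<le> \<epsilon> * \<nu>"
    proof -
      have "real K * P / \<epsilon> \<le> real n" using V(2) by (simp add: n_def n0_def) linarith
      then show ?thesis using \<epsilon>(1) P by (simp add: \<nu>_def field_simps)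
    qed
    define G where "G = {T \<in> PiE ?C (\<lambda>_. {..n}). (\<forall>a\<in>?C. \<bar>real (T a) - \<nu>\<bar> \<le> \<epsilon> * \<nu>) \<and> (\<Sum>a\<in>?C. T a) = n}"
    define w where "w = (\<lambda>T. \<Prod>i<d. real (matching_count p ?C T i))"
    define T'' where "T'' = (\<lambda>b T a. of_bool (a = b) + (if a \<in> ?C then shifted_type (D b) T a else 0))"
    define w' where "w' = (\<lambda>b T. \<Prod>i<d. real (matching_count p (all_columns p d) (T'' b T) i))"
    define N where "N = (\<lambda>T. real (card (arrays_of_type V ?C T)))"
    define N' where "N' = (\<lambda>b T. real (card (arrays_of_type (V - {v}) ?C (shifted_type (D b) T))))"
    have bounds: "r * \<nu> \<le> x \<and> x \<le> \<nu> / r" if "\<bar>x - \<nu>\<bar> \<le> 2 * \<epsilon> * \<nu>" for x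
    proof
      show "r * \<nu> \<le> x" using that by (simp add: r_def algebra_simps abs_le_iff)
      have "x \<le> (1 + 2 * \<epsilon>) * \<nu>" using that by (simp add: algebra_simps abs_le_iff)
      also have "1 + 2 * \<epsilon> \<le> 1 / r" using r by (simp add: pos_le_divide_eq r_def algebra_simps)
      finally show "x \<le> \<nu> / r" using \<nu> by (simp add: mult_right_mono)
    qed
    have \<epsilon>\<nu>: "\<epsilon> * \<nu> > 0" "\<epsilon> * \<nu> \<le> \<nu> / 4" using \<epsilon> \<nu> by auto
    have shifted_nonneg: "int (T a) + D b a \<ge> 0" if "T \<in> G" "b \<in> all_columns p d" "a \<in> ?C" for T b a
    proof -
      have "\<bar>real (T a) - \<nu>\<bar> \<le> \<epsilon> * \<nu>" using that(1,3) by (simp add: G_def)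
      then have "real K \<le> real (T a)" using K\<nu> \<epsilon>\<nu> \<nu> by linarith
      then show ?thesis using DK[OF that(2,3)] by linarith
    qed
    have pointwise: "(1 - \<delta>) * (N T * w T) \<le> P * (N' b T * w' b T)" if T: "T \<in> G" and b: "b \<in> columns_of_sum p d g" for T b
    proof -
      have b': "b \<in> all_columns p d" using b sub by blast
      have Ta: "\<bar>real (T a) - \<nu>\<bar> \<le> \<epsilon> * \<nu>" if "a \<in> ?C" for a using T that by (simp add: G_def)
      have "r ^ (K * card ?C) * \<nu> * N T \<le> real (card V) * N' b T"
        unfolding N_def N'_def
      proof (rule shifted_multinomial[OF finite_columns V(1,3) _ D(2)[OF b'] shifted_nonneg[OF T b'] r \<nu> _ _ DK[OF b']])
        show "(\<Sum>a\<in>?C. T a) = card V" using T by (simp add: G_def n_def)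
        show "r * \<nu> \<le> real (T a) \<and> real (T a) \<le> \<nu> / r" if "a \<in> ?C" for a
          using Ta[OF that] \<epsilon>\<nu> by (intro bounds) simp
        show "r * \<nu> \<le> real (shifted_type (D b) T a) \<and> real (shifted_type (D b) T a) \<le> \<nu> / r" if "a \<in> ?C" for a
        proof (rule bounds)
          have "int (shifted_type (D b) T a) = int (T a) + D b a"
            using shifted_nonneg[OF T b' that] by (simp add: shifted_type_def)
          then have "real (shifted_type (D b) T a) = real (T a) + of_int (D b a)"
            using arg_cong[of _ _ real_of_int] by fastforce
          moreover have "\<bar>real_of_int (D b a)\<bar> \<le> \<epsilon> * \<nu>" using DK[OF b' that] K\<nu> by linarith
          ultimately show "\<bar>real (shifted_type (D b) T a) - \<nu>\<bar> \<le> 2 * \<epsilon> * \<nu>" using Ta[OF that] by linarith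
        qed
      qed
      then have 1: "r ^ (K * card ?C) * N T \<le> P * N' b T"
        using n P by (simp add: \<nu>_def n_def field_simps)
      have "(\<Prod>i<d. r ^ e * real (matching_count p ?C T i)) \<le> w' b T"
        unfolding w'_def
      proof (intro prod_mono conjI)
        fix i assume "i \<in> {..<d}"
        then have i: "i < d" by simp
        have d2: "d \<ge> 2" using d by simp
        show "0 \<le> r ^ e * real (matching_count p ?C T i)" using r by simp
        show "r ^ e * real (matching_count p ?C T i) \<le> real (matching_count p (all_columns p d) (T'' b T) i)"
          unfolding T''_def e_def r_def
          by (rule shifted_matching_count[OF p0 d2 i b' D(1)[OF b'] D(2)[OF b'] shifted_nonneg[OF T b'] \<epsilon>(1,2) \<nu> Ta K1[OF b'] K\<nu>])
      qed
      then have 2: "r ^ (d * e) * w T \<le> w' b T"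
        by (simp add: w_def prod.distrib mult.commute flip: power_mult)
      have w0: "w T \<ge> 0" unfolding w_def by (intro prod_nonneg) auto
      have "(1 - \<delta>) * (N T * w T) \<le> r ^ m0 * (N T * w T)"
        using rm0 w0 by (intro mult_right_mono mult_nonneg_nonneg) (auto simp: N_def)
      also have "\<dots> = (r ^ (K * card ?C) * N T) * (r ^ (d * e) * w T)" by (simp add: m0_def power_add)
      also have "\<dots> \<le> (P * N' b T) * w' b T"
        by (rule mult_mono[OF 1 2]) (use w0 r P in \<open>simp_all add: N'_def\<close>)
      finally show ?thesis by (simp add: mult.assoc)
    qed
    have cardB: "real (card (columns_of_sum p d g)) = P"
      using card_columns[of d g p] d g p0 by (simp add: P_def residues_def)
    have finG: "finite G"
    proof -
      have "finite (PiE ?C (\<lambda>_. {..n}))" by (intro finite_PiE) auto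
      then show ?thesis by (rule finite_subset[rotated]) (auto simp: G_def)
    qed
    have lower: "(1 - \<delta>) * (\<Sum>T\<in>G. N T * w T) \<le> (\<Sum>b\<in>columns_of_sum p d g. \<Sum>T\<in>G. N' b T * w' b T)"
    proof -
      have "P * ((1 - \<delta>) * (\<Sum>T\<in>G. N T * w T)) = (\<Sum>b\<in>columns_of_sum p d g. \<Sum>T\<in>G. (1 - \<delta>) * (N T * w T))"
        using cardB by (simp add: sum_distrib_left)
      also have "\<dots> \<le> (\<Sum>b\<in>columns_of_sum p d g. \<Sum>T\<in>G. P * (N' b T * w' b T))"
        by (intro sum_mono pointwise)
      also have "\<dots> = P * (\<Sum>b\<in>columns_of_sum p d g. \<Sum>T\<in>G. N' b T * w' b T)" by (simp add: sum_distrib_left)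
      finally show ?thesis using P by (simp only: mult_le_cancel_left_pos)
    qed
    have upper1: "real (card (solution_pairs p d V (\<lambda>_. 0)
          (\<lambda>M x. near_uniform p d \<epsilon> V (column_array d V M x)))) \<le> (\<Sum>T\<in>G. N T * w T)"
    proof -
      define S where "S = {c \<in> PiE V (\<lambda>_. ?C). near_uniform p d \<epsilon> V c}"
      let ?g = "\<lambda>c. restrict (type_count V c) ?C"
      have "finite (PiE V (\<lambda>_. ?C))" using V(1) by (intro finite_PiE) auto
      then have finS: "finite S" by (rule finite_subset[rotated]) (auto simp: S_def)
      have gG: "?g ` S \<subseteq> G"
      proof (rule image_subsetI)
        fix c assume c: "c \<in> S"
        have "type_count V c a \<le> n" for a unfolding type_count_def n_def using V(1) by (intro card_mono) auto
        then have "?g c \<in> PiE ?C (\<lambda>_. {..n})" by (simp add: restrict_PiE_iff)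
        moreover have "(\<Sum>a\<in>?C. ?g c a) = n"
          using sum_type_count[OF V(1) finite_columns, of c p d 0] c by (simp add: S_def n_def)
        moreover have "\<bar>real (?g c a) - \<nu>\<bar> \<le> \<epsilon> * \<nu>" if "a \<in> ?C" for a
          using c that by (simp add: S_def near_uniform_def \<nu>_def n_def P_def)
        ultimately show "?g c \<in> G" by (simp add: G_def)
      qed
      have "card (solution_pairs p d V (\<lambda>_. 0)
          (\<lambda>M x. near_uniform p d \<epsilon> V (column_array d V M x))) =
          (\<Sum>c\<in>S. \<Prod>i<d. card (compatible_matchings V (\<lambda>j. fst (c j)) (\<lambda>j. snd (c j) i)))"
        unfolding S_def by (rule card_solutions_by_arrays[OF V(1)]) simp
      then have "real (card (solution_pairs p d V (\<lambda>_. 0)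
          (\<lambda>M x. near_uniform p d \<epsilon> V (column_array d V M x)))) =
          (\<Sum>c\<in>S. \<Prod>i<d. real (card (compatible_matchings V (\<lambda>j. fst (c j)) (\<lambda>j. snd (c j) i))))" by simp
      also have "\<dots> = (\<Sum>c\<in>S. w (type_count V c))"
        unfolding w_def using card_compatible_matchings_array[OF V(1) sub]
        by (intro sum.cong prod.cong refl) (auto simp: S_def)
      also have "\<dots> = (\<Sum>c\<in>S. w (?g c))"
      proof (rule sum.cong[OF refl])
        fix c
        show "w (type_count V c) = w (?g c)"
          unfolding w_def by (intro prod.cong refl arg_cong[where f = real] matching_count_cong) simp
      qed
      also have "\<dots> = (\<Sum>T\<in>G. \<Sum>c\<in>{c\<in>S. ?g c = T}. w (?g c))"
        by (rule sum.group[symmetric, OF finS finG gG])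
      also have "\<dots> = (\<Sum>T\<in>G. real (card {c\<in>S. ?g c = T}) * w T)"
        by (intro sum.cong refl) simp
      also have "\<dots> \<le> (\<Sum>T\<in>G. N T * w T)"
        unfolding N_def
      proof (intro sum_mono mult_right_mono of_nat_mono card_mono)
        fix T
        show "finite (arrays_of_type V ?C T)" by (rule finite_arrays_of_type[OF V(1) finite_columns])
        show "{c\<in>S. ?g c = T} \<subseteq> arrays_of_type V ?C T"
        proof
          fix c assume c: "c \<in> {c\<in>S. ?g c = T}"
          then have "type_count V c a = T a" if "a \<in> ?C" for a using that by (auto dest: fun_cong[of _ _ a])
          then show "c \<in> arrays_of_type V ?C T" using c by (simp add: arrays_of_type_def S_def)
        qed
        show "w T \<ge> 0" unfolding w_def by (intro prod_nonneg) auto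
      qed
      finally show ?thesis .
    qed
    have lower1: "(\<Sum>b\<in>columns_of_sum p d g. \<Sum>T\<in>G. N' b T * w' b T) \<le>
      real (card (solution_pairs p d V (\<lambda>j. if j = v then g else 0) (\<lambda>M x. True)))"
    proof -
      define S where "S = PiE V (\<lambda>j. columns_of_sum p d (if j = v then g else 0))"
      define W where "W = (\<lambda>c. \<Prod>i<d. real (matching_count p (all_columns p d) (type_count V c) i))"
      \<comment> \<open>Recovers the column \<open>b\<close> at \<open>v\<close> and the type \<open>T\<close> from an array.\<close>
      define h where "h = (\<lambda>c. (c v, \<lambda>a\<in>?C. nat (int (type_count (V - {v}) c a) - D (c v) a)))"
      define BG where "BG = columns_of_sum p d g \<times> G"
      have finS: "finite S" unfolding S_def using V(1) by (intro finite_PiE) auto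
      have W0: "W c \<ge> 0" for c unfolding W_def by (intro prod_nonneg) auto
      have Sall: "S \<subseteq> PiE V (\<lambda>_. all_columns p d)"
        unfolding S_def using sub by (intro PiE_mono) auto
      have "card (solution_pairs p d V (\<lambda>j. if j = v then g else 0) (\<lambda>M x. True)) =
          (\<Sum>c\<in>{c\<in>S. True}. \<Prod>i<d. card (compatible_matchings V (\<lambda>j. fst (c j)) (\<lambda>j. snd (c j) i)))"
        unfolding S_def by (rule card_solutions_by_arrays[OF V(1)]) simp
      then have eq: "real (card (solution_pairs p d V (\<lambda>j. if j = v then g else 0) (\<lambda>M x. True))) =
          (\<Sum>c\<in>S. \<Prod>i<d. real (card (compatible_matchings V (\<lambda>j. fst (c j)) (\<lambda>j. snd (c j) i))))" by simp
      also have "\<dots> = (\<Sum>c\<in>S. W c)"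
        unfolding W_def using card_compatible_matchings_array[OF V(1) order_refl] Sall
        by (intro sum.cong prod.cong refl) auto
      finally have total: "real (card (solution_pairs p d V (\<lambda>j. if j = v then g else 0) (\<lambda>M x. True)))
          = (\<Sum>c\<in>S. W c)" .
      have fiber: "N' b T * w' b T \<le> (\<Sum>c\<in>{c \<in> {c\<in>S. h c \<in> BG}. h c = (b, T)}. W c)"
        if b: "b \<in> columns_of_sum p d g" and T: "T \<in> G" for b T
      proof -
        let ?A = "arrays_of_type (V - {v}) ?C (shifted_type (D b) T)"
        let ?f = "\<lambda>c. c(v := b)"
        have b': "b \<in> all_columns p d" using b sub by blast
        have inj: "inj_on ?f ?A"
        proof (rule inj_onI, rule ext)
          fix c c' j assume c: "c \<in> ?A" "c' \<in> ?A" and e: "c(v := b) = c'(v := b)"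
          show "c j = c' j"
          proof (cases "j = v")
            case True
            have "c \<in> PiE (V - {v}) (\<lambda>_. ?C)" "c' \<in> PiE (V - {v}) (\<lambda>_. ?C)" using c by (auto simp: arrays_of_type_def)
            then show ?thesis using True PiE_arb[of c "V - {v}" _ j] PiE_arb[of c' "V - {v}" _ j] by simp
          next
            case False
            then show ?thesis using fun_cong[OF e, of j] by simp
          qed
        qed
        have props: "?f c \<in> S" "h (?f c) = (b, T)" "W (?f c) = w' b T" if c: "c \<in> ?A" for c
        proof -
          have cP: "c \<in> PiE (V - {v}) (\<lambda>_. ?C)" using c by (simp add: arrays_of_type_def)
          show "?f c \<in> S" unfolding S_def
          proof (rule PiE_I)
            show "?f c j \<in> columns_of_sum p d (if j = v then g else 0)" if "j \<in> V" for j
              using PiE_mem[OF cP, of j] b that by (cases "j = v") simp_all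
            show "?f c j = undefined" if "j \<notin> V" for j
              using PiE_arb[OF cP, of j] V(3) that by (cases "j = v") simp_all
          qed
          have tc: "type_count (V - {v}) (?f c) a = type_count (V - {v}) c a" for a
            unfolding type_count_def by (rule arg_cong[where f = card]) auto
          have tcC: "type_count (V - {v}) (?f c) a = shifted_type (D b) T a" if "a \<in> ?C" for a
            unfolding tc using c that by (simp add: arrays_of_type_def)
          have tcN: "type_count (V - {v}) (?f c) a = 0" if "a \<notin> ?C" for a
            unfolding tc type_count_def using that PiE_mem[OF cP] by (auto simp: card_eq_0_iff)
          have "(\<lambda>a\<in>?C. nat (int (type_count (V - {v}) (?f c) a) - D b a)) = T"
          proof
            fix a
            have TP: "T \<in> PiE ?C (\<lambda>_. {..n})" using T by (simp add: G_def)
            show "(\<lambda>a\<in>?C. nat (int (type_count (V - {v}) (?f c) a) - D b a)) a = T a"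
              using PiE_arb[OF TP, of a] shifted_nonneg[OF T b', of a] tcC[of a]
              by (cases "a \<in> ?C") (simp_all add: shifted_type_def)
          qed
          then show "h (?f c) = (b, T)" by (simp add: h_def)
          have "type_count V (?f c) a = T'' b T a" for a
          proof -
            have "type_count (insert v (V - {v})) (?f c) a = of_bool (?f c v = a) + type_count (V - {v}) (?f c) a"
              using V(1) by (intro type_count_insert) auto
            then show ?thesis using V(3) tcC[of a] tcN[of a] by (auto simp: T''_def insert_absorb)
          qed
          then show "W (?f c) = w' b T" unfolding W_def w'_def by (intro prod.cong refl arg_cong[where f = real] matching_count_cong)
        qed
        have "N' b T * w' b T = (\<Sum>c\<in>?f ` ?A. W c)"
          using props(3) by (simp add: sum.reindex[OF inj] N'_def)
        also have "\<dots> \<le> (\<Sum>c\<in>{c \<in> {c\<in>S. h c \<in> BG}. h c = (b, T)}. W c)"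
          using finS props(1,2) W0 b T by (intro sum_mono2) (auto simp: BG_def)
        finally show ?thesis .
      qed
      have "(\<Sum>b\<in>columns_of_sum p d g. \<Sum>T\<in>G. N' b T * w' b T) = (\<Sum>z\<in>BG. N' (fst z) (snd z) * w' (fst z) (snd z))"
        by (simp add: BG_def sum.cartesian_product case_prod_beta')
      also have "\<dots> \<le> (\<Sum>z\<in>BG. \<Sum>c\<in>{c \<in> {c\<in>S. h c \<in> BG}. h c = z}. W c)"
      proof (rule sum_mono)
        fix z assume "z \<in> BG"
        then show "N' (fst z) (snd z) * w' (fst z) (snd z) \<le> (\<Sum>c\<in>{c \<in> {c\<in>S. h c \<in> BG}. h c = z}. W c)"
          using fiber[of "fst z" "snd z"] by (simp add: BG_def mem_Times_iff)
      qed
      also have "\<dots> = (\<Sum>c\<in>{c\<in>S. h c \<in> BG}. W c)"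
        using finS finG by (intro sum.group) (auto simp: BG_def)
      also have "\<dots> \<le> (\<Sum>c\<in>S. W c)" using finS W0 by (intro sum_mono2) auto
      finally show ?thesis unfolding total .
    qed
    show "(1 - \<delta>) * real (card (solution_pairs p d V (\<lambda>_. 0)
          (\<lambda>M x. near_uniform p d \<epsilon> V (column_array d V M x))))
      \<le> real (card (solution_pairs p d V (\<lambda>j. if j = v then g else 0) (\<lambda>M x. True)))"
    proof (cases "\<delta> \<le> 1")
      case True
      then have "(1 - \<delta>) * real (card (solution_pairs p d V (\<lambda>_. 0)
          (\<lambda>M x. near_uniform p d \<epsilon> V (column_array d V M x)))) \<le> (1 - \<delta>) * (\<Sum>T\<in>G. N T * w T)"
        by (intro mult_left_mono upper1) simp
      also note lower
      also note lower1
      finally show ?thesis .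
    next
      case False
      then have "(1 - \<delta>) * real (card (solution_pairs p d V (\<lambda>_. 0)
          (\<lambda>M x. near_uniform p d \<epsilon> V (column_array d V M x)))) \<le> 0" by (intro mult_nonpos_nonneg) auto
      then show ?thesis by (rule order_trans) simp
    qed
  qed
qed

section \<open>Sparse kernel vectors\<close>

text \<open>
  For \<open>j = h\<close> this compares the matchings of \<open>2 * h + 2 * m\<close> points that preserve a subset of \<open>2 * h\<close> points
  with all matchings. Each of the factors \<open>(2 * j + 1) / (2 * j + 2 * m + 1)\<close> of the quotient is at most
  \<open>2 * h / (2 * h + 2 * m)\<close>.
\<close>

lemma odd_fact_split_bound:
  assumes "j \<le> h"
  shows "odd_fact (2 * j) * odd_fact (2 * m) * (2 * h + 2 * m) ^ j \<le> odd_fact (2 * j + 2 * m) * (2 * h) ^ j"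
  using assms
proof (induction j)
  case (Suc j)
  have le: "(2 * j + 1) * (2 * h + 2 * m) \<le> (2 * j + 2 * m + 1) * (2 * h)"
  proof -
    have "m * (2 * j + 1) \<le> m * (2 * h)" using Suc.prems by (intro mult_left_mono) auto
    then show ?thesis by (simp add: algebra_simps)
  qed
  have o1: "odd_fact (2 * Suc j) = (2 * j + 1) * odd_fact (2 * j)" by simp
  have o2: "odd_fact (2 * Suc j + 2 * m) = (2 * j + 2 * m + 1) * odd_fact (2 * j + 2 * m)" by simp
  have "odd_fact (2 * Suc j) * odd_fact (2 * m) * (2 * h + 2 * m) ^ Suc j =
      ((2 * j + 1) * (2 * h + 2 * m)) * (odd_fact (2 * j) * odd_fact (2 * m) * (2 * h + 2 * m) ^ j)"
    unfolding o1 power_Suc by (simp only: mult_ac)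
  also have "\<dots> \<le> ((2 * j + 2 * m + 1) * (2 * h)) * (odd_fact (2 * j + 2 * m) * (2 * h) ^ j)"
    by (rule mult_le_mono[OF le Suc.IH[OF Suc_leD[OF Suc.prems]]])
  also have "\<dots> = odd_fact (2 * Suc j + 2 * m) * (2 * h) ^ Suc j"
    unfolding o2 power_Suc by (simp only: mult_ac)
  finally show ?case .
qed simp

definition preserving :: "'v set \<Rightarrow> 'v set \<Rightarrow> ('v \<Rightarrow> 'v) set" where
  "preserving V A = {\<sigma> \<in> fpf_involutions V. \<sigma> ` A \<subseteq> A}"

lemma card_preserving_le:
  assumes V: "finite V" and A: "A \<subseteq> V"
  shows "card (preserving V A) \<le> odd_fact (card A) * odd_fact (card V - card A)"
proof -
  let ?f = "\<lambda>\<sigma>. (\<lambda>j. if j \<in> A then \<sigma> j else j, \<lambda>j. if j \<in> V - A then \<sigma> j else j)"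
  have inj: "inj_on ?f (preserving V A)"
  proof (rule inj_onI, rule ext)
    fix \<sigma> \<tau> j assume s: "\<sigma> \<in> preserving V A" "\<tau> \<in> preserving V A" and e: "?f \<sigma> = ?f \<tau>"
    have e1: "(\<lambda>j. if j \<in> A then \<sigma> j else j) = (\<lambda>j. if j \<in> A then \<tau> j else j)"
      and e2: "(\<lambda>j. if j \<in> V - A then \<sigma> j else j) = (\<lambda>j. if j \<in> V - A then \<tau> j else j)"
      using e by (simp_all only: prod.inject)
    have sf: "\<sigma> \<in> fpf_involutions V" "\<tau> \<in> fpf_involutions V" using s by (simp_all add: preserving_def)
    have o: "\<sigma> j = j" "\<tau> j = j" if "j \<notin> V"
      using fpf_involutionsD(4)[OF sf(1) that] fpf_involutionsD(4)[OF sf(2) that] by simp_all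
    show "\<sigma> j = \<tau> j"
    proof (cases "j \<in> V")
      case True
      then show ?thesis using fun_cong[OF e1, of j] fun_cong[OF e2, of j] by (cases "j \<in> A") simp_all
    next
      case False
      then show ?thesis using o by simp
    qed
  qed
  have sub: "?f ` preserving V A \<subseteq> fpf_involutions A \<times> fpf_involutions (V - A)"
  proof (rule image_subsetI)
    fix \<sigma> assume s: "\<sigma> \<in> preserving V A"
    then have "\<sigma> ` A \<subseteq> A" by (simp add: preserving_def)
    then have sA: "\<sigma> j \<in> A" if "j \<in> A" for j using that by blast
    have sV: "\<sigma> j \<in> V - A" if "j \<in> V - A" for j
    proof -
      have "\<sigma> j \<notin> A" using sA[of "\<sigma> j"] fpf_involutionsD(1)[of \<sigma> V j] s that unfolding preserving_def by auto
      then show ?thesis using fpf_involutionsD(2)[of \<sigma> V j] s that unfolding preserving_def by auto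
    qed
    have sf: "\<sigma> \<in> fpf_involutions V" using s by (simp add: preserving_def)
    have "(\<lambda>j. if j \<in> A then \<sigma> j else j) \<in> fpf_involutions A"
      by (rule fpf_involutionsI) (use sA fpf_involutionsD(1,3)[OF sf] A in auto)
    moreover have "(\<lambda>j. if j \<in> V - A then \<sigma> j else j) \<in> fpf_involutions (V - A)"
    proof (rule fpf_involutionsI)
      fix j
      show "(if (if j \<in> V - A then \<sigma> j else j) \<in> V - A then \<sigma> (if j \<in> V - A then \<sigma> j else j)
          else (if j \<in> V - A then \<sigma> j else j)) = j"
        using sV[of j] fpf_involutionsD(1)[OF sf, of j] by (cases "j \<in> V - A") (simp_all only: if_True if_False)
      show "(if j \<in> V - A then \<sigma> j else j) \<noteq> j" if "j \<in> V - A" using that fpf_involutionsD(3)[OF sf, of j] by simp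
      show "(if j \<in> V - A then \<sigma> j else j) = j" if "j \<notin> V - A" using that by (simp only: if_False)
    qed
    ultimately show "?f \<sigma> \<in> fpf_involutions A \<times> fpf_involutions (V - A)" by (rule SigmaI)
  qed
  have finA: "finite A" using V A by (rule finite_subset[rotated])
  have "card (preserving V A) = card (?f ` preserving V A)" by (simp only: card_image[OF inj])
  also have "\<dots> \<le> card (fpf_involutions A \<times> fpf_involutions (V - A))"
    by (rule card_mono[OF _ sub]) (simp add: finite_fpf_involutions V finA)
  also have "\<dots> = odd_fact (card A) * odd_fact (card V - card A)"
    using V A finA by (simp add: card_cartesian_product card_fpf_involutions card_Diff_subset)
  finally show ?thesis .
qed

lemma odd_fact_odd: "odd k \<Longrightarrow> odd_fact k = 0"
  by (induction k rule: odd_fact.induct) auto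

text \<open>
  A random matching preserves a set of \<open>a\<close> out of \<open>n\<close> points with probability at most \<open>(a / n) ^ (a / 2)\<close>.
  The square root allows the exponent to be written as the natural number \<open>card A\<close>.
\<close>

lemma card_preserving_bound:
  assumes V: "finite V" "even (card V)" "card V > 0" and A: "A \<subseteq> V" "card A \<le> 2 * k"
  shows "real (card (preserving V A)) \<le> odd_fact (card V) * sqrt (2 * real k / real (card V)) ^ card A"
proof (cases "even (card A)")
  case True
  then obtain h where h: "card A = 2 * h" by (rule evenE)
  have le: "card A \<le> card V" using V(1) A(1) by (rule card_mono)
  obtain m where m: "card V = 2 * h + 2 * m"
  proof -
    have "even (card V - card A)" using V(2) True by simp
    then obtain m where "card V - card A = 2 * m" by (rule evenE)
    then show ?thesis using that[of m] h le by simp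
  qed
  have n0: "real (card V) > 0" using V(3) by simp
  have "real (card (preserving V A)) \<le> real (odd_fact (2 * h) * odd_fact (2 * m))"
    using card_preserving_le[OF V(1) A(1)] unfolding h m by (simp del: of_nat_mult)
  also have "\<dots> = real (odd_fact (2 * h) * odd_fact (2 * m) * (2 * h + 2 * m) ^ h) / real (card V) ^ h"
    using n0 unfolding m by simp
  also have "\<dots> \<le> real (odd_fact (2 * h + 2 * m) * (2 * h) ^ h) / real (card V) ^ h"
    using odd_fact_split_bound[of h h m] by (intro divide_right_mono) (simp_all only: of_nat_le_iff order_refl zero_le_power of_nat_0_le_iff)
  also have "\<dots> = odd_fact (card V) * (real (2 * h) / real (card V)) ^ h"
    unfolding m by (simp add: power_divide)
  also have "\<dots> \<le> odd_fact (card V) * (2 * real k / real (card V)) ^ h"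
    using A(2) h n0 by (intro mult_left_mono power_mono divide_right_mono) auto
  also have "2 * real k / real (card V) = sqrt (2 * real k / real (card V)) ^ 2" by simp
  also have "(sqrt (2 * real k / real (card V)) ^ 2) ^ h = sqrt (2 * real k / real (card V)) ^ card A"
    by (simp only: power_mult[symmetric] h)
  finally show ?thesis .
next
  case False
  then have "card (preserving V A) = 0" using card_preserving_le[OF V(1) A(1)] odd_fact_odd by simp
  then show ?thesis by simp
qed

lemma binomial_bound:
  assumes "0 < k" "k \<le> b"
  shows "real (n choose b) \<le> (exp 1 * real n / real k) ^ b"
proof -
  have b: "b > 0" using assms by simp
  have "real b * ln (real b) - real b \<le> ln (fact b)" using ln_fact_lower[of b] by (simp add: xlnx_def)
  then have "exp (real b * ln (real b) - real b) \<le> fact b"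
    by (metis exp_le_cancel_iff exp_ln fact_gt_zero)
  also have "exp (real b * ln (real b) - real b) = (real b / exp 1) ^ b"
    using b by (simp add: exp_diff exp_of_nat_mult power_divide flip: exp_of_nat_mult[of b 1])
  finally have fb: "(real b / exp 1) ^ b \<le> fact b" .
  have "real (n choose b) * (real b / exp 1) ^ b \<le> real (n choose b) * fact b"
    by (intro mult_left_mono fb) simp
  also have "\<dots> = real ((n choose b) * fact b)" by simp
  also have "\<dots> \<le> real (n ^ b)" by (simp only: of_nat_le_iff binomial_fact_pow)
  finally have "real (n choose b) \<le> real n ^ b / (real b / exp 1) ^ b"
    using b by (simp add: pos_le_divide_eq)
  also have "\<dots> = (exp 1 * real n / real b) ^ b" by (simp add: power_divide power_mult_distrib)
  also have "\<dots> \<le> (exp 1 * real n / real k) ^ b"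
    using assms by (intro power_mono divide_left_mono) auto
  finally show ?thesis .
qed

text \<open>
  No vertex has exactly one edge into \<open>S\<close>. The support of a kernel vector has this property, because a single nonzero
  summand cannot cancel.
\<close>

definition unpaired_free :: "nat \<Rightarrow> 'v set \<Rightarrow> 'v set \<Rightarrow> (nat \<Rightarrow> 'v \<Rightarrow> 'v) \<Rightarrow> bool" where
  "unpaired_free d V S M \<longleftrightarrow> (\<forall>j\<in>V. card {i\<in>{..<d}. M i j \<in> S} \<noteq> 1)"

text \<open>
  The combinatorial traces of a set \<open>S\<close> without singly attached vertices: \<open>A i\<close> is the union of \<open>S\<close> and its neighbours
  along the \<open>i\<close>-th matching. The last condition is what remains of the fact that every
  vertex outside \<open>S\<close> that is covered at all is covered at least twice.
\<close>

definition covers :: "nat \<Rightarrow> 'v set \<Rightarrow> 'v set \<Rightarrow> (nat \<Rightarrow> 'v set) set" where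
  "covers d V S = {A \<in> PiE {..<d} (\<lambda>_. Pow V). (\<forall>i<d. card (A i) \<le> 2 * card S) \<and> S \<subseteq> (\<Union>i<d. A i) \<and>
     d * card S + 2 * card ((\<Union>i<d. A i) - S) \<le> (\<Sum>i<d. card (A i))}"

text \<open>
  Take \<open>A i = S \<union> M i ` S\<close>, which is preserved by the involution \<open>M i\<close>.
\<close>

lemma unpaired_free_cover:
  assumes V: "finite V" and S: "S \<subseteq> V" and d: "d > 0" and M: "M \<in> matching_tuples d V" and uf: "unpaired_free d V S M"
  shows "\<exists>A\<in>covers d V S. M \<in> PiE {..<d} (\<lambda>i. preserving V (A i))"
proof -
  define A where "A = (\<lambda>i\<in>{..<d}. S \<union> M i ` S)"
  define B where "B = (\<Union>i<d. A i)"
  have finS: "finite S" using V S by (rule finite_subset[rotated])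
  have Mi: "M i \<in> fpf_involutions V" if "i < d" for i using M that by (auto simp: matching_tuples_def)
  have AV: "A i \<subseteq> V" if "i < d" for i
    using that S fpf_involutionsD(2)[OF Mi[OF that]] by (auto simp: A_def)
  have finA: "finite (A i)" if "i < d" for i using AV[OF that] V by (rule finite_subset)
  have SA: "S \<subseteq> A i" if "i < d" for i using that by (simp add: A_def)
  have memA: "j \<in> A i \<longleftrightarrow> j \<in> S \<or> M i j \<in> S" if "i < d" for i j
  proof -
    have "j \<in> M i ` S \<longleftrightarrow> M i j \<in> S" using fpf_involutionsD(1)[OF Mi[OF that]] by (metis imageE imageI)
    then show ?thesis using that by (simp add: A_def)
  qed
  have BV: "B \<subseteq> V" using AV by (auto simp: B_def)
  have finB: "finite B" using BV V by (rule finite_subset)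
  have pres: "M i \<in> preserving V (A i)" if "i < d" for i
    unfolding preserving_def using Mi[OF that] memA[OF that] fpf_involutionsD(1)[OF Mi[OF that]] by auto
  have cA: "card (A i) \<le> 2 * card S" if "i < d" for i
  proof -
    have "card (A i) \<le> card S + card (M i ` S)" using that by (simp add: A_def card_Un_le)
    also have "\<dots> \<le> card S + card S" by (intro add_mono card_image_le finS) simp
    finally show ?thesis by simp
  qed
  have SB: "S \<subseteq> B" using SA d by (auto simp: B_def)
  have two: "2 \<le> card {i\<in>{..<d}. j \<in> A i}" if j: "j \<in> B - S" for j
  proof -
    obtain i where i: "i < d" "j \<in> A i" using j by (auto simp: B_def)
    have eq: "{i\<in>{..<d}. j \<in> A i} = {i\<in>{..<d}. M i j \<in> S}" using memA j by auto
    have "i \<in> {i\<in>{..<d}. M i j \<in> S}" using i memA[OF i(1)] j by auto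
    then have "card {i\<in>{..<d}. M i j \<in> S} \<noteq> 0" by (auto simp: card_eq_0_iff)
    moreover have "card {i\<in>{..<d}. M i j \<in> S} \<noteq> 1" using uf j BV unfolding unpaired_free_def by blast
    ultimately show ?thesis unfolding eq by linarith
  qed
  have "(\<Sum>i<d. card (A i)) = (\<Sum>i<d. card S + (\<Sum>j\<in>B - S. of_bool (j \<in> A i)))"
  proof (rule sum.cong[OF refl])
    fix i assume "i \<in> {..<d}"
    then have i: "i < d" by simp
    have "(\<Sum>j\<in>B - S. of_bool (j \<in> A i)) = card {j\<in>B - S. j \<in> A i}"
      using finB by (simp add: sum.inter_filter[symmetric] of_bool_def)
    also have "{j\<in>B - S. j \<in> A i} = A i - S" using i by (auto simp: B_def)
    also have "card (A i - S) = card (A i) - card S" by (rule card_Diff_subset[OF finS SA[OF i]])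
    finally show "card (A i) = card S + (\<Sum>j\<in>B - S. of_bool (j \<in> A i))"
      using card_mono[OF finA[OF i] SA[OF i]] by simp
  qed
  also have "\<dots> = d * card S + (\<Sum>i<d. \<Sum>j\<in>B - S. of_bool (j \<in> A i))" by (simp add: sum.distrib)
  also have "(\<Sum>i<d. \<Sum>j\<in>B - S. of_bool (j \<in> A i)) = (\<Sum>j\<in>B - S. \<Sum>i<d. of_bool (j \<in> A i))" by (rule sum.swap)
  also have "\<dots> = (\<Sum>j\<in>B - S. card {i\<in>{..<d}. j \<in> A i})"
    by (intro sum.cong refl) (simp add: sum.inter_filter[symmetric] of_bool_def)
  finally have "(\<Sum>i<d. card (A i)) = d * card S + (\<Sum>j\<in>B - S. card {i\<in>{..<d}. j \<in> A i})" .
  moreover have "(\<Sum>j\<in>B - S. 2) \<le> (\<Sum>j\<in>B - S. card {i\<in>{..<d}. j \<in> A i})" by (intro sum_mono two)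
  ultimately have "d * card S + 2 * card (B - S) \<le> (\<Sum>i<d. card (A i))" by simp
  moreover have "A \<in> PiE {..<d} (\<lambda>_. Pow V)" using AV by (simp add: PiE_iff) (simp add: A_def)
  ultimately have "A \<in> covers d V S" using cA SB by (simp add: covers_def B_def)
  moreover have "M \<in> PiE {..<d} (\<lambda>i. preserving V (A i))"
  proof (rule PiE_I)
    show "M i \<in> preserving V (A i)" if "i \<in> {..<d}" for i using pres that by simp
    show "M i = undefined" if "i \<notin> {..<d}" for i using M that by (auto simp: matching_tuples_def PiE_iff extensional_def)
  qed
  ultimately show ?thesis by blast
qed


definition support :: "'v set \<Rightarrow> ('v \<Rightarrow> int) \<Rightarrow> 'v set" where
  "support V x = {j\<in>V. x j \<noteq> 0}"

lemma solution_unpaired_free: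
  assumes M: "M \<in> matching_tuples d V" and x: "x \<in> solutions p d V M (\<lambda>_. 0)"
  shows "unpaired_free d V (support V x) M"
  unfolding unpaired_free_def
proof (intro ballI notI)
  fix j assume j: "j \<in> V" and "card {i\<in>{..<d}. M i j \<in> support V x} = 1"
  then obtain i where i: "{i\<in>{..<d}. M i j \<in> support V x} = {i}" by (auto simp: card_1_singleton_iff)
  then have id: "i < d" and iS: "M i j \<in> support V x" by auto
  have "x (M l j) = 0" if "l \<in> {..<d} - {i}" for l
    using i that matching_tuples_in[OF M _ j, of l] by (auto simp: support_def)
  then have "(\<Sum>l<d. x (M l j)) = x (M i j)"
    using id by (subst sum.remove[of _ i]) auto
  moreover have "(\<Sum>l<d. x (M l j)) mod p = 0" using x j by (simp add: solutions_def neighbour_sum_def)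
  moreover have "x (M i j) \<in> residues p" "x (M i j) \<noteq> 0" using iS x by (auto simp: support_def solutions_def)
  ultimately show False by (simp add: residues_def)
qed

lemma card_with_support_le:
  assumes "finite V" "S \<subseteq> V"
  shows "card {x \<in> PiE V (\<lambda>_. residues p). support V x = S} \<le> card (residues p) ^ card S"
proof -
  have finS: "finite S" using assms by (rule finite_subset[rotated])
  have inj: "inj_on (\<lambda>x. restrict x S) {x \<in> PiE V (\<lambda>_. residues p). support V x = S}"
  proof (rule inj_onI, rule ext)
    fix x y j assume x: "x \<in> {x \<in> PiE V (\<lambda>_. residues p). support V x = S}"
      and y: "y \<in> {x \<in> PiE V (\<lambda>_. residues p). support V x = S}" and e: "restrict x S = restrict y S"
    have xP: "x \<in> PiE V (\<lambda>_. residues p)" and yP: "y \<in> PiE V (\<lambda>_. residues p)" using x y by auto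
    show "x j = y j"
    proof (cases "j \<in> S")
      case True
      then show ?thesis using fun_cong[OF e, of j] by simp
    next
      case False
      then show ?thesis using x y PiE_arb[OF xP, of j] PiE_arb[OF yP, of j] by (cases "j \<in> V") (auto simp: support_def)
    qed
  qed
  have "(\<lambda>x. restrict x S) ` {x \<in> PiE V (\<lambda>_. residues p). support V x = S} \<subseteq> PiE S (\<lambda>_. residues p)"
  proof (rule image_subsetI)
    fix x assume "x \<in> {x \<in> PiE V (\<lambda>_. residues p). support V x = S}"
    then have "x \<in> PiE V (\<lambda>_. residues p)" by simp
    then show "restrict x S \<in> PiE S (\<lambda>_. residues p)"
      using assms(2) by (intro restrict_PiE_iff[THEN iffD2] ballI PiE_mem[of x V]) auto
  qed
  then have "card {x \<in> PiE V (\<lambda>_. residues p). support V x = S} \<le> card (PiE S (\<lambda>_. residues p))"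
    by (rule card_inj_on_le[OF inj]) (intro finite_PiE finS finite_residues)
  then show ?thesis using finS by (simp add: card_PiE)
qed

lemma finite_covers: "finite V \<Longrightarrow> finite (covers d V S)"
proof -
  assume "finite V"
  then have "finite (PiE {..<d} (\<lambda>_. Pow V))" by (intro finite_PiE) simp_all
  then show ?thesis by (rule finite_subset[rotated]) (auto simp: covers_def)
qed

lemma card_unpaired_free_le:
  assumes V: "finite V" "even (card V)" "card V > 0" and S: "S \<subseteq> V" and d: "d > 0" and k: "2 * card S \<le> card V"
  shows "real (card {M \<in> matching_tuples d V. unpaired_free d V S M}) \<le>
    (\<Sum>A\<in>covers d V S. odd_fact (card V) ^ d * sqrt (2 * real (card S) / real (card V)) ^ (d * card S + 2 * card ((\<Union>i<d. A i) - S)))"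
proof -
  define q where "q = sqrt (2 * real (card S) / real (card V))"
  have q: "0 \<le> q" "q \<le> 1" using k V(3) by (auto simp: q_def divide_le_eq_1)
  have finp: "finite (preserving V A)" for A
    unfolding preserving_def using V(1) by (simp add: finite_fpf_involutions)
  have "{M \<in> matching_tuples d V. unpaired_free d V S M} \<subseteq> (\<Union>A\<in>covers d V S. PiE {..<d} (\<lambda>i. preserving V (A i)))"
    using unpaired_free_cover[OF V(1) S d] by blast
  then have "card {M \<in> matching_tuples d V. unpaired_free d V S M} \<le> card (\<Union>A\<in>covers d V S. PiE {..<d} (\<lambda>i. preserving V (A i)))"
    by (rule card_mono[rotated]) (intro finite_UN_I finite_covers V(1) finite_PiE finp finite_lessThan)
  also have "\<dots> \<le> (\<Sum>A\<in>covers d V S. card (PiE {..<d} (\<lambda>i. preserving V (A i))))"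
    by (rule card_UN_le[OF finite_covers[OF V(1)]])
  finally have "real (card {M \<in> matching_tuples d V. unpaired_free d V S M}) \<le>
      real (\<Sum>A\<in>covers d V S. card (PiE {..<d} (\<lambda>i. preserving V (A i))))" by (simp only: of_nat_le_iff)
  also have "\<dots> = (\<Sum>A\<in>covers d V S. \<Prod>i<d. real (card (preserving V (A i))))" by (simp add: card_PiE)
  also have "\<dots> \<le> (\<Sum>A\<in>covers d V S. odd_fact (card V) ^ d * q ^ (d * card S + 2 * card ((\<Union>i<d. A i) - S)))"
  proof (rule sum_mono)
    fix A assume A: "A \<in> covers d V S"
    have "(\<Prod>i<d. real (card (preserving V (A i)))) \<le> (\<Prod>i<d. odd_fact (card V) * q ^ card (A i))"
    proof (intro prod_mono conjI)
      fix i assume "i \<in> {..<d}"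
      then have "A i \<subseteq> V" "card (A i) \<le> 2 * card S" using A by (auto simp: covers_def PiE_iff)
      then show "real (card (preserving V (A i))) \<le> odd_fact (card V) * q ^ card (A i)"
        unfolding q_def by (rule card_preserving_bound[OF V])
    qed simp
    also have "\<dots> = odd_fact (card V) ^ d * q ^ (\<Sum>i<d. card (A i))"
      by (simp add: prod.distrib power_sum)
    also have "\<dots> \<le> odd_fact (card V) ^ d * q ^ (d * card S + 2 * card ((\<Union>i<d. A i) - S))"
      using A q by (intro mult_left_mono power_decreasing) (auto simp: covers_def)
    finally show "(\<Prod>i<d. real (card (preserving V (A i)))) \<le> odd_fact (card V) ^ d * q ^ (d * card S + 2 * card ((\<Union>i<d. A i) - S))" .
  qed
  finally show ?thesis unfolding q_def .
qed

text \<open>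
  The sets \<open>S\<close> and \<open>A i\<close> are subsets of \<open>B = (\<Union>i<d. A i)\<close>, so there are at most \<open>2 ^ (b * (d + 1))\<close> of them once \<open>B\<close>, of
  size \<open>b\<close>, is chosen. The exponent of \<open>q\<close> equals \<open>(d - 2) * k + 2 * b\<close>. As \<open>q\<^sup>2 = 2 * k / n\<close>, the part \<open>q ^ (2 * b)\<close>
  balances the number of choices of \<open>B\<close>, and \<open>q ^ ((d - 2) * k) \<le> q ^ k\<close> remains. The size \<open>b\<close> is at most \<open>d * k\<close>
  because vertices outside \<open>S\<close> are covered twice.
\<close>

lemma sum_covers_le:
  assumes V: "finite V" "card V > 0" and d: "d \<ge> 3" and k: "0 < k" "2 * k \<le> card V"
  shows "(\<Sum>S\<in>{S. S \<subseteq> V \<and> card S = k}. \<Sum>A\<in>covers d V S.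
      sqrt (2 * real k / real (card V)) ^ (d * k + 2 * card ((\<Union>i<d. A i) - S))) \<le>
    real (d * k + 1) * ((exp 1 * 2 ^ (d + 2)) ^ (d * k) * sqrt (2 * real k / real (card V)) ^ k)"
proof -
  define n where "n = card V"
  define q where "q = sqrt (2 * real k / real n)"
  define E where "E = exp 1 * (2::real) ^ (d + 2)"
  have n: "n > 0" using V by (simp add: n_def)
  have q: "0 \<le> q" "q \<le> 1" using k n by (auto simp: q_def divide_le_eq_1 n_def)
  have q2: "q ^ 2 = 2 * real k / real n" by (simp add: q_def)
  have E: "E \<ge> 1"   proof -
    have "1 \<le> (2::real) ^ (d + 2)" by (rule one_le_power) simp
    moreover have "1 \<le> exp (1::real)" by simp
    ultimately show ?thesis unfolding E_def using mult_mono[of 1 "exp 1" 1 "2 ^ (d + 2) :: real"] by linarith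
  qed
  let ?Sk = "{S. S \<subseteq> V \<and> card S = k}"
  let ?U = "\<lambda>A. \<Union>i<d. A i"
  define Z where "Z = (SIGMA S:?Sk. covers d V S)"
  have finSk: "finite ?Sk" by (rule finite_subset[of _ "Pow V"]) (use V(1) in auto)
  have finZ: "finite Z" unfolding Z_def by (rule finite_SigmaI[OF finSk finite_covers[OF V(1)]])
  have UV: "?U A \<subseteq> V" if "A \<in> covers d V S" for A S using that by (auto simp: covers_def PiE_iff)
  have cardB: "card (?U A) = k + card (?U A - S)" "card (?U A) \<le> d * k" if z: "(S, A) \<in> Z" for S A
  proof -
    have A: "A \<in> covers d V S" and S: "S \<subseteq> V" "card S = k" using z by (auto simp: Z_def)
    have fin: "finite (?U A)" using UV[OF A] V(1) by (rule finite_subset)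
    have SU: "S \<subseteq> ?U A" using A by (simp add: covers_def)
    then have finS: "finite S" using fin by (rule finite_subset)
    have "card (?U A - S) = card (?U A) - card S" by (rule card_Diff_subset[OF finS SU])
    then show 1: "card (?U A) = k + card (?U A - S)" using card_mono[OF fin SU] S by simp
    have "d * card S + 2 * card (?U A - S) \<le> (\<Sum>i<d. card (A i))" using A by (simp add: covers_def)
    also have "\<dots> \<le> (\<Sum>i<d. 2 * card S)" using A by (intro sum_mono) (simp add: covers_def)
    finally have "2 * card (?U A - S) \<le> d * k" using S by simp
    moreover have "3 * k \<le> d * k" using d by (intro mult_right_mono) auto
    ultimately show "card (?U A) \<le> d * k" using 1 by linarith
  qed
  have "(\<Sum>S\<in>?Sk. \<Sum>A\<in>covers d V S. q ^ (d * k + 2 * card (?U A - S))) =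
      (\<Sum>z\<in>Z. q ^ (d * k + 2 * card (?U (snd z) - fst z)))"
    unfolding Z_def by (subst sum.Sigma[OF finSk]) (simp_all add: finite_covers V(1) case_prod_beta')
  also have "\<dots> = (\<Sum>b\<in>{..d * k}. \<Sum>z\<in>{z\<in>Z. card (?U (snd z)) = b}. q ^ (d * k + 2 * card (?U (snd z) - fst z)))"
    using finZ cardB(2) by (intro sum.group[symmetric]) auto
  also have "\<dots> \<le> (\<Sum>b\<in>{..d * k}. E ^ (d * k) * q ^ k)"
  proof (rule sum_mono)
    fix b assume b: "b \<in> {..d * k}"
    let ?Zb = "{z\<in>Z. card (?U (snd z)) = b}"
    show "(\<Sum>z\<in>?Zb. q ^ (d * k + 2 * card (?U (snd z) - fst z))) \<le> E ^ (d * k) * q ^ k"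
    proof (cases "k \<le> b")
      case False
      have "?Zb = {}"
      proof (rule ccontr)
        assume "?Zb \<noteq> {}"
        then obtain z where "z \<in> Z" "card (?U (snd z)) = b" by blast
        then show False using cardB(1)[of "fst z" "snd z"] False by simp
      qed
      moreover have "0 \<le> E ^ (d * k) * q ^ k" using E q by simp
      ultimately show ?thesis by (simp only: sum.empty)
    next
      case True
      have expo: "d * k + 2 * card (?U (snd z) - fst z) = (d - 2) * k + 2 * b" if "z \<in> ?Zb" for z
      proof -
        have "b = k + card (?U (snd z) - fst z)" using that cardB(1)[of "fst z" "snd z"] by simp
        moreover have "d * k = (d - 2) * k + 2 * k"
        proof -
          have "(d - 2) * k + 2 * k = ((d - 2) + 2) * k" by (simp only: add_mult_distrib)
          also have "(d - 2) + 2 = d" using d by simp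
          finally show ?thesis by simp
        qed
        ultimately show ?thesis by simp
      qed
      define X where "X = (SIGMA B:{B. B \<subseteq> V \<and> card B = b}. Pow B \<times> PiE {..<d} (\<lambda>_. Pow B))"
      have finX: "finite X" unfolding X_def
      proof (rule finite_SigmaI)
        show "finite {B. B \<subseteq> V \<and> card B = b}" by (rule finite_subset[of _ "Pow V"]) (use V(1) in auto)
        fix B assume "B \<in> {B. B \<subseteq> V \<and> card B = b}"
        then have "finite (Pow B)" using V(1) finite_subset by blast
        then show "finite (Pow B \<times> PiE {..<d} (\<lambda>_. Pow B))"
          by (intro finite_cartesian_product finite_PiE finite_lessThan)
      qed
      have "(\<lambda>z. (?U (snd z), z)) ` ?Zb \<subseteq> X"
      proof (rule image_subsetI)
        fix z assume z: "z \<in> ?Zb"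
        then have A: "snd z \<in> covers d V (fst z)" by (auto simp: Z_def)
        have "fst z \<subseteq> ?U (snd z)" using A by (simp add: covers_def)
        moreover have "snd z \<in> PiE {..<d} (\<lambda>_. Pow (?U (snd z)))" using A by (auto simp: covers_def PiE_iff)
        moreover have "?U (snd z) \<subseteq> V" by (rule UV[OF A])
        moreover have "card (?U (snd z)) = b" using z by simp
        ultimately show "(?U (snd z), z) \<in> X" unfolding X_def by (simp add: mem_Times_iff)
      qed
      then have "card ?Zb \<le> card X"
        by (rule card_inj_on_le[rotated, OF _ finX]) (rule inj_onI, simp)
      also have "card X = (\<Sum>B\<in>{B. B \<subseteq> V \<and> card B = b}. card (Pow B \<times> PiE {..<d} (\<lambda>_. Pow B)))"
        unfolding X_def
      proof (rule card_SigmaI)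
        show "finite {B. B \<subseteq> V \<and> card B = b}" by (rule finite_subset[of _ "Pow V"]) (use V(1) in auto)
        show "\<forall>B\<in>{B. B \<subseteq> V \<and> card B = b}. finite (Pow B \<times> PiE {..<d} (\<lambda>_. Pow B))"
        proof
          fix B assume "B \<in> {B. B \<subseteq> V \<and> card B = b}"
          then have "finite (Pow B)" using V(1) finite_subset by blast
          then show "finite (Pow B \<times> PiE {..<d} (\<lambda>_. Pow B))"
            by (intro finite_cartesian_product finite_PiE finite_lessThan)
        qed
      qed
      also have "\<dots> = (\<Sum>B\<in>{B. B \<subseteq> V \<and> card B = b}. 2 ^ b * (2 ^ b) ^ d)"
      proof (rule sum.cong[OF refl])
        fix B assume B: "B \<in> {B. B \<subseteq> V \<and> card B = b}"
        then have "finite B" using V(1) finite_subset by blast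
        then show "card (Pow B \<times> PiE {..<d} (\<lambda>_. Pow B)) = 2 ^ b * (2 ^ b) ^ d"
          using B by (simp add: card_cartesian_product card_Pow card_PiE)
      qed
      also have "\<dots> = (n choose b) * (2 ^ b * (2 ^ b) ^ d)"
        using n_subsets[OF V(1), of b] by (simp add: n_def)
      finally have cZ: "card ?Zb \<le> (n choose b) * (2 ^ b * (2 ^ b) ^ d)" .
      have "(\<Sum>z\<in>?Zb. q ^ (d * k + 2 * card (?U (snd z) - fst z))) = (\<Sum>z\<in>?Zb. q ^ ((d - 2) * k + 2 * b))"
        by (intro sum.cong refl) (simp only: expo)
      also have "\<dots> = real (card ?Zb) * q ^ ((d - 2) * k + 2 * b)" by simp
      also have "\<dots> \<le> real ((n choose b) * (2 ^ b * (2 ^ b) ^ d)) * q ^ ((d - 2) * k + 2 * b)"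
        using q by (intro mult_right_mono of_nat_mono cZ) simp
      also have "\<dots> = real (n choose b) * ((2 ^ (d + 1)) ^ b * q ^ ((d - 2) * k + 2 * b))"
        by (simp add: power_mult_distrib power_add mult.commute flip: power_mult)
      also have "\<dots> \<le> (exp 1 * real n / real k) ^ b * ((2 ^ (d + 1)) ^ b * q ^ ((d - 2) * k + 2 * b))"
        using q by (intro mult_right_mono binomial_bound k(1) True) simp
      also have "\<dots> = E ^ b * q ^ ((d - 2) * k)"
      proof -
        have e: "exp 1 * real n / real k * 2 ^ (d + 1) * q ^ 2 = E"
          using k n unfolding q2 E_def by (simp add: field_simps)
        have "q ^ ((d - 2) * k + 2 * b) = q ^ ((d - 2) * k) * (q ^ 2) ^ b" by (simp only: power_add power_mult)
        then show ?thesis unfolding e[symmetric] power_mult_distrib by (simp only: mult_ac)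
      qed
      also have "\<dots> \<le> E ^ (d * k) * q ^ k"
      proof (rule mult_mono[OF power_increasing[OF _ E] power_decreasing[OF _ q]])
        show "b \<le> d * k" using b by simp
        have "1 * k \<le> (d - 2) * k" by (rule mult_le_mono1) (use d in simp)
        then show "k \<le> (d - 2) * k" by simp
      qed (use E q in auto)
      finally show ?thesis .
    qed
  qed
  also have "\<dots> = real (d * k + 1) * (E ^ (d * k) * q ^ k)" by simp
  finally show ?thesis unfolding q_def E_def n_def .
qed


text \<open>
  Supports of size \<open>k\<close> contribute at most \<open>(d * k + 1) * (F * sqrt (2 * k / n)) ^ k\<close>. For \<open>k \<le> \<epsilon>0 * n\<close> the base is at most
  \<open>1 / 8\<close>, so the sum over \<open>k\<close> is dominated by a geometric series, and one factor \<open>1 / sqrt n\<close> is left over.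
\<close>

theorem sparse_solutions_rare:
  assumes d: "d \<ge> 3" and p: "p > 0"
  obtains \<epsilon>0 K where "\<epsilon>0 > 0" "K > 0"
    "\<And>V :: 'v set. finite V \<Longrightarrow> even (card V) \<Longrightarrow> card V > 0 \<Longrightarrow>
      real (card (solution_pairs p d V (\<lambda>_. 0)
          (\<lambda>M x. support V x \<noteq> {} \<and> real (card (support V x)) \<le> \<epsilon>0 * real (card V))))
      \<le> odd_fact (card V) ^ d * (K / sqrt (real (card V)))"
proof -
  define E where "E = exp 1 * (2::real) ^ (d + 2)"
  define F where "F = real (card (residues p)) * E ^ d"
  have E: "E \<ge> 1"
  proof -
    have "1 \<le> (2::real) ^ (d + 2)" by (rule one_le_power) simp
    moreover have "1 \<le> exp (1::real)" by simp
    ultimately show ?thesis unfolding E_def using mult_mono[of 1 "exp 1" 1 "2 ^ (d + 2) :: real"] by linarith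
  qed
  have F: "F \<ge> 1"
  proof -
    have "1 \<le> real (card (residues p))" using p by (simp add: residues_def)
    moreover have "1 \<le> E ^ d" using E by (rule one_le_power)
    ultimately show ?thesis unfolding F_def using mult_mono[of 1 "real (card (residues p))" 1 "E ^ d"] by linarith
  qed
  \<comment> \<open>This makes \<open>F * sqrt (2 * \<epsilon>0) = 1 / 8\<close>.\<close>
  define \<epsilon>0 where "\<epsilon>0 = 1 / (128 * F\<^sup>2)"
  define K where "K = 16 * real (d + 1) * F"
  have "1 \<le> F\<^sup>2" using F by (rule one_le_power)
  then have "1 \<le> 64 * F\<^sup>2" by linarith
  then have \<epsilon>0: "\<epsilon>0 > 0" "\<epsilon>0 \<le> 1 / 2" using F unfolding \<epsilon>0_def by (simp_all add: divide_le_eq)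
  show ?thesis
  proof (rule that[of \<epsilon>0 K])
    fix V :: "'v set" assume V: "finite V" "even (card V)" "card V > 0"
    define n where "n = card V"
    define W where "W = real (odd_fact n) ^ d"
    have n: "n > 0" using V by (simp add: n_def)
    have W: "W \<ge> 0" by (simp add: W_def)
    define Z where "Z = (\<lambda>k. (solution_pairs p d V (\<lambda>_. 0) (\<lambda>M x. card (support V x) = k)))"
    have Zbound: "real (card (Z k)) \<le> W * (16 * real (d + 1) * F / sqrt (real n) * (1 / 2) ^ k)"
      if k: "0 < k" "real k \<le> \<epsilon>0 * real n" for k
    proof -
      define q where "q = sqrt (2 * real k / real n)"
      have k2: "2 * k \<le> card V"
      proof -
        have "2 * real k \<le> 2 * (\<epsilon>0 * real n)" using k by simp
        also have "\<dots> \<le> 2 * (1 / 2 * real n)" using \<epsilon>0 by (intro mult_left_mono mult_right_mono) auto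
        finally show ?thesis by (simp add: n_def)
      qed
      let ?Sk = "{S. S \<subseteq> V \<and> card S = k}"
      let ?M = "\<lambda>S. {M \<in> matching_tuples d V. unpaired_free d V S M}"
      let ?X = "\<lambda>S. {x \<in> PiE V (\<lambda>_. residues p). support V x = S}"
      have finSk: "finite ?Sk" by (rule finite_subset[of _ "Pow V"]) (use V(1) in auto)
      have finP: "finite (PiE V (\<lambda>_. residues p))" using V(1) by (intro finite_PiE) simp_all
      have "Z k \<subseteq> (\<Union>S\<in>?Sk. ?M S \<times> ?X S)"
      proof
        fix z assume z: "z \<in> Z k"
        obtain M x where Mx: "z = (M, x)" by (cases z)
        have M: "M \<in> matching_tuples d V" and x: "x \<in> solutions p d V M (\<lambda>_. 0)" and c: "card (support V x) = k"
          using z by (simp_all add: Z_def Mx)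
        have "support V x \<in> ?Sk" using c by (auto simp: support_def)
        moreover have "z \<in> ?M (support V x) \<times> ?X (support V x)"
          using M x solution_unpaired_free[OF M x] by (simp add: Mx solutions_def)
        ultimately show "z \<in> (\<Union>S\<in>?Sk. ?M S \<times> ?X S)" by blast
      qed
      then have "card (Z k) \<le> card (\<Union>S\<in>?Sk. ?M S \<times> ?X S)"
        by (rule card_mono[rotated]) (use finSk finP V(1) in auto)
      also have "\<dots> \<le> (\<Sum>S\<in>?Sk. card (?M S \<times> ?X S))" by (rule card_UN_le[OF finSk])
      finally have "real (card (Z k)) \<le> real (\<Sum>S\<in>?Sk. card (?M S \<times> ?X S))" by (simp only: of_nat_le_iff)
      also have "\<dots> = (\<Sum>S\<in>?Sk. real (card (?M S)) * real (card (?X S)))" by (simp add: card_cartesian_product)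
      also have "\<dots> \<le> (\<Sum>S\<in>?Sk. (\<Sum>A\<in>covers d V S. W * q ^ (d * k + 2 * card ((\<Union>i<d. A i) - S))) * real (card (residues p) ^ k))"
      proof (rule sum_mono)
        fix S assume S: "S \<in> ?Sk"
        have 1: "real (card (?M S)) \<le> (\<Sum>A\<in>covers d V S. W * q ^ (d * k + 2 * card ((\<Union>i<d. A i) - S)))"
          using card_unpaired_free_le[OF V, of S d] S k2 d by (simp add: W_def q_def n_def)
        have 2: "real (card (?X S)) \<le> real (card (residues p) ^ k)"
          using card_with_support_le[OF V(1), of S p] S by (simp only: of_nat_le_iff) simp
        show "real (card (?M S)) * real (card (?X S)) \<le>
            (\<Sum>A\<in>covers d V S. W * q ^ (d * k + 2 * card ((\<Union>i<d. A i) - S))) * real (card (residues p) ^ k)"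
          by (rule mult_mono[OF 1 2]) (auto intro!: sum_nonneg simp: W q_def)
      qed
      also have "\<dots> = W * real (card (residues p)) ^ k *
          (\<Sum>S\<in>?Sk. \<Sum>A\<in>covers d V S. q ^ (d * k + 2 * card ((\<Union>i<d. A i) - S)))"
        by (simp add: sum_distrib_left sum_distrib_right mult_ac)
      also have "\<dots> \<le> W * real (card (residues p)) ^ k * (real (d * k + 1) * (E ^ (d * k) * q ^ k))"
        unfolding q_def E_def n_def
        by (rule mult_left_mono[OF sum_covers_le[OF V(1,3) d k(1) k2]]) (simp add: W)
      also have "\<dots> = W * (real (d * k + 1) * (F * q) ^ k)"
        by (simp add: F_def power_mult_distrib power_mult mult_ac)
      also have "\<dots> \<le> W * (16 * real (d + 1) * F / sqrt (real n) * (1 / 2) ^ k)"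
      proof (rule mult_left_mono[OF _ W])
        have q0: "q \<ge> 0" by (simp add: q_def)
        have "2 * real k / real n \<le> (1 / (8 * F))\<^sup>2"
        proof -
          have "2 * real k / real n \<le> 2 * \<epsilon>0" using k n by (simp add: pos_divide_le_eq)
          also have "\<dots> = (1 / (8 * F))\<^sup>2" by (simp add: \<epsilon>0_def power2_eq_square)
          finally show ?thesis .
        qed
        then have "q \<le> 1 / (8 * F)" unfolding q_def using F by (intro real_le_lsqrt) auto
        then have Fq: "F * q \<le> 1 / 8" using F by (simp add: pos_le_divide_eq mult.commute mult.left_commute)
        obtain l where l: "k = Suc l" using k by (cases k) auto
        have "(F * q) ^ k \<le> (F * q) * (1 / 8) ^ l"
          unfolding l power_Suc using Fq F q0 by (intro mult_left_mono power_mono) auto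
        also have "(F * q) * (1 / 8) ^ l \<le> (F * (2 * real k / sqrt (real n))) * (1 / 8) ^ l"
        proof (intro mult_right_mono mult_left_mono)
          have "sqrt (2 * real k) \<le> 2 * real k"
          proof (rule real_le_lsqrt)
            have "2 * real k * 1 \<le> 2 * real k * (2 * real k)" using k by (intro mult_left_mono) auto
            then show "2 * real k \<le> (2 * real k)\<^sup>2" by (simp add: power2_eq_square)
          qed simp
          then show "q \<le> 2 * real k / sqrt (real n)"
            unfolding q_def real_sqrt_divide by (rule divide_right_mono) simp
        qed (use F in auto)
        also have "\<dots> = 16 * F / sqrt (real n) * (real k * (1 / 8) ^ k)" by (simp add: l)
        finally have "real (d * k + 1) * (F * q) ^ k \<le> real (d * k + 1) * (16 * F / sqrt (real n) * (real k * (1 / 8) ^ k))"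
          by (rule mult_left_mono) simp
        also have "\<dots> \<le> (real (d + 1) * real k) * (16 * F / sqrt (real n) * (real k * (1 / 8) ^ k))"
          using F k by (intro mult_right_mono) (auto simp: algebra_simps)
        also have "\<dots> = 16 * real (d + 1) * F / sqrt (real n) * (real k * real k * (1 / 8) ^ k)" by simp
        also have "\<dots> \<le> 16 * real (d + 1) * F / sqrt (real n) * (2 ^ k * 2 ^ k * (1 / 8) ^ k)"
        proof (intro mult_left_mono mult_right_mono mult_mono)
          show "real k \<le> 2 ^ k" using of_nat_less_two_power[of k, where 'a = real] by simp
          then show "real k \<le> 2 ^ k" .
        qed (use F in auto)
        also have "2 ^ k * 2 ^ k * (1 / 8 :: real) ^ k = (1 / 2) ^ k"
          by (simp only: power_mult_distrib[symmetric]) simp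
        finally show "real (d * k + 1) * (F * q) ^ k \<le> 16 * real (d + 1) * F / sqrt (real n) * (1 / 2) ^ k" .
      qed
      finally show ?thesis .
    qed
    define m where "m = nat \<lfloor>\<epsilon>0 * real n\<rfloor>"
    let ?Y = "(solution_pairs p d V (\<lambda>_. 0)
          (\<lambda>M x. support V x \<noteq> {} \<and> real (card (support V x)) \<le> \<epsilon>0 * real (card V)))"
    have finZ: "finite (Z k)" for k
    proof -
      have "Z k \<subseteq> matching_tuples d V \<times> (PiE V (\<lambda>_. residues p))" by (auto simp: Z_def solutions_def)
      then show ?thesis by (rule finite_subset) (intro finite_cartesian_product finite_matching_tuples V(1) finite_PiE finite_residues)
    qed
    have "?Y \<subseteq> (\<Union>k\<in>{1..m}. Z k)"
    proof
      fix z assume z: "z \<in> ?Y"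
      obtain M x where Mx: "z = (M, x)" by (cases z)
      define k where "k = card (support V x)"
      have "finite (support V x)" using V(1) by (simp add: support_def)
      then have "k > 0" using z by (simp add: Mx k_def card_gt_0_iff)
      moreover have "k \<le> m" using z unfolding m_def Mx k_def n_def by (simp add: le_nat_floor)
      moreover have "z \<in> Z k" using z by (simp add: Mx Z_def k_def)
      ultimately show "z \<in> (\<Union>k\<in>{1..m}. Z k)" by auto
    qed
    then have "card ?Y \<le> card (\<Union>k\<in>{1..m}. Z k)" by (rule card_mono[rotated]) (intro finite_UN_I finite_atLeastAtMost finZ)
    also have "\<dots> \<le> (\<Sum>k\<in>{1..m}. card (Z k))" by (rule card_UN_le) simp
    finally have "real (card ?Y) \<le> (\<Sum>k\<in>{1..m}. real (card (Z k)))" by (simp flip: of_nat_sum)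
    also have "\<dots> \<le> (\<Sum>k\<in>{1..m}. W * (16 * real (d + 1) * F / sqrt (real n) * (1 / 2) ^ k))"
    proof (rule sum_mono)
      fix k assume k: "k \<in> {1..m}"
      then have "int k \<le> \<lfloor>\<epsilon>0 * real n\<rfloor>" by (auto simp: m_def)
      then have "real k \<le> \<epsilon>0 * real n" by (simp add: le_floor_iff)
      then show "real (card (Z k)) \<le> W * (16 * real (d + 1) * F / sqrt (real n) * (1 / 2) ^ k)" using k by (intro Zbound) auto
    qed
    also have "\<dots> = W * (K / sqrt (real n)) * (\<Sum>k\<in>{1..m}. (1 / 2) ^ k)"
      by (simp add: sum_distrib_left K_def mult.assoc)
    also have "\<dots> \<le> W * (K / sqrt (real n)) * 1"
    proof (rule mult_left_mono)
      have "(\<Sum>k\<in>{1..m}. (1 / 2 :: real) ^ k) = 1 - (1 / 2) ^ m" by (induction m) auto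
      then show "(\<Sum>k\<in>{1..m}. (1 / 2 :: real) ^ k) \<le> 1" by simp
      show "0 \<le> W * (K / sqrt (real n))" using W F by (simp add: K_def)
    qed
    finally show "real (card ?Y) \<le> odd_fact (card V) ^ d * (K / sqrt (real (card V)))"
      by (simp add: W_def n_def)
  qed (use \<epsilon>0 F in \<open>auto simp: K_def\<close>)
qed

section \<open>Singularity modulo a prime\<close>

lemma fpf_involution_bij: "\<sigma> \<in> fpf_involutions V \<Longrightarrow> bij_betw \<sigma> V V"
  by (rule bij_betw_byWitness[where f' = \<sigma>]) (auto dest: fpf_involutionsD)

lemma neighbour_sum_symmetric:
  assumes V: "finite V" and M: "M \<in> matching_tuples d V"
  shows "(\<Sum>j\<in>V. w j * (\<Sum>i<d. x (M i j))) = (\<Sum>j\<in>V. (\<Sum>i<d. w (M i j)) * (x j :: int))"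
proof -
  have step: "(\<Sum>j\<in>V. w j * x (M i j)) = (\<Sum>j\<in>V. w (M i j) * x j)" if "i < d" for i
  proof -
    have Mi: "M i \<in> fpf_involutions V" using M that by (auto simp: matching_tuples_def)
    have "(\<Sum>j\<in>V. w (M i j) * x (M i (M i j))) = (\<Sum>j\<in>V. w j * x (M i j))"
      by (rule sum.reindex_bij_betw[OF fpf_involution_bij[OF Mi]])
    then show ?thesis by (simp only: fpf_involutionsD(1)[OF Mi])
  qed
  have "(\<Sum>i<d. \<Sum>j\<in>V. w j * x (M i j)) = (\<Sum>i<d. \<Sum>j\<in>V. w (M i j) * x j)"
    by (rule sum.cong[OF refl], rule step) simp
  then show ?thesis by (simp add: sum_distrib_left sum_distrib_right sum.swap[of _ V])
qed

text \<open>
  The matrix is symmetric, so its range is orthogonal to its kernel: \<open>w v * g = 0\<close> modulo \<open>p\<close>.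
\<close>

lemma kernel_orthogonal:
  assumes V: "finite V" and M: "M \<in> matching_tuples d V" and p: "prime p"
    and x: "x \<in> solutions p d V M (\<lambda>j. if j = v then g else 0)" and g: "g \<in> {1..<p}" and v: "v \<in> V"
    and w: "w \<in> solutions p d V M (\<lambda>_. 0)"
  shows "w v = 0"
proof -
  have "p dvd (\<Sum>j\<in>V. (\<Sum>i<d. w (M i j)) * x j)"
  proof (rule dvd_sum)
    fix j assume "j \<in> V"
    then have "(\<Sum>i<d. w (M i j)) mod p = 0" using w by (simp add: solutions_def neighbour_sum_def)
    then show "p dvd (\<Sum>i<d. w (M i j)) * x j" by (simp add: dvd_eq_mod_eq_0[symmetric])
  qed
  then have 1: "p dvd (\<Sum>j\<in>V. w j * (\<Sum>i<d. x (M i j)))" by (simp only: neighbour_sum_symmetric[OF V M])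
  have "(\<Sum>j\<in>V. w j * (\<Sum>i<d. x (M i j))) = w v * (\<Sum>i<d. x (M i v)) + (\<Sum>j\<in>V - {v}. w j * (\<Sum>i<d. x (M i j)))"
    by (rule sum.remove[OF V v])
  moreover have "p dvd (\<Sum>j\<in>V - {v}. w j * (\<Sum>i<d. x (M i j)))"
  proof (rule dvd_sum)
    fix j assume "j \<in> V - {v}"
    then have "(\<Sum>i<d. x (M i j)) mod p = 0" using x by (simp add: solutions_def neighbour_sum_def)
    then show "p dvd w j * (\<Sum>i<d. x (M i j))" by (simp add: dvd_eq_mod_eq_0[symmetric])
  qed
  ultimately have prod: "p dvd w v * (\<Sum>i<d. x (M i v))" using 1 by (simp only: dvd_add_left_iff)
  have "\<not> p dvd (\<Sum>i<d. x (M i v))"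
  proof -
    have "(\<Sum>i<d. x (M i v)) mod p = g" using x v by (simp add: solutions_def neighbour_sum_def)
    then show ?thesis using g by (simp add: dvd_eq_mod_eq_0)
  qed
  then have "p dvd w v" using prime_dvd_multD[OF p prod] by blast
  then have "w v mod p = 0" by simp
  moreover have "w v \<in> residues p" using w v by (auto simp: solutions_def)
  ultimately show ?thesis by (simp add: residues_def)
qed

lemma card_solutions_le_kernel:
  assumes V: "finite V" and M: "M \<in> matching_tuples d V" and p: "p > 0"
  shows "card (solutions p d V M z) \<le> card (solutions p d V M (\<lambda>_. 0))"
proof (cases "solutions p d V M z = {}")
  case False
  then obtain x0 where x0: "x0 \<in> solutions p d V M z" by blast
  let ?f = "\<lambda>x. \<lambda>j\<in>V. (x j - x0 j) mod p"
  have "inj_on ?f (solutions p d V M z)"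
  proof (rule inj_onI, rule ext)
    fix x y j assume x: "x \<in> solutions p d V M z" and y: "y \<in> solutions p d V M z" and e: "?f x = ?f y"
    have xP: "x \<in> PiE V (\<lambda>_. residues p)" and yP: "y \<in> PiE V (\<lambda>_. residues p)" using x y by (simp_all add: solutions_def)
    show "x j = y j"
    proof (cases "j \<in> V")
      case True
      then have "(x j - x0 j) mod p = (y j - x0 j) mod p" using fun_cong[OF e, of j] by simp
      then have "x j mod p = y j mod p" by (simp add: mod_eq_dvd_iff)
      then show ?thesis using PiE_mem[OF xP True] PiE_mem[OF yP True] by (simp add: residues_def)
    next
      case False
      then show ?thesis using PiE_arb[OF xP False] PiE_arb[OF yP False] by simp
    qed
  qed
  moreover have "?f ` solutions p d V M z \<subseteq> solutions p d V M (\<lambda>_. 0)"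
  proof (rule image_subsetI)
    fix x assume x: "x \<in> solutions p d V M z"
    have "neighbour_sum p d M (?f x) j = 0" if j: "j \<in> V" for j
    proof -
      have "(\<Sum>i<d. ?f x (M i j)) = (\<Sum>i<d. (x (M i j) - x0 (M i j)) mod p)"
        using matching_tuples_in[OF M _ j] by (intro sum.cong) auto
      then have "(\<Sum>i<d. ?f x (M i j)) mod p = (\<Sum>i<d. x (M i j) - x0 (M i j)) mod p" by (simp only: mod_sum_eq)
      also have "\<dots> = ((\<Sum>i<d. x (M i j)) mod p - (\<Sum>i<d. x0 (M i j)) mod p) mod p"
        by (simp only: sum_subtractf mod_diff_eq)
      also have "\<dots> = 0" using x x0 j by (simp add: solutions_def neighbour_sum_def)
      finally show ?thesis by (simp only: neighbour_sum_def)
    qed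
    then show "?f x \<in> solutions p d V M (\<lambda>_. 0)" using p by (simp add: solutions_def residues_def)
  qed
  ultimately show ?thesis by (intro card_inj_on_le) (simp_all add: V)
qed simp

lemma zero_in_kernel:
  assumes "p > 0" "M \<in> matching_tuples d V"
  shows "(\<lambda>j\<in>V. 0) \<in> solutions p d V M (\<lambda>_. 0)"
proof -
  have "(\<Sum>i<d. (\<lambda>j\<in>V. 0) (M i j)) = (0::int)" if "j \<in> V" for j
    using matching_tuples_in[OF assms(2) _ that] by (intro sum.neutral) auto
  then show ?thesis using assms(1) by (simp add: solutions_def residues_def neighbour_sum_def)
qed

lemma kernel_eq:
  assumes p: "p > 0" and M: "M \<in> matching_tuples d V"
  shows "solutions p d V M (\<lambda>_. 0) = insert (\<lambda>j\<in>V. 0) {x \<in> solutions p d V M (\<lambda>_. 0). support V x \<noteq> {}}"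
proof -
  have "x = (\<lambda>j\<in>V. 0)" if "x \<in> solutions p d V M (\<lambda>_. 0)" "support V x = {}" for x
  proof
    fix j
    have "x \<in> PiE V (\<lambda>_. residues p)" using that by (simp add: solutions_def)
    then show "x j = (\<lambda>j\<in>V. 0) j" using that(2) PiE_arb[of x V "\<lambda>_. residues p" j] by (auto simp: support_def)
  qed
  then show ?thesis using zero_in_kernel[OF p M] by blast
qed

text \<open>
  The nonzero multiples of a nonzero kernel vector are distinct.
\<close>

lemma card_nonzero_kernel_ge:
  assumes V: "finite V" and M: "M \<in> matching_tuples d V" and p: "prime p"
    and w: "w \<in> solutions p d V M (\<lambda>_. 0)" "support V w \<noteq> {}"
  shows "of_int p - 1 \<le> real (card {x \<in> solutions p d V M (\<lambda>_. 0). support V x \<noteq> {}})"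
proof -
  have p0: "p > 0" using p by (simp add: prime_gt_0_int)
  obtain v where v: "v \<in> V" "w v \<noteq> 0" using w(2) by (auto simp: support_def)
  have wR: "w v \<in> residues p" using w(1) v by (auto simp: solutions_def)
  have ndvd: "\<not> p dvd w v" using wR v(2) by (auto simp: residues_def dest: zdvd_imp_le)
  let ?f = "\<lambda>c. \<lambda>j\<in>V. (c * w j) mod p"
  have "inj_on ?f {1..<p}"
  proof (rule inj_onI)
    fix b c assume bc: "b \<in> {1..<p}" "c \<in> {1..<p}" "?f b = ?f c"
    have "(b * w v) mod p = (c * w v) mod p" using fun_cong[OF bc(3), of v] v by simp
    then have "p dvd b * w v - c * w v" by (simp add: mod_eq_dvd_iff)
    then have "p dvd (b - c) * w v" by (simp add: left_diff_distrib)
    then have "p dvd b - c" using p ndvd by (simp add: prime_dvd_mult_iff)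
    then have "b mod p = c mod p" by (simp add: mod_eq_dvd_iff)
    then show "b = c" using bc by simp
  qed
  moreover have "?f ` {1..<p} \<subseteq> {x \<in> solutions p d V M (\<lambda>_. 0). support V x \<noteq> {}}"
  proof (rule image_subsetI)
    fix c assume c: "c \<in> {1..<p}"
    have "neighbour_sum p d M (?f c) j = 0" if j: "j \<in> V" for j
    proof -
      have "(\<Sum>i<d. ?f c (M i j)) = (\<Sum>i<d. (c * w (M i j)) mod p)"
        using matching_tuples_in[OF M _ j] by (intro sum.cong) auto
      then have "(\<Sum>i<d. ?f c (M i j)) mod p = (\<Sum>i<d. c * w (M i j)) mod p" by (simp only: mod_sum_eq)
      also have "\<dots> = (c * ((\<Sum>i<d. w (M i j)) mod p)) mod p" by (simp only: sum_distrib_left[symmetric] mod_mult_right_eq)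
      also have "\<dots> = 0" using w(1) j by (simp add: solutions_def neighbour_sum_def)
      finally show ?thesis by (simp only: neighbour_sum_def)
    qed
    moreover have "\<not> p dvd c * w v"
      using p ndvd c by (auto simp: prime_dvd_mult_iff dest: zdvd_imp_le)
    then have "v \<in> support V (?f c)" using v by (simp add: support_def dvd_eq_mod_eq_0)
    ultimately show "?f c \<in> {x \<in> solutions p d V M (\<lambda>_. 0). support V x \<noteq> {}}"
      using p0 by (auto simp: solutions_def residues_def)
  qed
  ultimately have "card {1..<p} \<le> card {x \<in> solutions p d V M (\<lambda>_. 0). support V x \<noteq> {}}"
    by (intro card_inj_on_le) (simp_all add: V)
  then show ?thesis using p0 by simp
qed

lemma fst_column_array: "j \<in> V \<Longrightarrow> fst (column_array d V M x j) = x j"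
  by (simp add: column_array_def)

lemma card_zero_entries_near_uniform:
  assumes d: "d \<ge> 3" and p: "p > 0" and V: "finite V" and M: "M \<in> matching_tuples d V"
    and x: "x \<in> solutions p d V M (\<lambda>_. 0)" and nu: "near_uniform p d \<epsilon> V (column_array d V M x)"
  shows "real (card {j\<in>V. x j = 0}) \<le> (1 + \<epsilon>) * (real (card V) / of_int p)"
proof -
  let ?C = "columns_of_sum p d 0"
  let ?c = "column_array d V M x"
  let ?S = "{a \<in> ?C. fst a = 0}"
  let ?\<nu> = "real (card V) / of_int p ^ d"
  have cC: "?c \<in> PiE V (\<lambda>_. ?C)" by (rule column_array_in[OF M x])
  have R0: "0 \<in> residues p" using p by (simp add: residues_def)
  have d1: "(0::nat) < d" using d by simp
  have "(\<Sum>t\<in>residues p. card {a \<in> ?S. snd a 0 = t}) = card ?S"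
  proof -
    have "(\<Sum>t\<in>residues p. \<Sum>a\<in>{a \<in> ?S. snd a 0 = t}. 1) = (\<Sum>a\<in>?S. 1::nat)"
      using columnsD(2)[OF _ d1, of _ p 0] by (intro sum.group) auto
    then show ?thesis by simp
  qed
  moreover have "card {a \<in> ?S. snd a 0 = t} = card (residues p) ^ (d - 2)" if "t \<in> residues p" for t
  proof -
    have "{a \<in> ?S. snd a 0 = t} = {a \<in> ?C. (fst a, snd a 0) = (0, t)}" by auto
    then show ?thesis using card_column_fiber[of d 0 p 0 t] d p R0 that by simp
  qed
  ultimately have cS: "card ?S = card (residues p) * card (residues p) ^ (d - 2)" by simp
  have pd: "of_int p ^ d = of_int p * (of_int p * real_of_int p ^ (d - 2))"
  proof -
    have "Suc (Suc (d - 2)) = d" using d by simp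
    then show ?thesis by (metis power_Suc)
  qed
  have cS': "real (card ?S) * ?\<nu> = real (card V) / of_int p"
    using p unfolding cS pd by (simp add: residues_def)
  have "(\<Sum>a\<in>?S. \<Sum>j\<in>{j \<in> {j\<in>V. x j = 0}. ?c j = a}. 1) = (\<Sum>j\<in>{j\<in>V. x j = 0}. 1::nat)"
    using V PiE_mem[OF cC] by (intro sum.group) (auto simp: fst_column_array)
  moreover have "{j \<in> {j\<in>V. x j = 0}. ?c j = a} = {j\<in>V. ?c j = a}" if "a \<in> ?S" for a
    using that fst_column_array[of _ V d M x] by auto
  ultimately have "card {j\<in>V. x j = 0} = (\<Sum>a\<in>?S. type_count V ?c a)" by (simp add: type_count_def)
  then have "real (card {j\<in>V. x j = 0}) = (\<Sum>a\<in>?S. real (type_count V ?c a))" by simp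
  also have "\<dots> \<le> (\<Sum>a\<in>?S. (1 + \<epsilon>) * ?\<nu>)"
  proof (rule sum_mono)
    fix a assume "a \<in> ?S"
    then have "\<bar>real (type_count V ?c a) - ?\<nu>\<bar> \<le> \<epsilon> * ?\<nu>" using nu by (simp add: near_uniform_def)
    then show "real (type_count V ?c a) \<le> (1 + \<epsilon>) * ?\<nu>" unfolding distrib_right by linarith
  qed
  also have "\<dots> = (1 + \<epsilon>) * (real (card ?S) * ?\<nu>)" by simp
  finally show ?thesis unfolding cS' .
qed


text \<open>
  Let \<open>G\<close> and \<open>B\<close> be the total numbers of nonzero kernel vectors of nearly uniform type and of all other ones, and \<open>W\<close> the
  number of tuples of matchings; then \<open>B \<le> W / 10\<close> for large \<open>n\<close>. Let \<open>k\<close> be the number of nonzero kernel vectors of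
  one tuple. Summing over all \<open>v\<close> and all \<open>g \<noteq> 0\<close>, a tuple has at most \<open>n * (p - 1)\<close> solutions of the systems with
  right-hand side \<open>g\<close> at \<open>v\<close> if \<open>k = 0\<close>, about \<open>n * (p - 1) / p * (k + 1)\<close> if some kernel vector is nearly uniform, and
  \<open>n * (p - 1) * (k + 1)\<close> in the remaining case, where all \<open>k\<close> vectors count for \<open>B\<close>. Comparison with
  \<open>typical_solutions_transfer\<close> yields \<open>3/4 * G \<le> W + 4/p * (G + B) + 2 * B\<close>, hence \<open>G + B \<le> 3 * W\<close> for \<open>p \<ge> 17\<close>.
\<close>

theorem singular_mod_p_rare:
  assumes d: "d \<ge> 3" and p: "prime p" "\<not> p dvd int d" "p \<ge> 17"
  obtains n1 where "\<And>V :: 'v set. finite V \<Longrightarrow> even (card V) \<Longrightarrow> card V \<ge> n1 \<Longrightarrow>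
    (of_int p - 1) * real (card {M \<in> matching_tuples d V. \<exists>x\<in>solutions p d V M (\<lambda>_. 0). support V x \<noteq> {}})
      \<le> 3 * real (card (matching_tuples d V))"
proof -
  have p0: "p > 0" using p by simp
  have odd: "odd p" using p(1,3) by (intro prime_odd_int) auto
  obtain \<epsilon> n0 where \<epsilon>: "0 < \<epsilon>" "\<epsilon> \<le> 1 / 2" and transfer:
    "\<And>(V :: 'v set) v g. finite V \<Longrightarrow> card V \<ge> n0 \<Longrightarrow> v \<in> V \<Longrightarrow> g \<in> residues p \<Longrightarrow>
      (1 - 1 / 4) * real (card (solution_pairs p d V (\<lambda>_. 0)
          (\<lambda>M x. near_uniform p d \<epsilon> V (column_array d V M x))))
      \<le> real (card (solution_pairs p d V (\<lambda>j. if j = v then g else 0) (\<lambda>M x. True)))"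
    using typical_solutions_transfer[OF d p(1) odd p(2), of "1 / 4" "1 / 2", where ?'v = 'v] by auto
  obtain \<epsilon>0 K where \<epsilon>0: "\<epsilon>0 > 0" "K > 0" and sparse:
    "\<And>V :: 'v set. finite V \<Longrightarrow> even (card V) \<Longrightarrow> card V > 0 \<Longrightarrow>
      real (card (solution_pairs p d V (\<lambda>_. 0)
          (\<lambda>M x. support V x \<noteq> {} \<and> real (card (support V x)) \<le> \<epsilon>0 * real (card V))))
      \<le> odd_fact (card V) ^ d * (K / sqrt (real (card V)))"
    using sparse_solutions_rare[OF d p0, where ?'v = 'v] by auto
  obtain \<eta> K1 K2 where \<eta>: "\<eta> > 0" and atypical:
    "\<And>V :: 'v set. finite V \<Longrightarrow> even (card V) \<Longrightarrow> card V > 0 \<Longrightarrow>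
      real (card (solution_pairs p d V (\<lambda>_. 0)
          (\<lambda>M x. \<not> near_uniform p d \<epsilon> V (column_array d V M x) \<and> real (card {j\<in>V. fst (column_array d V M x j) = 0}) \<le> (1 - \<epsilon>0) * real (card V))))
      \<le> real (odd_fact (card V)) ^ d * exp (- \<eta> * real (card V) + K1 + K2 * ln (real (card V) + 1))"
    using atypical_solutions_rare[OF d p(1,2) \<epsilon>0(1) \<epsilon>(1), where ?'v = 'v] by auto
  \<comment> \<open>The proportions of sparse and of atypical kernel vectors tend to zero.\<close>
  have "((\<lambda>n. K / sqrt (real n) + exp (- \<eta> * real n + K1 + K2 * ln (real n + 1))) \<longlongrightarrow> 0) at_top"
    using \<eta> by real_asymp
  then have "eventually (\<lambda>n. K / sqrt (real n) + exp (- \<eta> * real n + K1 + K2 * ln (real n + 1)) < 1 / 10) at_top"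
    by (rule order_tendstoD(2)) simp
  then obtain n2 where n2: "\<And>n. n \<ge> n2 \<Longrightarrow> K / sqrt (real n) + exp (- \<eta> * real n + K1 + K2 * ln (real n + 1)) < 1 / 10"
    by (auto simp: eventually_at_top_linorder)
  show ?thesis
  proof (rule that[of "max 1 (max n0 n2)"])
    fix V :: "'v set" assume V: "finite V" "even (card V)" "card V \<ge> max 1 (max n0 n2)"
    define n where "n = card V"
    have n: "n > 0" "n \<ge> n0" "n \<ge> n2" using V(3) by (auto simp: n_def)
    define MT where "MT = matching_tuples d V"
    define ker where "ker = (\<lambda>M. solutions p d V M (\<lambda>_. 0))"
    define near where "near = (\<lambda>M x. near_uniform p d \<epsilon> V (column_array d V M x))"
    define good where "good = (\<lambda>M. {x \<in> ker M. near M x})"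
    define bad where "bad = (\<lambda>M. {x \<in> ker M. support V x \<noteq> {} \<and> \<not> near M x})"
    define nz where "nz = (\<lambda>M. {x \<in> ker M. support V x \<noteq> {}})"
    define W where "W = real (card MT)"
    have W_eq: "W = real (odd_fact n) ^ d" by (simp add: W_def MT_def n_def card_matching_tuples[OF V(1)])
    have finMT: "finite MT" unfolding MT_def using V(1) by simp
    have finker: "finite (ker M)" for M unfolding ker_def using V(1) by simp
    have fing: "finite (good M)" "finite (bad M)" "finite (nz M)" for M
      using finker[of M] by (simp_all add: good_def bad_def nz_def)
    have zero_count: "real (card {j\<in>V. x j = 0}) \<le> (1 + \<epsilon>) * (real n / of_int p)" if "M \<in> MT" "x \<in> good M" for M x
      using card_zero_entries_near_uniform[OF d p0 V(1)] that by (simp add: MT_def good_def near_def ker_def n_def)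
    have small: "(1 + \<epsilon>) * (real n / of_int p) \<le> 2 / of_int p * real n"
      using \<epsilon>(2) p0 n by (simp add: divide_right_mono)
    have good_nz: "support V x \<noteq> {}" if M: "M \<in> MT" and x: "x \<in> good M" for M x
    proof
      assume "support V x = {}"
      then have "{j\<in>V. x j = 0} = V" by (auto simp: support_def)
      then have "real n \<le> 2 / of_int p * real n" using zero_count[OF M x] small by (simp add: n_def)
      then have "1 * real n \<le> 2 / of_int p * real n" by simp
      then have "1 \<le> 2 / real_of_int p" using n by (subst (asm) mult_le_cancel_right_pos) auto
      then show False using p(3) by (simp add: le_divide_eq)
    qed
    have nz_split: "card (nz M) = card (good M) + card (bad M)" if "M \<in> MT" for M
    proof -
      have "nz M = good M \<union> bad M" using good_nz[OF that] by (auto simp: nz_def good_def bad_def)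
      moreover have "good M \<inter> bad M = {}" by (auto simp: good_def bad_def)
      ultimately show ?thesis using fing by (simp add: card_Un_disjoint)
    qed
    have ker_card: "card (ker M) = card (nz M) + 1" if "M \<in> MT" for M
    proof -
      have "ker M = insert (\<lambda>j\<in>V. 0) (nz M)" unfolding ker_def nz_def using kernel_eq[OF p0] that by (simp add: MT_def)
      moreover have "(\<lambda>j\<in>V. 0) \<notin> nz M" by (auto simp: nz_def support_def)
      ultimately show ?thesis using fing(3) by simp
    qed
    define G where "G = (\<Sum>M\<in>MT. real (card (good M)))"
    define B where "B = (\<Sum>M\<in>MT. real (card (bad M)))"
    have pairs: "card {(M, x). M \<in> MT \<and> x \<in> X M} = (\<Sum>M\<in>MT. card (X M))" if "\<And>M. finite (X M)" for X :: "(nat \<Rightarrow> 'v \<Rightarrow> 'v) \<Rightarrow> ('v \<Rightarrow> int) set"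
    proof -
      have "{(M, x). M \<in> MT \<and> x \<in> X M} = (SIGMA M:MT. X M)" by auto
      then show ?thesis using finMT that by simp
    qed
    have B_le: "B \<le> W / 10"
    proof -
      let ?P1 = "(solution_pairs p d V (\<lambda>_. 0)
          (\<lambda>M x. support V x \<noteq> {} \<and> real (card (support V x)) \<le> \<epsilon>0 * real (card V)))"
      let ?P2 = "(solution_pairs p d V (\<lambda>_. 0)
          (\<lambda>M x. \<not> near_uniform p d \<epsilon> V (column_array d V M x) \<and> real (card {j\<in>V. fst (column_array d V M x j) = 0}) \<le> (1 - \<epsilon>0) * real (card V)))"
      have finP: "finite {(M, x). M \<in> MT \<and> x \<in> ker M}"
      proof -
        have "{(M, x). M \<in> MT \<and> x \<in> ker M} = (SIGMA M:MT. ker M)" by auto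
        then show ?thesis using finMT finker by simp
      qed
      have "{(M, x). M \<in> MT \<and> x \<in> bad M} \<subseteq> ?P1 \<union> ?P2"
      proof
        fix z assume z: "z \<in> {(M, x). M \<in> MT \<and> x \<in> bad M}"
        obtain M x where Mx: "z = (M, x)" by (cases z)
        have MM: "M \<in> matching_tuples d V" "x \<in> solutions p d V M (\<lambda>_. 0)" "support V x \<noteq> {}"
          "\<not> near_uniform p d \<epsilon> V (column_array d V M x)"
          using z by (simp_all add: Mx bad_def ker_def MT_def near_def)
        show "z \<in> ?P1 \<union> ?P2"
        proof (cases "real (card (support V x)) \<le> \<epsilon>0 * real (card V)")
          case True
          then show ?thesis using MM by (simp add: Mx)
        next
          case False
          have "{j\<in>V. fst (column_array d V M x j) = 0} = V - support V x"
            by (auto simp: fst_column_array support_def)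
          moreover have "card (V - support V x) = card V - card (support V x)"
            using V(1) by (intro card_Diff_subset) (auto simp: support_def)
          moreover have "card (support V x) \<le> card V" using V(1) by (intro card_mono) (auto simp: support_def)
          ultimately have "real (card {j\<in>V. fst (column_array d V M x j) = 0}) \<le> (1 - \<epsilon>0) * real (card V)"
            using False by (simp add: of_nat_diff left_diff_distrib)
          then show ?thesis using MM by (simp add: Mx)
        qed
      qed
      then have "card {(M, x). M \<in> MT \<and> x \<in> bad M} \<le> card (?P1 \<union> ?P2)"
      proof (rule card_mono[rotated])
        have "?P1 \<union> ?P2 \<subseteq> {(M, x). M \<in> MT \<and> x \<in> ker M}" by (auto simp: MT_def ker_def)
        then show "finite (?P1 \<union> ?P2)" using finP by (rule finite_subset)
      qed
      also have "\<dots> \<le> card ?P1 + card ?P2" by (rule card_Un_le)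
      finally have "(\<Sum>M\<in>MT. card (bad M)) \<le> card ?P1 + card ?P2" unfolding pairs[OF fing(2)] .
      then have "real (\<Sum>M\<in>MT. card (bad M)) \<le> real (card ?P1) + real (card ?P2)" by linarith
      also have "\<dots> \<le> W * (K / sqrt (real n)) + W * exp (- \<eta> * real n + K1 + K2 * ln (real n + 1))"
        using sparse[OF V(1,2)] atypical[OF V(1,2)] n unfolding W_eq n_def by (intro add_mono) auto
      also have "\<dots> = W * (K / sqrt (real n) + exp (- \<eta> * real n + K1 + K2 * ln (real n + 1)))" by (simp add: distrib_left)
      also have "\<dots> \<le> W * (1 / 10)" using n2[OF n(3)] by (intro mult_left_mono) (auto simp: W_def)
      finally show ?thesis by (simp add: B_def)
    qed
    have G_le: "(3 / 4) * G \<le> W + 4 / of_int p * G + (2 + 4 / of_int p) * B"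
    proof -
      let ?z = "\<lambda>v g. \<lambda>j. if j = v then g else (0::int)"
      have "3 / 4 * G \<le> (\<Sum>M\<in>MT. real (card (solutions p d V M (?z v g))))" if "v \<in> V" "g \<in> {1..<p}" for v g
      proof -
        have "(solution_pairs p d V (\<lambda>_. 0)
          (\<lambda>M x. near_uniform p d \<epsilon> V (column_array d V M x))) = {(M, x). M \<in> MT \<and> x \<in> good M}"
          by (auto simp: MT_def good_def ker_def near_def)
        moreover have "(solution_pairs p d V (?z v g) (\<lambda>M x. True))
            = {(M, x). M \<in> MT \<and> x \<in> solutions p d V M (?z v g)}" by (auto simp: MT_def)
        moreover have "g \<in> residues p" using that by (simp add: residues_def)
        ultimately show ?thesis
          using transfer[OF V(1) _ that(1), of g] n(2) pairs[OF fing(1)] pairs[of "\<lambda>M. solutions p d V M (?z v g)"] V(1)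
          by (simp add: n_def G_def)
      qed
      then have "(\<Sum>v\<in>V. \<Sum>g\<in>{1..<p}. 3 / 4 * G) \<le> (\<Sum>v\<in>V. \<Sum>g\<in>{1..<p}. \<Sum>M\<in>MT. real (card (solutions p d V M (?z v g))))"
        by (intro sum_mono)
      also have "\<dots> = (\<Sum>M\<in>MT. \<Sum>v\<in>V. \<Sum>g\<in>{1..<p}. real (card (solutions p d V M (?z v g))))"
        by (simp only: sum.swap[of _ _ MT])
      also have "\<dots> \<le> (\<Sum>M\<in>MT. (of_int p - 1) * real n * (1 + 4 / of_int p * (real (card (good M)) + real (card (bad M))) + 2 * real (card (bad M))))"
      proof (rule sum_mono)
        fix M assume M: "M \<in> MT"
        let ?k = "real (card (nz M))"
        let ?Z = "{v\<in>V. \<forall>w\<in>ker M. w v = 0}"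
        have M': "M \<in> matching_tuples d V" using M by (simp add: MT_def)
        have each: "real (card (solutions p d V M (?z v g))) \<le> (if v \<in> ?Z then ?k + 1 else 0)" if "v \<in> V" "g \<in> {1..<p}" for v g
        proof (cases "v \<in> ?Z")
          case True
          have "card (solutions p d V M (?z v g)) \<le> card (ker M)"
            unfolding ker_def by (rule card_solutions_le_kernel[OF V(1) M' p0])
          then show ?thesis using True ker_card[OF M] by simp
        next
          case False
          then have "solutions p d V M (?z v g) = {}"
            using kernel_orthogonal[OF V(1) M' p(1) _ that(2,1)] that(1) unfolding ker_def by blast
          then show ?thesis using False by simp
        qed
        have "(\<Sum>v\<in>V. \<Sum>g\<in>{1..<p}. real (card (solutions p d V M (?z v g)))) \<le> (\<Sum>v\<in>V. \<Sum>g\<in>{1..<p}. (if v \<in> ?Z then ?k + 1 else 0))"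
          by (intro sum_mono each)
        also have "\<dots> = (of_int p - 1) * (\<Sum>v\<in>V. if v \<in> ?Z then ?k + 1 else 0)"
          using p0 by (simp add: sum_distrib_left)
        also have "(\<Sum>v\<in>V. if v \<in> ?Z then ?k + 1 else 0) = (\<Sum>v\<in>?Z. ?k + 1)"
          by (subst sum.inter_filter[OF V(1), symmetric]) (rule sum.cong, auto)
        also have "\<dots> = real (card ?Z) * (?k + 1)" by simp
        also have "\<dots> \<le> real n * (1 + 4 / of_int p * (real (card (good M)) + real (card (bad M))) + 2 * real (card (bad M)))"
        proof -
          have Zn: "real (card ?Z) \<le> real n" unfolding n_def using V(1) by (intro of_nat_mono card_mono) auto
          have k_eq: "?k = real (card (good M)) + real (card (bad M))" using nz_split[OF M] by simp
          have r: "0 \<le> 4 / real_of_int p * (real (card (good M)) + real (card (bad M)))" using p0 by simp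
          consider "nz M = {}" | "nz M \<noteq> {}" "good M \<noteq> {}" | "nz M \<noteq> {}" "good M = {}" by blast
          then show ?thesis
          proof cases
            case 1
            then have "real (card ?Z) * (?k + 1) \<le> real n * 1" using Zn by simp
            also have "\<dots> \<le> real n * (1 + 4 / of_int p * (real (card (good M)) + real (card (bad M))) + 2 * real (card (bad M)))"
              using r by (intro mult_left_mono) auto
            finally show ?thesis .
          next
            case 2
            then obtain w where w: "w \<in> good M" by blast
            have "?Z \<subseteq> {j\<in>V. w j = 0}" using w by (auto simp: good_def)
            then have "real (card ?Z) \<le> real (card {j\<in>V. w j = 0})" using V(1) by (intro of_nat_mono card_mono) auto
            also have "\<dots> \<le> 2 / of_int p * real n" using zero_count[OF M w] small by linarith
            finally have Z2: "real (card ?Z) \<le> 2 / of_int p * real n" .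
            have "card (nz M) \<ge> 1" using 2(1) fing(3)[of M] by (simp add: Suc_le_eq card_gt_0_iff)
            then have "?k + 1 \<le> 2 * ?k" by simp
            then have "real (card ?Z) * (?k + 1) \<le> (2 / of_int p * real n) * (2 * ?k)"
              using Z2 p0 by (intro mult_mono) auto
            also have "\<dots> = real n * (4 / of_int p * ?k)" by simp
            also have "\<dots> \<le> real n * (1 + 4 / of_int p * ?k + 2 * real (card (bad M)))" by (intro mult_left_mono) auto
            finally show ?thesis unfolding k_eq .
          next
            case 3
            have "card (nz M) \<ge> 1" using 3(1) fing(3)[of M] by (simp add: Suc_le_eq card_gt_0_iff)
            then have "?k + 1 \<le> 2 * real (card (bad M))" using nz_split[OF M] 3(2) by simp
            then have "real (card ?Z) * (?k + 1) \<le> real n * (2 * real (card (bad M)))" using Zn by (intro mult_mono) auto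
            also have "\<dots> \<le> real n * (1 + 4 / of_int p * (real (card (good M)) + real (card (bad M))) + 2 * real (card (bad M)))"
              using r by (intro mult_left_mono) auto
            finally show ?thesis .
          qed
        qed
        finally show "(\<Sum>v\<in>V. \<Sum>g\<in>{1..<p}. real (card (solutions p d V M (?z v g)))) \<le>
            (of_int p - 1) * real n * (1 + 4 / of_int p * (real (card (good M)) + real (card (bad M))) + 2 * real (card (bad M)))"
          using p0 by (simp add: mult_left_mono mult.assoc)
      qed
      also have "\<dots> = (of_int p - 1) * real n * (W + 4 / of_int p * (G + B) + 2 * B)"
      proof -
        have "(\<Sum>M\<in>MT. 1 + 4 / of_int p * (real (card (good M)) + real (card (bad M))) + 2 * real (card (bad M)))
            = W + 4 / of_int p * (G + B) + 2 * B"
          by (simp only: sum.distrib sum_distrib_left[symmetric] G_def B_def W_def real_of_card)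
        then show ?thesis by (simp only: sum_distrib_left[symmetric])
      qed
      also have "(\<Sum>v\<in>V. \<Sum>g\<in>{1..<p}. 3 / 4 * G) = (of_int p - 1) * real n * (3 / 4 * G)"
        using p0 by (simp add: n_def)
      finally have "3 / 4 * G \<le> W + 4 / of_int p * (G + B) + 2 * B"
        using p(3) n by (subst (asm) mult_le_cancel_left_pos) auto
      then show ?thesis by (simp add: algebra_simps add_divide_distrib)
    qed
    have G0: "G \<ge> 0" "B \<ge> 0" "W \<ge> 0" by (auto simp: G_def B_def W_def intro!: sum_nonneg)
    have p4: "4 / real_of_int p \<le> 1 / 4" using p(3) by (simp add: divide_le_eq)
    have "4 / real_of_int p * G \<le> 1 / 4 * G" "4 / real_of_int p * B \<le> 1 / 4 * B"
      by (rule mult_right_mono[OF p4 G0(1)], rule mult_right_mono[OF p4 G0(2)])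
    then have "G \<le> 2 * W + 9 / 2 * B" using G_le unfolding distrib_right by linarith
    then have GB: "G + B \<le> 3 * W" using B_le G0 by linarith
    let ?U = "{M \<in> MT. \<exists>x\<in>ker M. support V x \<noteq> {}}"
    have "(of_int p - 1) * real (card ?U) = (\<Sum>M\<in>?U. of_int p - 1)" by simp
    also have "\<dots> \<le> (\<Sum>M\<in>?U. real (card (nz M)))"
    proof (rule sum_mono)
      fix M assume "M \<in> ?U"
      then show "of_int p - 1 \<le> real (card (nz M))"
        using card_nonzero_kernel_ge[OF V(1) _ p(1)] unfolding nz_def ker_def MT_def by blast
    qed
    also have "\<dots> \<le> (\<Sum>M\<in>MT. real (card (nz M)))" using finMT by (intro sum_mono2) auto
    also have "\<dots> = G + B" unfolding G_def B_def sum.distrib[symmetric] using nz_split by (intro sum.cong) auto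
    also have "\<dots> \<le> 3 * W" by (rule GB)
    finally show "(of_int p - 1) * real (card {M \<in> matching_tuples d V. \<exists>x\<in>solutions p d V M (\<lambda>_. 0). support V x \<noteq> {}})
      \<le> 3 * real (card (matching_tuples d V))" by (simp add: MT_def ker_def W_def)
  qed
qed


lemma real_of_int_mat_singular_kernel:
  fixes A :: "int mat"
  assumes A: "A \<in> carrier_mat n n" and sing: "\<not> invertible_mat (map_mat real_of_int A)"
  obtains v where "v \<in> carrier_vec n" "v \<noteq> 0\<^sub>v n" "A *\<^sub>v v = 0\<^sub>v n"
proof -
  have carr: "map_mat real_of_int A \<in> carrier_mat n n" using A by simp
  have "det (map_mat real_of_int A) = 0"
  proof (rule ccontr)
    assume "det (map_mat real_of_int A) \<noteq> 0"
    then obtain B where "inverts_mat (map_mat real_of_int A) B" "inverts_mat B (map_mat real_of_int A)"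
      using det_non_zero_imp_unit[OF carr, of "()"] carr unfolding Units_def ring_mat_def inverts_mat_def by auto
    then have "invertible_mat (map_mat real_of_int A)" using carr unfolding invertible_mat_def by auto
    then show False using sing by simp
  qed
  then have "real_of_int (det A) = 0" by (simp only: of_int_hom.hom_det)
  then have "det A = 0" by simp
  then show ?thesis using det_0_iff_vec_prod_zero[OF A] that by blast
qed

lemma primitive_multiple:
  fixes v :: "'a \<Rightarrow> int" and p :: int
  assumes p: "p > 1" and V: "finite V" and nz: "\<exists>j\<in>V. v j \<noteq> 0"
  obtains w m where "m \<noteq> 0" "\<And>j. j \<in> V \<Longrightarrow> v j = m * w j" "\<exists>j\<in>V. \<not> p dvd w j"
proof -
  define m where "m = Gcd (v ` V)"
  obtain j0 where j0: "j0 \<in> V" "v j0 \<noteq> 0" using nz by blast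
  have m_dvd: "m dvd v j" if "j \<in> V" for j using that by (simp add: m_def)
  have m0: "m \<noteq> 0" using j0 by (auto simp: m_def)
  define w where "w = (\<lambda>j. v j div m)"
  have vw: "v j = m * w j" if "j \<in> V" for j using m_dvd[OF that] by (simp add: w_def)
  have "\<exists>j\<in>V. \<not> p dvd w j"
  proof (rule ccontr)
    assume "\<not> ?thesis"
    then have mp: "m * p dvd v j" if "j \<in> V" for j using vw[OF that] that by (simp add: mult_dvd_mono)
    have "m * p dvd Gcd (v ` V)" by (rule Gcd_greatest) (use mp in blast)
    then have "m * p dvd m" by (simp only: m_def[symmetric])
    then have "p dvd 1" using m0 by (metis dvd_times_left_cancel_iff mult.right_neutral)
    then show False using p by (simp add: zdvd1_eq)
  qed
  then show ?thesis using that m0 vw by blast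
qed

section \<open>The adjacency matrix of the random graph\<close>

text \<open>
  A singular integer matrix has an integral kernel vector, and after division by the greatest common divisor of its entries this
  vector is nonzero modulo \<open>p\<close>.
\<close>

lemma singular_graph_kernel_mod_p:
  fixes p :: int
  assumes p: "prime p" and M: "M \<in> matching_tuples d {1..n}"
    and sing: "\<not> invertible_mat (adjacency_matrix n (\<Sum>k<d. mset_set ((\<lambda>i. {i, M k i}) ` {1..n})))"
  shows "\<exists>x\<in>solutions p d {1..n} M (\<lambda>_. 0). support {1..n} x \<noteq> {}"
proof -
  let ?V = "{1..n}"
  have p1: "p > 1" using p by (simp add: prime_gt_1_int)
  have Mk: "M k \<in> fpf_involutions ?V" if "k < d" for k using M that by (auto simp: matching_tuples_def)
  have pm: "(\<lambda>i. {i, M k i}) ` ?V \<in> perfect_matchings n" if "k < d" for k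
    using bij_betw_apply[OF bij_betw_involutions_perfect_matchings] Mk[OF that] by (simp add: fpf_involutions_def)
  have edge: "{a, b} \<in> (\<lambda>i. {i, M k i}) ` ?V \<longleftrightarrow> M k a = b" if "k < d" "a \<in> ?V" for k a b
  proof
    assume "{a, b} \<in> (\<lambda>i. {i, M k i}) ` ?V"
    then obtain i where "{a, b} = {i, M k i}" by blast
    then show "M k a = b" using fpf_involutionsD(1)[OF Mk[OF that(1)], of i] by (auto simp: doubleton_eq_iff)
  next
    assume "M k a = b"
    then show "{a, b} \<in> (\<lambda>i. {i, M k i}) ` ?V" using that(2) by blast
  qed
  define A :: "int mat" where "A = mat n n (\<lambda>(i, j). \<Sum>k<d. of_bool (M k (i + 1) = j + 1))"
  have A: "A \<in> carrier_mat n n" by (simp add: A_def)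
  have "adjacency_matrix n (\<Sum>k<d. mset_set ((\<lambda>i. {i, M k i}) ` ?V)) = map_mat real_of_int A"
  proof (rule eq_matI)
    fix i j assume ij: "i < dim_row (map_mat real_of_int A)" "j < dim_col (map_mat real_of_int A)"
    then have ij': "i < n" "j < n" by (simp_all add: A_def)
    have "adjacency_matrix n (\<Sum>k<d. mset_set ((\<lambda>i. {i, M k i}) ` ?V)) $$ (i, j) =
        (\<Sum>k<d. of_bool ({i + 1, j + 1} \<in> (\<lambda>i. {i, M k i}) ` ?V))"
      by (rule adjacency_matrix_union_matchings[OF pm ij'])
    also have "\<dots> = (\<Sum>k<d. of_bool (M k (i + 1) = j + 1))"
      using ij' by (intro sum.cong refl arg_cong[where f = of_bool] edge) auto
    also have "\<dots> = map_mat real_of_int A $$ (i, j)" using ij' by (simp add: A_def)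
    finally show "adjacency_matrix n (\<Sum>k<d. mset_set ((\<lambda>i. {i, M k i}) ` ?V)) $$ (i, j) = map_mat real_of_int A $$ (i, j)" .
  qed (simp_all add: A_def adjacency_matrix_def)
  then obtain v where v: "v \<in> carrier_vec n" "v \<noteq> 0\<^sub>v n" "A *\<^sub>v v = 0\<^sub>v n"
    using real_of_int_mat_singular_kernel[OF A] sing by metis
  define u where "u = (\<lambda>j::nat. v $ (j - 1))"
  have sumu: "(\<Sum>k<d. u (M k i)) = 0" if i: "i \<in> ?V" for i
  proof -
    have i': "i - 1 < n" "i - 1 + 1 = i" using i by auto
    have "(A *\<^sub>v v) $ (i - 1) = (\<Sum>j<n. (\<Sum>k<d. of_bool (M k i = j + 1)) * v $ j)"
      using i' v(1) A by (simp add: scalar_prod_def A_def atLeast0LessThan)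
    also have "\<dots> = (\<Sum>k<d. \<Sum>j<n. of_bool (M k i = j + 1) * v $ j)"
      by (simp only: sum_distrib_right sum.swap[of _ "{..<d}"])
    also have "\<dots> = (\<Sum>k<d. u (M k i))"
    proof (rule sum.cong[OF refl])
      fix k assume "k \<in> {..<d}"
      then have "M k i \<in> ?V" using fpf_involutionsD(2)[OF Mk i] by simp
      then have "M k i - 1 \<in> {..<n}" and m1: "M k i = j + 1 \<longleftrightarrow> M k i - 1 = j" for j by auto
      then show "(\<Sum>j<n. of_bool (M k i = j + 1) * v $ j) = u (M k i)"
        unfolding u_def m1 of_bool_def by (simp add: if_distrib[of "\<lambda>c. c * _"] cong: if_cong)
    qed
    finally show ?thesis using v(3) i' by simp
  qed
  have ex: "\<exists>j\<in>?V. u j \<noteq> 0"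
  proof (rule ccontr)
    assume none: "\<not> ?thesis"
    have "v $ j = 0" if "j < n" for j
    proof -
      have "j + 1 \<in> ?V" using that by simp
      then have "u (j + 1) = 0" using none by blast
      then show ?thesis by (simp add: u_def)
    qed
    then have "v = 0\<^sub>v n" using v(1) by (intro eq_vecI) auto
    then show False using v(2) by simp
  qed
  obtain w m where m: "m \<noteq> 0" and w: "\<And>j. j \<in> ?V \<Longrightarrow> u j = m * w j" and ndvd: "\<exists>j\<in>?V. \<not> p dvd w j"
    by (rule primitive_multiple[OF p1 finite_atLeastAtMost ex]) (use that in blast)
  have sumw: "(\<Sum>k<d. w (M k i)) = 0" if i: "i \<in> ?V" for i
  proof -
    have "m * (\<Sum>k<d. w (M k i)) = (\<Sum>k<d. u (M k i))"
      unfolding sum_distrib_left using matching_tuples_in[OF M _ i] w by (intro sum.cong) auto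
    then show ?thesis using sumu[OF i] m by simp
  qed
  define x where "x = (\<lambda>j\<in>?V. w j mod p)"
  have "neighbour_sum p d M x i = 0" if i: "i \<in> ?V" for i
  proof -
    have "(\<Sum>k<d. x (M k i)) = (\<Sum>k<d. w (M k i) mod p)"
      using matching_tuples_in[OF M _ i] by (intro sum.cong) (auto simp: x_def)
    then show ?thesis unfolding neighbour_sum_def using sumw[OF i] by (simp add: mod_sum_eq)
  qed
  then have "x \<in> solutions p d ?V M (\<lambda>_. 0)" using p1 by (simp add: solutions_def x_def residues_def)
  moreover have "support ?V x \<noteq> {}" using ndvd by (auto simp: support_def x_def dvd_eq_mod_eq_0)
  ultimately show ?thesis by blast
qed

text \<open>
  Perfect matchings, as sets of edges, correspond to fixed point free involutions, so the probability is a quotient of two cardinalities.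
\<close>

lemma prob_singular_le:
  fixes p :: int
  assumes n: "even n" and p: "prime p"
  shows "measure_pmf.prob (random_regular_graph d n) {H. \<not> invertible_mat (adjacency_matrix n H)} \<le>
    real (card {M \<in> matching_tuples d {1..n}. \<exists>x\<in>solutions p d {1..n} M (\<lambda>_. 0). support {1..n} x \<noteq> {}}) /
    real (card (matching_tuples d {1..n}))"
proof -
  let ?V = "{1..n}"
  let ?PM = "perfect_matchings n"
  let ?I = "fpf_involutions ?V"
  define f :: "(nat \<Rightarrow> nat) \<Rightarrow> nat set set" where "f = (\<lambda>\<sigma>. (\<lambda>i. {i, \<sigma> i}) ` ?V)"
  have bij: "bij_betw f ?I ?PM"
    using bij_betw_involutions_perfect_matchings[of n] unfolding f_def fpf_involutions_def .
  define \<Omega> where "\<Omega> = PiE_dflt {..<d} {} (\<lambda>_. ?PM)"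
  define bad where "bad = {N. \<not> invertible_mat (adjacency_matrix n (\<Sum>k<d. mset_set (N k)))}"
  let ?U = "{M \<in> matching_tuples d ?V. \<exists>x\<in>solutions p d ?V M (\<lambda>_. 0). support ?V x \<noteq> {}}"
  have PM: "finite ?PM" "?PM \<noteq> {}" using finite_perfect_matchings perfect_matchings_nonempty[OF n] by auto
  have law: "Pi_pmf {..<d} {} (\<lambda>_. pmf_of_set ?PM) = pmf_of_set \<Omega>"
    unfolding \<Omega>_def using PM by (intro Pi_pmf_of_set) auto
  have fin\<Omega>: "finite \<Omega>" unfolding \<Omega>_def using PM by (intro finite_PiE_dflt) auto
  have card\<Omega>: "card \<Omega> = card (matching_tuples d ?V)"
  proof -
    have "card \<Omega> = card ?PM ^ d" unfolding \<Omega>_def using PM by (simp add: card_PiE_dflt)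
    also have "card ?PM = card ?I" using bij_betw_same_card[OF bij] by simp
    finally show ?thesis by (simp add: matching_tuples_def card_PiE)
  qed
  have "card ?PM > 0" using PM by (simp add: card_gt_0_iff)
  then have "\<Omega> \<noteq> {}" using card_PiE_dflt[of "{..<d}" "\<lambda>_. ?PM" "{}"] PM unfolding \<Omega>_def by fastforce
  have "measure_pmf.prob (random_regular_graph d n) {H. \<not> invertible_mat (adjacency_matrix n H)} =
      measure_pmf.prob (pmf_of_set \<Omega>) bad"
    unfolding random_regular_graph_def law by (simp add: bad_def vimage_def)
  also have "\<dots> = real (card (\<Omega> \<inter> bad)) / real (card \<Omega>)"
    by (rule measure_pmf_of_set[OF \<open>\<Omega> \<noteq> {}\<close> fin\<Omega>])
  also have "\<dots> \<le> real (card ?U) / real (card \<Omega>)"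
  proof (intro divide_right_mono of_nat_mono)
    let ?\<phi> = "\<lambda>N. \<lambda>k\<in>{..<d}. inv_into ?I f (N k)"
    have N\<Omega>: "N k \<in> ?PM" if "N \<in> \<Omega>" "k < d" for N k using that by (simp add: \<Omega>_def PiE_dflt_def)
    have fi: "f (inv_into ?I f (N k)) = N k" "inv_into ?I f (N k) \<in> ?I" if "N \<in> \<Omega>" "k < d" for N k
    proof -
      have "N k \<in> f ` ?I" using N\<Omega>[OF that] bij_betw_imp_surj_on[OF bij] by simp
      then show "f (inv_into ?I f (N k)) = N k" "inv_into ?I f (N k) \<in> ?I"
        by (simp_all only: f_inv_into_f inv_into_into)
    qed
    have "inj_on ?\<phi> (\<Omega> \<inter> bad)"
    proof (rule inj_onI, rule ext)
      fix N N' k assume N: "N \<in> \<Omega> \<inter> bad" "N' \<in> \<Omega> \<inter> bad" and e: "?\<phi> N = ?\<phi> N'"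
      show "N k = N' k"
      proof (cases "k < d")
        case True
        then have eq: "inv_into ?I f (N k) = inv_into ?I f (N' k)" using fun_cong[OF e, of k] by simp
        have N\<Omega>: "N \<in> \<Omega>" "N' \<in> \<Omega>" using N by simp_all
        show ?thesis
          by (rule box_equals[OF arg_cong[OF eq, of f] fi(1)[OF N\<Omega>(1) True] fi(1)[OF N\<Omega>(2) True]])
      next
        case False
        then show ?thesis using N by (simp add: \<Omega>_def PiE_dflt_def)
      qed
    qed
    moreover have "?\<phi> ` (\<Omega> \<inter> bad) \<subseteq> ?U"
    proof (rule image_subsetI)
      fix N assume N: "N \<in> \<Omega> \<inter> bad"
      have Mt: "?\<phi> N \<in> matching_tuples d ?V" using fi(2)[of N] N by (simp add: matching_tuples_def)
      have "(\<Sum>k<d. mset_set ((\<lambda>i. {i, ?\<phi> N k i}) ` ?V)) = (\<Sum>k<d. mset_set (N k))"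
      proof (rule sum.cong[OF refl])
        fix k assume "k \<in> {..<d}"
        then show "mset_set ((\<lambda>i. {i, ?\<phi> N k i}) ` ?V) = mset_set (N k)"
          using fi(1)[of N k] N by (simp add: f_def)
      qed
      then have "\<not> invertible_mat (adjacency_matrix n (\<Sum>k<d. mset_set ((\<lambda>i. {i, ?\<phi> N k i}) ` ?V)))"
        using N by (simp add: bad_def)
      then show "?\<phi> N \<in> ?U" using singular_graph_kernel_mod_p[OF p Mt] Mt by blast
    qed
    ultimately show "card (\<Omega> \<inter> bad) \<le> card ?U" by (rule card_inj_on_le) simp
  qed simp
  finally show ?thesis unfolding card\<Omega> .
qed

theorem theorem1p7:
  fixes d :: nat
  assumes "d \<ge> 3"
  shows "(\<lambda>n. measure_pmf.prob (random_regular_graph d n)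
                {H. \<not> invertible_mat (adjacency_matrix n H)})
           \<in> o[at_top \<sqinter> principal {n. even n}](\<lambda>_. 1)"
proof (rule landau_o.smallI)
  fix c :: real assume c: "c > 0"
  obtain q :: nat where q: "prime q" "q > max 17 (max d (nat \<lceil>3 / c\<rceil> + 1))" using bigger_prime by blast
  define p where "p = int q"
  have p: "prime p" "p \<ge> 17" using q by (auto simp: p_def)
  have pd: "\<not> p dvd int d" using q assms by (auto simp: p_def dest: dvd_imp_le)
  have "3 / c \<le> of_int p - 1"
  proof -
    have "3 / c \<le> real (nat \<lceil>3 / c\<rceil>)" by linarith
    also have "\<dots> \<le> of_int p - 1" using q(2) by (simp add: p_def)
    finally show ?thesis .
  qed
  then have pc: "3 \<le> c * (of_int p - 1)" using c by (simp add: pos_divide_le_eq mult.commute)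
  obtain n1 where n1: "\<And>V :: nat set. finite V \<Longrightarrow> even (card V) \<Longrightarrow> card V \<ge> n1 \<Longrightarrow>
    (of_int p - 1) * real (card {M \<in> matching_tuples d V. \<exists>x\<in>solutions p d V M (\<lambda>_. 0). support V x \<noteq> {}})
      \<le> 3 * real (card (matching_tuples d V))"
    using singular_mod_p_rare[OF assms p(1) pd p(2), where ?'v = nat] by auto
  have "measure_pmf.prob (random_regular_graph d n) {H. \<not> invertible_mat (adjacency_matrix n H)} \<le> c"
    if n: "n \<ge> n1" "even n" for n
  proof -
    let ?U = "{M \<in> matching_tuples d {1..n}. \<exists>x\<in>solutions p d {1..n} M (\<lambda>_. 0). support {1..n} x \<noteq> {}}"
    let ?W = "real (card (matching_tuples d {1..n}))"
    have W: "?W > 0" using n odd_fact_pos[of n] by (simp add: card_matching_tuples)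
    have "(of_int p - 1) * real (card ?U) \<le> 3 * ?W" using n1[of "{1..n}"] n by simp
    also have "\<dots> \<le> (c * (of_int p - 1)) * ?W" by (rule mult_right_mono[OF pc]) simp
    finally have "(of_int p - 1) * real (card ?U) \<le> (of_int p - 1) * (c * ?W)" by (simp only: mult_ac)
    then have "real (card ?U) \<le> c * ?W" using p(2) by (subst (asm) mult_le_cancel_left_pos) auto
    then have "real (card ?U) / ?W \<le> c" using W by (simp add: pos_divide_le_eq)
    then show ?thesis using prob_singular_le[OF n(2) p(1), of d] by linarith
  qed
  then have "eventually (\<lambda>n. even n \<longrightarrow> measure_pmf.prob (random_regular_graph d n)
      {H. \<not> invertible_mat (adjacency_matrix n H)} \<le> c) at_top"
    unfolding eventually_at_top_linorder by blast
  then show "eventually (\<lambda>n. norm (measure_pmf.prob (random_regular_graph d n)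
      {H. \<not> invertible_mat (adjacency_matrix n H)}) \<le> c * norm (1::real)) (at_top \<sqinter> principal {n. even n})"
    by (simp add: eventually_inf_principal)
qed

end
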